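(* Let $U\subset\mathbb{R}^{2m}$ be open and let $\phi:U\to\mathbb{C}$ be holomorphic with respect to some Hermitian structure $J$ on $U$. (In particular, if $\phi$ is harmonic, it is a harmonic morphism.) Let $q_0\in U$ be a regular point of $\phi$. (i) By a permutation of the coordinates $(q^i,q^{\bar i})$, we can assume that $J(q_0)$ is positive and lies in a large cell, so that $J(q_0)=J(M)$ for some $M\in so(m,\mathbb{C})$. (ii) Then in some neighbourhood $U'\subset U$ of $q_0$, the map $\phi$ is the first component $z^1$ of a smooth solution $U'\to\mathbb{C}^k$, $q\mapsto z(q)$, to an equation $F(q,z)=0$ with $F(q,z)\equiv f(q-M(z)\bar q,\,z)$, where $k$ is an integer, $1\le k\le m$, and $f:\mathbb{C}^m\times\mathbb{C}^k\supset W\to\mathbb{C}^k$ and $M:\mathbb{C}^k\supset V\to so(m,\mathbb{C})$ are holomorphic maps on open sets $W$, $V$. The Laplacian of $\phi=z^1$ is then given by the case $a=1$ of $$\tfrac14\Delta z^a=-\sum_{i,j=1}^m\sum_{b=1}^k A^a_iA^b_j\frac{\partial M^i_{\bar j}}{\partial z^b},\qquad A^a_i=\frac{\partial z^a}{\partial q^i}.$$ (iii) We can choose $k=m$ and $f$ of the form $f(w,z)=w-h(z)$, where $h:\mathbb{C}^m\supset V\to\mathbb{C}^m$ is holomorphic and of rank $m$ everywhere. The Laplacian of $\phi$ is then given by the case $a=1$ of $$\tfrac14\Delta z^a=\frac{(-1)^a}{\det K}\sum_{1\le i<j\le m}(-1)^{i+j-1}D^a_{ij},$$ where $K=(K^b_c)$,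 $K^b_c=\partial F^b/\partial z^c$ evaluated at $(q,z(q))$, and $D^a_{ij}$ is the determinant of the $(m-1)\times(m-1)$ matrix with columns indexed by $c\in\{1,\dots,m\}\setminus\{a\}$ (in increasing order), whose first row is $\left(\partial M^i_{\bar j}/\partial z^c\right)_{c}$ and whose remaining rows are $(K^{l}_c)_c$ for $l\in\{1,\dots,m\}\setminus\{i,j\}$ in increasing order.
   Context: Identify $\mathbb{R}^{2m}=\mathbb{C}^m$ by $q^j=x^{2j-1}+\mathrm{i}x^{2j}$, and write $q^{\bar j}=\overline{q^j}$, $\bar q=(q^{\bar1},\dots,q^{\bar m})$. $\Delta=\sum_{i=1}^{2m}\partial^2/(\partial x^i)^2$. A harmonic morphism $\phi:U\to\mathbb{C}$ is a smooth map with $\Delta\phi=0$ and $\sum_i(\partial\phi/\partial x^i)^2=0$. An almost Hermitian structure on an open set is a smooth field $J$ of orthogonal endomorphisms of the tangent spaces with $J^2=-I$; it is Hermitian if integrable. It is positive at a point if there is an oriented orthonormal basis $e_1,\dots,e_{2m}$ with $e_{2j}=Je_{2j-1}$. $\phi$ is $J$-holomorphic if $d\phi(JX)=\mathrm{i}\,d\phi(X)$ for all $X$. $so(m,\mathbb{C})$ is the space of skew-symmetric complex $m\times m$ matrices $M=(M^i_{\bar j})$, and $M\bar q$ has components $\sum_jM^i_{\bar j}q^{\bar j}$. For $M\in so(m,\mathbb{C})$, $J(M)$ is the positive almost Hermitian structure at a point whose $(1,0)$-cotangent space is spanned by $dq^i-\sum_jM^i_{\bar j}dq^{\bar j}$ $(i=1,\dots,m)$;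 equivalently its $(-\mathrm{i})$-eigenspace on complexified tangent vectors is spanned by $\partial/\partial q^{\bar i}+\sum_jM^j_{\bar i}\partial/\partial q^j$. The set of structures of the form $J(M)$ is called a large cell; it is a dense subset of the set of positive almost Hermitian structures at the point. In (i), a permutation of the coordinates $(q^i,q^{\bar i})$ means one compatible with conjugation (e.g. interchanging $q^i$ and $q^{\bar i}$ for some indices $i$), and positivity is with respect to the orientation defined by the new coordinates.
   Formalization: In (iii), "h of rank m everywhere" is proved for h(z) − (q₀ − M(z)q̄₀), i.e. for h in coordinates centred at q₀ (h itself if q₀ = 0). For q₀ ≠ 0 it can fail: m = 2, q₀ = (1,0), φ = |q|²/q̄¹, M¹₂ = −q²/q̄¹ force h = (z¹,0), of rank 1. *)

theory Defs
  imports "HOL-Analysis.Analysis" "Jordan_Normal_Form.Determinant"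
begin

no_notation Matrix.vec_index (infixl \<open>$\<close> 100)
no_notation Matrix.scalar_prod (infix \<open>\<bullet>\<close> 70)

text \<open>
  The space R^{2m} = C^m is \<open>complex^'m\<close> with its library structure of a real Euclidean space, for
  which the vectors \<open>axis j 1\<close>, \<open>axis j \<i>\<close> (the directions of the real coordinates \<open>Re (q $ j)\<close>,
  \<open>Im (q $ j)\<close>) form the standard orthonormal basis. The index type \<open>'m\<close> is finite and linearly
  ordered; \<open>idx\<close> numbers it increasingly by 1, ..., m.
\<close>

type_synonym 'm cspace = "complex^'m"
type_synonym 'm cmatrix = "complex^'m^'m"

definition idx :: "'m::{finite,linorder} \<Rightarrow> nat" where
  "idx i = card {j. j \<le> i}"

text \<open>C^k, for k at most m, as the space of vectors whose components after the k-th vanish.\<close>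

definition Cpow :: "nat \<Rightarrow> 'm::{finite,linorder} cspace set" where
  "Cpow k = {z. \<forall>i. k < idx i \<longrightarrow> z $ i = 0}"

definition vcnj :: "'m::finite cspace \<Rightarrow> 'm cspace" where
  "vcnj q = (\<chi> i. cnj (q $ i))"


subsection \<open>Smooth maps, Laplacian, harmonic morphisms\<close>

text \<open>Both definitions are meant for open \<open>S\<close>.\<close>

primrec Ck_on :: "nat \<Rightarrow> ('a::real_normed_vector \<Rightarrow> 'b::real_normed_vector) \<Rightarrow> 'a set \<Rightarrow> bool" where
  "Ck_on 0 f S \<longleftrightarrow> continuous_on S f"
| "Ck_on (Suc n) f S \<longleftrightarrow> (\<forall>x\<in>S. f differentiable (at x)) \<and>
     (\<forall>v. Ck_on n (\<lambda>x. frechet_derivative f (at x) v) S)"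

definition smooth_on :: "'a::real_normed_vector set \<Rightarrow> ('a \<Rightarrow> 'b::real_normed_vector) \<Rightarrow> bool" where
  "smooth_on S f \<longleftrightarrow> (\<forall>n. Ck_on n f S)"

definition laplacian :: "('a::euclidean_space \<Rightarrow> complex) \<Rightarrow> 'a \<Rightarrow> complex" where
  "laplacian g q = (\<Sum>e\<in>Basis. frechet_derivative (\<lambda>x. frechet_derivative g (at x) e) (at q) e)"

definition harmonic_morphism_on :: "'a::euclidean_space set \<Rightarrow> ('a \<Rightarrow> complex) \<Rightarrow> bool" where
  "harmonic_morphism_on U \<phi> \<longleftrightarrow> smooth_on U \<phi> \<and>
     (\<forall>q\<in>U. laplacian \<phi> q = 0 \<and> (\<Sum>e\<in>Basis. (frechet_derivative \<phi> (at q) e)\<^sup>2) = 0)"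


subsection \<open>Almost Hermitian and Hermitian structures\<close>

definition almost_hermitian_at :: "('a::euclidean_space \<Rightarrow> 'a) \<Rightarrow> bool" where
  "almost_hermitian_at J0 \<longleftrightarrow> orthogonal_transformation J0 \<and> (\<forall>X. J0 (J0 X) = - X)"

definition almost_hermitian_on :: "'a::euclidean_space set \<Rightarrow> ('a \<Rightarrow> 'a \<Rightarrow> 'a) \<Rightarrow> bool" where
  "almost_hermitian_on U J \<longleftrightarrow>
     (\<forall>q\<in>U. almost_hermitian_at (J q)) \<and> (\<forall>X. smooth_on U (\<lambda>q. J q X))"

definition J_holomorphic_on ::
    "'a::euclidean_space set \<Rightarrow> ('a \<Rightarrow> 'a \<Rightarrow> 'a) \<Rightarrow> ('a \<Rightarrow> complex) \<Rightarrow> bool" where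
  "J_holomorphic_on U J \<phi> \<longleftrightarrow> smooth_on U \<phi> \<and>
     (\<forall>q\<in>U. \<forall>X. frechet_derivative \<phi> (at q) (J q X) = \<i> * frechet_derivative \<phi> (at q) X)"

text \<open>
  Integrable: \<open>J\<close> comes from a structure of complex manifold, that is, there are complex charts
  (diffeomorphisms onto open subsets of C^m) with \<open>J\<close>-holomorphic components around every point.
\<close>

definition integrable_acs_on ::
    "'m::finite cspace set \<Rightarrow> ('m cspace \<Rightarrow> 'm cspace \<Rightarrow> 'm cspace) \<Rightarrow> bool" where
  "integrable_acs_on U J \<longleftrightarrow> (\<forall>p\<in>U. \<exists>N \<zeta> :: 'm cspace \<Rightarrow> 'm cspace.
     open N \<and> p \<in> N \<and> N \<subseteq> U \<and>
     smooth_on N \<zeta> \<and> inj_on \<zeta> N \<and> open (\<zeta> ` N) \<and> smooth_on (\<zeta> ` N) (inv_into N \<zeta>) \<and>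
     (\<forall>i. J_holomorphic_on N J (\<lambda>q. \<zeta> q $ i)))"

definition hermitian_on ::
    "'m::finite cspace set \<Rightarrow> ('m cspace \<Rightarrow> 'm cspace \<Rightarrow> 'm cspace) \<Rightarrow> bool" where
  "hermitian_on U J \<longleftrightarrow> almost_hermitian_on U J \<and> integrable_acs_on U J"

text \<open>
  \<open>Inl j\<close> stands for the (2j-1)-st and \<open>Inr j\<close> for the 2j-th real coordinate, respectively
  basis vector; the determinant does not depend on how \<open>'m + 'm\<close> is enumerated.
\<close>

definition real_coord :: "'m::finite cspace \<Rightarrow> 'm + 'm \<Rightarrow> real" where
  "real_coord v r = (case r of Inl j \<Rightarrow> Re (v $ j) | Inr j \<Rightarrow> Im (v $ j))"

definition oriented_orthonormal_basis :: "('m::finite + 'm \<Rightarrow> 'm cspace) \<Rightarrow> bool" where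
  "oriented_orthonormal_basis e \<longleftrightarrow>
     (\<forall>r s. e r \<bullet> e s = (if r = s then 1 else 0)) \<and>
     Determinants.det ((\<chi> r s. real_coord (e s) r) :: real^('m + 'm)^('m + 'm)) > 0"

definition positive_acs :: "('m::finite cspace \<Rightarrow> 'm cspace) \<Rightarrow> bool" where
  "positive_acs J0 \<longleftrightarrow>
     (\<exists>e. oriented_orthonormal_basis e \<and> (\<forall>j. e (Inr j) = J0 (e (Inl j))))"


subsection \<open>The structures J(M)\<close>

definition so_complex :: "'m::finite cmatrix set" where
  "so_complex = {A. Finite_Cartesian_Product.transpose A = - A}"

definition cotangent10 :: "('m::finite cspace \<Rightarrow> 'm cspace) \<Rightarrow> ('m cspace \<Rightarrow> complex) set" where
  "cotangent10 J0 = {\<alpha>. linear \<alpha> \<and> (\<forall>X. \<alpha> (J0 X) = \<i> * \<alpha> X)}"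

text \<open>The i-th one is the form \<open>dq^i - (\<Sum>j. M^i_j dq^{\bar j})\<close>.\<close>

definition theta :: "'m::finite cmatrix \<Rightarrow> 'm \<Rightarrow> 'm cspace \<Rightarrow> complex" where
  "theta M i X = X $ i - (\<Sum>j\<in>UNIV. M $ i $ j * cnj (X $ j))"

text \<open>\<open>is_J_of M J0\<close> says that \<open>J0\<close> is the structure J(M).\<close>

definition is_J_of :: "'m::finite cmatrix \<Rightarrow> ('m cspace \<Rightarrow> 'm cspace) \<Rightarrow> bool" where
  "is_J_of M J0 \<longleftrightarrow> almost_hermitian_at J0 \<and> positive_acs J0 \<and>
     cotangent10 J0 = {(\<lambda>X. \<Sum>i\<in>UNIV. c i * theta M i X) | c. True}"

definition large_cell :: "('m::finite cspace \<Rightarrow> 'm cspace) set" where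
  "large_cell = {J0. \<exists>M\<in>so_complex. is_J_of M J0}"


subsection \<open>Permutations of the coordinates\<close>

text \<open>
  The new i-th complex coordinate is an old coordinate or the conjugate of one. Geometric objects are
  carried over to the new coordinates by the real-linear isometry \<open>T\<close>: the set \<open>U\<close> to
  \<open>T ` U\<close>, the function \<open>\<phi>\<close> to \<open>\<phi> \<circ> inv_into UNIV T\<close>, and \<open>J\<close> to \<open>push_acs T J\<close>. In particular, positivity
  of \<open>push_acs T J\<close> is positivity of \<open>J\<close> for the orientation defined by the new coordinates.
\<close>

definition coordinate_permutation :: "('m::finite cspace \<Rightarrow> 'm cspace) \<Rightarrow> bool" where
  "coordinate_permutation T \<longleftrightarrow> (\<exists>\<pi> S. \<pi> permutes UNIV \<and>
     T = (\<lambda>q. \<chi> i. if i \<in> S then cnj (q $ \<pi> i) else q $ \<pi> i))"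

definition push_acs :: "('m::finite cspace \<Rightarrow> 'm cspace) \<Rightarrow>
    ('m cspace \<Rightarrow> 'm cspace \<Rightarrow> 'm cspace) \<Rightarrow> 'm cspace \<Rightarrow> 'm cspace \<Rightarrow> 'm cspace" where
  "push_acs T J p X = T (J (inv_into UNIV T p) (inv_into UNIV T X))"


subsection \<open>Holomorphic maps and partial derivatives\<close>

text \<open>
  Holomorphic functions on an open subset \<open>S\<close> of a complex vector space \<open>E\<close>, given as a subspace of
  an ambient space on which \<open>I\<close> is multiplication by the imaginary unit.
\<close>

definition holomorphic_in ::
    "('a::real_normed_vector \<Rightarrow> 'a) \<Rightarrow> 'a set \<Rightarrow> 'a set \<Rightarrow> ('a \<Rightarrow> complex) \<Rightarrow> bool" where
  "holomorphic_in I E S f \<longleftrightarrow> openin (top_of_set E) S \<and>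
     (\<forall>x\<in>S. \<exists>D. (f has_derivative D) (at x within E) \<and> (\<forall>v\<in>E. D (I v) = \<i> * D v))"

definition mult_i :: "'m::finite cspace \<Rightarrow> 'm cspace" where
  "mult_i v = \<i> *s v"

definition mult_i2 :: "'m::finite cspace \<times> 'm cspace \<Rightarrow> 'm cspace \<times> 'm cspace" where
  "mult_i2 = map_prod mult_i mult_i"

text \<open>The Wirtinger derivative \<open>\<partial>g/\<partial>q^i\<close>.\<close>

definition wirtinger :: "('m::finite cspace \<Rightarrow> complex) \<Rightarrow> 'm \<Rightarrow> 'm cspace \<Rightarrow> complex" where
  "wirtinger g i q =
     (frechet_derivative g (at q) (axis i 1) - \<i> * frechet_derivative g (at q) (axis i \<i>)) / 2"

text \<open>
  The complex partial derivative \<open>\<partial>g/\<partial>z^c\<close> of a holomorphic function; for functions on C^k it is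
  only meaningful for the first k indices \<open>c\<close>.
\<close>

definition cpartial :: "('m::finite cspace \<Rightarrow> complex) \<Rightarrow> 'm \<Rightarrow> 'm cspace \<Rightarrow> complex" where
  "cpartial g c z = deriv (\<lambda>t. g (z + t *s axis c 1)) 0"

definition cjacobian :: "('m::finite cspace \<Rightarrow> 'm cspace) \<Rightarrow> 'm cspace \<Rightarrow> 'm cmatrix" where
  "cjacobian g z = (\<chi> b c. cpartial (\<lambda>z. g z $ b) c z)"


subsection \<open>The implicit equation\<close>

definition eqF :: "('m::finite cspace \<times> 'm cspace \<Rightarrow> 'm cspace) \<Rightarrow> ('m cspace \<Rightarrow> 'm cmatrix) \<Rightarrow>
    'm cspace \<Rightarrow> 'm cspace \<Rightarrow> 'm cspace" where
  "eqF f M q z = f (q - M z *v vcnj q, z)"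

definition Kmat :: "('m::finite cspace \<times> 'm cspace \<Rightarrow> 'm cspace) \<Rightarrow> ('m cspace \<Rightarrow> 'm cmatrix) \<Rightarrow>
    'm cspace \<Rightarrow> 'm cspace \<Rightarrow> 'm cmatrix" where
  "Kmat f M q z = cjacobian (eqF f M q) z"

text \<open>
  \<open>z : U' \<rightarrow> C^k\<close> is a smooth solution of \<open>F(q,z) = 0\<close>. The last conjunct, nonsingularity of
  the k by k matrix \<open>\<partial>F/\<partial>z\<close> along the solution, makes the equation determine the solution
  locally; it excludes degenerate equations such as \<open>F = 0\<close> identically.
\<close>

definition implicit_solution :: "nat \<Rightarrow>
    ('m::{finite,linorder} cspace \<times> 'm cspace) set \<Rightarrow>
    ('m cspace \<times> 'm cspace \<Rightarrow> 'm cspace) \<Rightarrow>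
    'm cspace set \<Rightarrow> ('m cspace \<Rightarrow> 'm cmatrix) \<Rightarrow>
    'm cspace set \<Rightarrow> ('m cspace \<Rightarrow> 'm cspace) \<Rightarrow> bool" where
  "implicit_solution k W f V M U' z \<longleftrightarrow>
     f ` W \<subseteq> Cpow k \<and> (\<forall>b. holomorphic_in mult_i2 (UNIV \<times> Cpow k) W (\<lambda>x. f x $ b)) \<and>
     M ` V \<subseteq> so_complex \<and> (\<forall>i j. holomorphic_in mult_i (Cpow k) V (\<lambda>z. M z $ i $ j)) \<and>
     smooth_on U' z \<and> z ` U' \<subseteq> V \<and>
     (\<forall>q\<in>U'. (q - M (z q) *v vcnj q, z q) \<in> W \<and> eqF f M q (z q) = 0) \<and>
     (\<forall>q\<in>U'. \<forall>v\<in>Cpow k. Kmat f M q (z q) *v v = 0 \<longrightarrow> v = 0)"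

text \<open>
  The determinant \<open>D^a_{ij}\<close>, for \<open>i < j\<close>, made from the matrix \<open>K\<close> and the row \<open>d = (\<partial>M^i_j/\<partial>z^c)_c\<close>.
  It is of size m-1, so it is taken from the library of matrices with variable dimensions, whose
  indices start from 0.
\<close>

definition Ddet :: "('m::{finite,linorder} \<Rightarrow> complex) \<Rightarrow> 'm cmatrix \<Rightarrow> 'm \<Rightarrow> 'm \<Rightarrow> 'm \<Rightarrow> complex" where
  "Ddet d K a i j =
     (let cols = sorted_list_of_set (UNIV - {a}); rows = sorted_list_of_set (UNIV - {i, j})
      in Determinant.det (Matrix.mat (CARD('m) - 1) (CARD('m) - 1)
           (\<lambda>(r, s). if r = 0 then d (cols ! s) else K $ (rows ! (r - 1)) $ (cols ! s))))"

text \<open>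
  The map h of the equation \<open>w = h(z)\<close> when the coordinates q are replaced by the coordinates
  q - p with origin p: as \<open>w = q - M(z) *v vcnj q\<close> changes by \<open>p - M(z) *v vcnj p\<close>, so does h.
  The maps M and z, and the matrix K, do not change; for p = 0 this is h itself.

  A pitfall: h can be taken of rank m near the point under consideration only if that point is the
  origin. For m = 2 let \<open>u = - q2 / cnj q1\<close> on the set where q1 is nonzero, let M be the skew matrix
  with \<open>M^1_2 = u\<close>, and \<open>J = J(M)\<close>. Then J is Hermitian, \<open>w = q - M *v vcnj q\<close> is \<open>(\<phi>, 0)\<close> with the
  J-holomorphic function \<open>\<phi> = q1 + q2 * cnj q2 / cnj q1\<close>, and (as \<open>d\<phi>\<close> determines the positive
  structure J) every representation \<open>w = h(z)\<close>, \<open>z1 = \<phi>\<close>, has h of rank at most 1.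
\<close>

definition recentred :: "'m::finite cspace \<Rightarrow> ('m cspace \<Rightarrow> 'm cmatrix) \<Rightarrow> ('m cspace \<Rightarrow> 'm cspace) \<Rightarrow>
    'm cspace \<Rightarrow> 'm cspace" where
  "recentred p M h z = h z - (p - M z *v vcnj p)"

end

theory Submission
  imports Defs
begin

text \<open>
  Let \<open>y\<close> be the inverse of a complex chart of \<open>J\<close>. The forms \<open>theta M i\<close> are of type (1,0) if and only
  if \<open>\<partial>y/\<partial>\<zeta>^{\bar a} = M \<partial>\bar y/\<partial>\<zeta>^{\bar a}\<close>, which defines \<open>M\<close> as a function of the chart coordinates.
  Differentiating this identity once more, the symmetry of second derivatives and the skewness of \<open>M\<close>
  force the antiholomorphic derivatives of \<open>M\<close>, and hence those of \<open>h = y - M \bar y\<close>, to vanish.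
  Exchanging one coordinate for \<open>\<phi>\<close> gives the coordinates \<open>z\<close>, and \<open>F(q, z) = q - M(z) \bar q - h(z)\<close>
  satisfies \<open>-K dz = dq - M d\bar q\<close>. So \<open>K\<close> is nonsingular and \<open>A = -K^{-1}\<close>; the Laplacian is
  obtained by differentiating \<open>\<partial>z/\<partial>\bar q = -A M\<close>, and the 2 by 2 minors of \<open>K^{-1}\<close> in it are
  complementary minors of \<open>K\<close>. The statement for general k follows with k = m.
\<close>

subsection \<open>Calculus of \<open>Ck_on\<close>\<close>

text \<open>Skewness of \<open>M\<close> does the work in three separate places. It is the isotropy
  of the (1,0)-forms, so it comes for free once the forms \<open>theta M i\<close> are of type
  (1,0). It makes the map X - M conj(X) injective, because pairing with conj(X) leaves only the
  squared norm of X; positivity, the nonsingularity of K and the rank of h all rest on this one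
  fact. Finally, contracted with the symmetric second derivatives of z, it removes them from the
  Laplacian.

  The obstacle is the rank of h. The derivative of y - M conj(y) contains derivatives of M
  multiplied by conj(y). They cancel only after recentring at a point p, and only where y = p;
  openness of nonsingularity then provides a neighbourhood. In K the same terms cancel at every
  point, since F is evaluated where x(z) = q.

  Moreover M is given at a single point only. It is rebuilt as a quotient of two blocks of the
  derivative of y, on the open set where the denominator is invertible.\<close>

lemma Ck_on_imp_continuous_on: "Ck_on n f S \<Longrightarrow> continuous_on S f"
  by (cases n) (auto intro!: continuous_at_imp_continuous_on differentiable_imp_continuous_within)

lemma Ck_on_Suc_imp: "Ck_on (Suc n) f S \<Longrightarrow> Ck_on n f S"
proof (induction n arbitrary: f)
  case 0
  then show ?case
    using Ck_on_imp_continuous_on[OF 0] by simp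
next
  case (Suc n)
  then show ?case
    by (metis Ck_on.simps(2))
qed

lemma Ck_on_subset: "Ck_on n f S \<Longrightarrow> T \<subseteq> S \<Longrightarrow> Ck_on n f T"
  by (induction n arbitrary: f) (auto intro: continuous_on_subset)

text \<open>Differentiability is no assumption here: \<open>frechet_derivative\<close> chooses from
  the set of all derivatives at the point, and this set depends only on the function near the
  point.\<close>

lemma frechet_derivative_cong_open:
  assumes "open S" "x \<in> S" "\<And>y. y \<in> S \<Longrightarrow> f y = g y"
  shows "frechet_derivative f (at x) = frechet_derivative g (at x)"
proof -
  have "(f has_derivative D) (at x) \<longleftrightarrow> (g has_derivative D) (at x)" for D
    using has_derivative_transform_within_open[OF _ assms(1,2), of f D UNIV g]
      has_derivative_transform_within_open[OF _ assms(1,2), of g D UNIV f] assms(3)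
    by auto
  then show ?thesis
    by (simp add: frechet_derivative_def)
qed

lemma differentiable_cong_open:
  assumes "open S" "x \<in> S" "\<And>y. y \<in> S \<Longrightarrow> f y = g y" "f differentiable (at x)"
  shows "g differentiable (at x)"
  using assms has_derivative_transform_within_open[OF _ assms(1,2), of f _ UNIV g]
  unfolding differentiable_def by metis

lemma Ck_on_cong:
  assumes "open S" "\<And>x. x \<in> S \<Longrightarrow> f x = g x" "Ck_on n f S"
  shows "Ck_on n g S"
  using assms(2,3)
proof (induction n arbitrary: f g)
  case 0
  then show ?case
    by (simp cong: continuous_on_cong)
next
  case (Suc n)
  have "frechet_derivative f (at x) v = frechet_derivative g (at x) v" if "x \<in> S" for x v
    using frechet_derivative_cong_open[OF assms(1) that] Suc.prems(1) by metis
  moreover have "g differentiable (at x)" if "x \<in> S" for x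
    using differentiable_cong_open[OF assms(1) that] Suc.prems that by (metis Ck_on.simps(2))
  moreover have "Ck_on n (\<lambda>x. frechet_derivative g (at x) v) S" for v
    by (rule Suc.IH[of "\<lambda>x. frechet_derivative f (at x) v"])
      (use calculation(1) Suc.prems(2) in auto)
  ultimately show ?case
    by simp
qed

text \<open>The closure rules below go through this form: an explicit formula for the derivative
  replaces \<open>frechet_derivative\<close>, and the induction hypothesis is applied to that
  formula.\<close>

lemma Ck_on_SucI:
  assumes "open S" "\<And>x. x \<in> S \<Longrightarrow> (f has_derivative f' x) (at x)"
    "\<And>v. Ck_on n (\<lambda>x. f' x v) S"
  shows "Ck_on (Suc n) f S"
proof -
  have "frechet_derivative f (at x) = f' x" if "x \<in> S" for x
    using frechet_derivative_at[OF assms(2)[OF that]] by simp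
  then have "Ck_on n (\<lambda>x. frechet_derivative f (at x) v) S" for v
    by (intro Ck_on_cong[OF assms(1) _ assms(3)[of v]]) auto
  then show ?thesis
    using assms(2) by (auto simp: differentiable_def)
qed

lemma Ck_on_Suc_has_derivative:
  "Ck_on (Suc n) f S \<Longrightarrow> x \<in> S \<Longrightarrow> (f has_derivative frechet_derivative f (at x)) (at x)"
  by (simp add: frechet_derivative_works)

lemma Ck_on_const: "open S \<Longrightarrow> Ck_on n (\<lambda>x. c) S"
proof (induction n arbitrary: c)
  case (Suc n)
  show ?case
    by (rule Ck_on_SucI[OF Suc.prems, of _ "\<lambda>x v. 0"]) (use Suc in auto)
qed simp

lemma Ck_on_bounded_linear:
  assumes "open S" "bounded_linear L" "Ck_on n f S"
  shows "Ck_on n (\<lambda>x. L (f x)) S"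
  using assms(3)
proof (induction n arbitrary: f)
  case 0
  then show ?case
    using assms(2) by (auto intro: bounded_linear.continuous_on)
next
  case (Suc n)
  show ?case
  proof (rule Ck_on_SucI[OF assms(1)])
    show "((\<lambda>x. L (f x)) has_derivative (\<lambda>v. L (frechet_derivative f (at x) v))) (at x)"
      if "x \<in> S" for x
      by (rule bounded_linear.has_derivative[OF assms(2) Ck_on_Suc_has_derivative[OF Suc.prems that]])
  qed (use Suc in auto)
qed

lemma Ck_on_add:
  assumes "open S" "Ck_on n f S" "Ck_on n g S"
  shows "Ck_on n (\<lambda>x. f x + g x) S"
  using assms(2,3)
proof (induction n arbitrary: f g)
  case (Suc n)
  show ?case
    by (rule Ck_on_SucI[OF assms(1) has_derivative_add[OF Ck_on_Suc_has_derivative[OF Suc.prems(1)]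
            Ck_on_Suc_has_derivative[OF Suc.prems(2)]]])
      (use Suc in auto)
qed (auto intro: continuous_intros)

lemma Ck_on_mult:
  fixes f g :: "'a::real_normed_vector \<Rightarrow> 'b::real_normed_algebra"
  assumes "open S" "Ck_on n f S" "Ck_on n g S"
  shows "Ck_on n (\<lambda>x. f x * g x) S"
  using assms(2,3)
proof (induction n arbitrary: f g)
  case (Suc n)
  show ?case
  proof (rule Ck_on_SucI[OF assms(1)])
    show "((\<lambda>x. f x * g x) has_derivative
        (\<lambda>v. f x * frechet_derivative g (at x) v + frechet_derivative f (at x) v * g x)) (at x)"
      if "x \<in> S" for x
      using Suc.prems that by (intro has_derivative_mult Ck_on_Suc_has_derivative)
    show "Ck_on n (\<lambda>x. f x * frechet_derivative g (at x) v + frechet_derivative f (at x) v * g x) S"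
      for v
      using Suc.prems Suc.prems[THEN Ck_on_Suc_imp]
      by (auto simp del: Ck_on.simps(1) intro!: Ck_on_add[OF assms(1)] Suc.IH)
  qed
qed (auto intro: continuous_intros)

lemma Ck_on_diff:
  assumes "open S" "Ck_on n f S" "Ck_on n g S"
  shows "Ck_on n (\<lambda>x. f x - g x) S"
  using Ck_on_add[OF assms(1,2) Ck_on_bounded_linear[OF assms(1)
        bounded_linear_minus[OF bounded_linear_ident] assms(3)]] by simp

lemma Ck_on_sum:
  assumes "open S" "\<And>i. i \<in> I \<Longrightarrow> Ck_on n (f i) S"
  shows "Ck_on n (\<lambda>x. \<Sum>i\<in>I. f i x) S"
  using assms(2)
  by (induction I rule: infinite_finite_induct)
    (auto intro: Ck_on_add Ck_on_const assms(1))

lemma Ck_on_prod: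
  fixes f :: "'i \<Rightarrow> 'a::real_normed_vector \<Rightarrow> 'b::real_normed_field"
  assumes "open S" "\<And>i. i \<in> I \<Longrightarrow> Ck_on n (f i) S"
  shows "Ck_on n (\<lambda>x. \<Prod>i\<in>I. f i x) S"
  using assms(2)
  by (induction I rule: infinite_finite_induct)
    (auto intro: Ck_on_mult Ck_on_const assms(1))

text \<open>The induction keeps \<open>f\<close> fixed: the derivative is a product of
  \<open>inverse (f x)\<close>, to which the induction hypothesis applies, and a derivative of
  \<open>f\<close>.\<close>

lemma Ck_on_inverse:
  fixes f :: "'a::real_normed_vector \<Rightarrow> 'b::real_normed_field"
  assumes "open S" "Ck_on n f S" "\<And>x. x \<in> S \<Longrightarrow> f x \<noteq> 0"
  shows "Ck_on n (\<lambda>x. inverse (f x)) S"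
  using assms(2)
proof (induction n)
  case (Suc n)
  have "Ck_on n (\<lambda>x. - (inverse (f x) * frechet_derivative f (at x) v * inverse (f x))) S" for v
    using Suc Ck_on_Suc_imp[OF Suc.prems]
    by (intro Ck_on_bounded_linear[OF assms(1) bounded_linear_minus[OF bounded_linear_ident]]
        Ck_on_mult[OF assms(1)]) auto
  then show ?case
    by (intro Ck_on_SucI[OF assms(1) Deriv.has_derivative_inverse[OF assms(3)
            Ck_on_Suc_has_derivative[OF Suc.prems]]])
qed (auto intro!: continuous_intros assms(3))

lemma Ck_on_det:
  fixes A :: "'a::real_normed_vector \<Rightarrow> 'b::real_normed_field^'n::finite^'n"
  assumes "open S" "\<And>i j. Ck_on n (\<lambda>x. A x $ i $ j) S"
  shows "Ck_on n (\<lambda>x. Determinants.det (A x)) S"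
  unfolding Determinants.det_def
  by (intro Ck_on_sum Ck_on_mult Ck_on_prod Ck_on_const assms)

text \<open>Linear inner maps are the case that the transport by coordinate permutations calls for;
  no chain rule of higher order arises, because the inner derivative is constant.\<close>

lemma Ck_on_compose_linear:
  assumes "open S" "bounded_linear L" "Ck_on n f S"
  shows "Ck_on n (\<lambda>x. f (L x)) (L -` S)"
  using assms(3)
proof (induction n arbitrary: f)
  case 0
  then show ?case
    using continuous_on_compose2[OF _ linear_continuous_on[OF assms(2)], of S f "L -` S"] by auto
next
  case (Suc n)
  have "open (L -` S)"
    using assms(1,2) by (simp add: continuous_open_vimage linear_continuous_at)
  then show ?case
  proof (rule Ck_on_SucI)
    show "((\<lambda>x. f (L x)) has_derivative (\<lambda>v. frechet_derivative f (at (L x)) (L v))) (at x)"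
      if "x \<in> L -` S" for x
      using that has_derivative_compose[OF bounded_linear_imp_has_derivative[OF assms(2)]
          Ck_on_Suc_has_derivative[OF Suc.prems]] by auto
  qed (use Suc in auto)
qed

section \<open>Smooth maps\<close>

lemma smooth_on_frechet:
  assumes "smooth_on S f"
  shows "smooth_on S (\<lambda>x. frechet_derivative f (at x) v)"
  unfolding smooth_on_def
proof
  show "Ck_on n (\<lambda>x. frechet_derivative f (at x) v) S" for n
    using assms[unfolded smooth_on_def, rule_format, of "Suc n"] by simp
qed

lemma smooth_on_has_derivative:
  "smooth_on S f \<Longrightarrow> x \<in> S \<Longrightarrow> (f has_derivative frechet_derivative f (at x)) (at x)"
  by (rule Ck_on_Suc_has_derivative[of 0]) (auto simp: smooth_on_def simp del: Ck_on.simps)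

lemma smooth_on_linear:
  "smooth_on S f \<Longrightarrow> x \<in> S \<Longrightarrow> linear (frechet_derivative f (at x))"
  by (rule has_derivative_linear[OF smooth_on_has_derivative])

lemma smooth_on_bounded_linear:
  "open S \<Longrightarrow> bounded_linear L \<Longrightarrow> smooth_on S f \<Longrightarrow> smooth_on S (\<lambda>x. L (f x))"
  by (simp add: smooth_on_def Ck_on_bounded_linear)

lemma smooth_on_compose_linear:
  "open S \<Longrightarrow> bounded_linear L \<Longrightarrow> smooth_on S f \<Longrightarrow> smooth_on (L -` S) (\<lambda>x. f (L x))"
  by (simp add: smooth_on_def Ck_on_compose_linear)

lemma smooth_on_add:
  "open S \<Longrightarrow> smooth_on S f \<Longrightarrow> smooth_on S g \<Longrightarrow> smooth_on S (\<lambda>x. f x + g x)"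
  by (simp add: smooth_on_def Ck_on_add)

lemma smooth_on_subset: "smooth_on S f \<Longrightarrow> T \<subseteq> S \<Longrightarrow> smooth_on T f"
  by (auto simp: smooth_on_def intro: Ck_on_subset)

lemma smooth_on_cong:
  "open S \<Longrightarrow> (\<And>x. x \<in> S \<Longrightarrow> f x = g x) \<Longrightarrow> smooth_on S f \<Longrightarrow> smooth_on S g"
  unfolding smooth_on_def by (auto intro: Ck_on_cong)

lemma has_derivative_vec_nth:
  "(f has_derivative D) F \<Longrightarrow> ((\<lambda>x. f x $ i) has_derivative (\<lambda>v. D v $ i)) F"
  by (rule bounded_linear.has_derivative[OF bounded_linear_vec_nth])

lemma has_derivative_vec:
  fixes f :: "'a::real_normed_vector \<Rightarrow> 'b::euclidean_space^'n::finite"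
  assumes "\<And>i. ((\<lambda>x. f x $ i) has_derivative (\<lambda>v. D v $ i)) (at x)"
  shows "(f has_derivative D) (at x)"
  by (subst has_derivative_componentwise_within)
    (auto simp: Basis_vec_def inner_axis intro: has_derivative_inner_left assms)

section \<open>Symmetry of second derivatives\<close>

lemma has_derivative_along_line:
  fixes f :: "'a::real_normed_vector \<Rightarrow> real"
  assumes "(f has_derivative D) (at (x + s *\<^sub>R u))"
  shows "((\<lambda>s. f (x + s *\<^sub>R u)) has_real_derivative D u) (at s)"
proof -
  have "((\<lambda>s. x + s *\<^sub>R u) has_derivative (\<lambda>r. r *\<^sub>R u)) (at s)"
    by (auto intro!: derivative_eq_intros)
  from has_derivative_compose[OF this assms]
  have "((\<lambda>s. f (x + s *\<^sub>R u)) has_derivative (\<lambda>r. D (r *\<^sub>R u))) (at s)"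
    by simp
  moreover have "D (r *\<^sub>R u) = D u * r" for r
    using linear_cmul[OF has_derivative_linear[OF assms], of r u] by simp
  ultimately show ?thesis
    by (simp add: has_field_derivative_def)
qed

text \<open>The mean value theorem is used twice: along u for the increment of \<open>f\<close> in
  direction v, then along v for the derivative in direction u.\<close>

lemma second_difference_mvt:
  fixes f :: "'a::real_normed_vector \<Rightarrow> real"
  assumes f: "\<And>y. y \<in> cball x (norm u + norm v) \<Longrightarrow> (f has_derivative f' y) (at y)"
    and f': "\<And>y. y \<in> cball x (norm u + norm v) \<Longrightarrow> ((\<lambda>y. f' y u) has_derivative f'' y) (at y)"
  obtains p where "p \<in> cball x (norm u + norm v)"
    "f (x + u + v) - f (x + u) - f (x + v) + f x = f'' p v"
proof -
  have mem: "x + s *\<^sub>R u + t *\<^sub>R v \<in> cball x (norm u + norm v)"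
    if "0 \<le> s" "s \<le> 1" "0 \<le> t" "t \<le> 1" for s t
  proof -
    have "norm (s *\<^sub>R u + t *\<^sub>R v) \<le> norm (s *\<^sub>R u) + norm (t *\<^sub>R v)"
      by (rule norm_triangle_ineq)
    also have "\<dots> \<le> 1 * norm u + 1 * norm v"
      unfolding norm_scaleR using that by (intro add_mono mult_right_mono) auto
    finally show ?thesis
      using norm_minus_cancel[of "s *\<^sub>R u + t *\<^sub>R v"]
      by (simp add: dist_norm algebra_simps del: norm_minus_cancel)
  qed
  let ?g = "\<lambda>s. f (x + v + s *\<^sub>R u) - f (x + s *\<^sub>R u)"
  have "(?g has_real_derivative f' (x + v + s *\<^sub>R u) u - f' (x + s *\<^sub>R u) u) (at s)"
    if "0 \<le> s" "s \<le> 1" for s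
    using mem[of s 1] mem[of s 0] that
    by (intro derivative_intros has_derivative_along_line f) (auto simp: algebra_simps)
  then obtain s where s: "0 < s" "s < 1"
    and 1: "?g 1 - ?g 0 = (1 - 0) * (f' (x + v + s *\<^sub>R u) u - f' (x + s *\<^sub>R u) u)"
    using MVT2[of 0 1 ?g "\<lambda>s. f' (x + v + s *\<^sub>R u) u - f' (x + s *\<^sub>R u) u"] by auto
  let ?k = "\<lambda>t. f' (x + s *\<^sub>R u + t *\<^sub>R v) u"
  have "(?k has_real_derivative f'' (x + s *\<^sub>R u + t *\<^sub>R v) v) (at t)"
    if "0 \<le> t" "t \<le> 1" for t
    using mem[of s t] that s by (intro has_derivative_along_line[where f = "\<lambda>y. f' y u"] f') auto
  then obtain t where t: "0 < t" "t < 1"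
    and 2: "?k 1 - ?k 0 = (1 - 0) * f'' (x + s *\<^sub>R u + t *\<^sub>R v) v"
    using MVT2[of 0 1 ?k "\<lambda>t. f'' (x + s *\<^sub>R u + t *\<^sub>R v) v"] by auto
  show ?thesis
    by (rule that[of "x + s *\<^sub>R u + t *\<^sub>R v"])
      (use mem[of s t] s t 1 2 in \<open>auto simp: algebra_simps\<close>)
qed

text \<open>The second difference is symmetric in u and v, so the two mixed derivatives agree up to
  moving each to some point near x. Continuity of both then excludes a gap of size
  \<open>2 * e\<close> at x itself.\<close>

lemma second_derivative_symmetric_real:
  fixes f :: "'a::real_normed_vector \<Rightarrow> real"
  assumes S: "open S" "x \<in> S" and f: "\<And>y. y \<in> S \<Longrightarrow> (f has_derivative f' y) (at y)"
    and u: "\<And>y. y \<in> S \<Longrightarrow> ((\<lambda>y. f' y u) has_derivative fu y) (at y)"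
    and v: "\<And>y. y \<in> S \<Longrightarrow> ((\<lambda>y. f' y v) has_derivative fv y) (at y)"
    and cont: "continuous_on S (\<lambda>y. fu y v)" "continuous_on S (\<lambda>y. fv y u)"
  shows "fu x v = fv x u"
proof (rule ccontr)
  assume ne: "fu x v \<noteq> fv x u"
  define e where "e = \<bar>fu x v - fv x u\<bar> / 2"
  have e: "e > 0"
    using ne by (simp add: e_def)
  have near_x: "\<forall>\<^sub>F y in nhds x. dist (g y) (g x) < e" if "continuous_on S g" for g :: "'a \<Rightarrow> real"
  proof (rule tendstoD[OF _ e])
    show "(g \<longlongrightarrow> g x) (nhds x)"
      using that S by (simp add: continuous_on_eq_continuous_at isCont_def tendsto_at_iff_tendsto_nhds)
  qed
  have "\<forall>\<^sub>F y in nhds x. y \<in> S \<and> dist (fu y v) (fu x v) < e \<and> dist (fv y u) (fv x u) < e"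
    by (intro eventually_conj eventually_nhds_in_open near_x cont S)
  then obtain d where d: "d > 0"
    and near: "\<And>y. dist y x < d \<Longrightarrow> y \<in> S \<and> dist (fu y v) (fu x v) < e \<and> dist (fv y u) (fv x u) < e"
    by (auto simp: eventually_nhds_metric)
  \<comment> \<open>The summand 1 keeps the denominator positive when u = v = 0; the factor 2 makes
    the resulting bound by \<open>d\<close> strict.\<close>
  define h where "h = d / (2 * (norm u + norm v + 1))"
  have pos: "norm u + norm v + 1 > 0"
    by (simp add: add_nonneg_pos)
  have h: "h > 0"
    using d pos by (simp add: h_def)
  have "h * (norm u + norm v) < h * (2 * (norm u + norm v + 1))"
    using h pos by (intro mult_strict_left_mono) auto
  also have "\<dots> = d"
    using pos by (simp add: h_def)
  finally have small: "norm (h *\<^sub>R u) + norm (h *\<^sub>R v) < d"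
    using h by (simp add: algebra_simps)
  then have ball: "dist y x < d" "y \<in> S" if "y \<in> cball x (norm (h *\<^sub>R u) + norm (h *\<^sub>R v))" for y
    using that near[of y] by (auto simp: dist_commute)
  have cmul: "g' (h *\<^sub>R w) = h * g' w" if "(g has_derivative g') (at y)" for g :: "'a \<Rightarrow> real" and g' w y
    using linear_cmul[OF has_derivative_linear[OF that], of h w] by simp
  have scaled: "((\<lambda>y. f' y (h *\<^sub>R w)) has_derivative (\<lambda>z. h * fw y z)) (at y)"
    if "y \<in> S" "\<And>y. y \<in> S \<Longrightarrow> ((\<lambda>y. f' y w) has_derivative fw y) (at y)" for y w fw
    by (rule has_derivative_transform_within_open[OF _ S(1) that(1), where f = "\<lambda>y. h * f' y w"])
      (use that cmul[OF f] in \<open>auto intro: derivative_intros\<close>)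
  obtain p where p: "p \<in> cball x (norm (h *\<^sub>R u) + norm (h *\<^sub>R v))"
    "f (x + h *\<^sub>R u + h *\<^sub>R v) - f (x + h *\<^sub>R u) - f (x + h *\<^sub>R v) + f x = h * fu p (h *\<^sub>R v)"
    by (rule second_difference_mvt[of x "h *\<^sub>R u" "h *\<^sub>R v" f f' "\<lambda>y z. h * fu y z"])
      (use ball(2) f scaled u in blast)+
  obtain q where q: "q \<in> cball x (norm (h *\<^sub>R v) + norm (h *\<^sub>R u))"
    "f (x + h *\<^sub>R v + h *\<^sub>R u) - f (x + h *\<^sub>R v) - f (x + h *\<^sub>R u) + f x = h * fv q (h *\<^sub>R u)"
    by (rule second_difference_mvt[of x "h *\<^sub>R v" "h *\<^sub>R u" f f' "\<lambda>y z. h * fv y z"])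
      (use ball(2) f scaled v in \<open>auto simp: add.commute\<close>)
  have pq: "dist p x < d" "dist q x < d"
    using ball p q by (auto simp: add.commute)
  have "h * fu p (h *\<^sub>R v) = h * fv q (h *\<^sub>R u)"
    using p(2) q(2) by (simp add: algebra_simps)
  then have "fu p v = fv q u"
    using cmul[OF u, of p v] cmul[OF v, of q u] near pq h by simp
  moreover have "dist (fu p v) (fu x v) < e" "dist (fv q u) (fv x u) < e"
    using near pq by auto
  moreover have "dist (fu x v) (fv x u) = 2 * e"
    by (simp add: e_def dist_real_def)
  ultimately show False
    using dist_triangle_half_r[of "fu p v" "fu x v" "2 * e" "fv x u"] by simp
qed

lemma second_derivative_symmetric:
  fixes f :: "'a::real_normed_vector \<Rightarrow> 'b::euclidean_space"
  assumes "open S" "smooth_on S f" "x \<in> S"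
  shows "frechet_derivative (\<lambda>y. frechet_derivative f (at y) u) (at x) v =
    frechet_derivative (\<lambda>y. frechet_derivative f (at y) v) (at x) u"
proof (rule euclidean_eqI)
  fix b :: 'b
  have 1: "((\<lambda>y. frechet_derivative f (at y) w \<bullet> b) has_derivative
      (\<lambda>z. frechet_derivative (\<lambda>y. frechet_derivative f (at y) w) (at y) z \<bullet> b)) (at y)"
    if "y \<in> S" for w y
    using that by (intro has_derivative_inner_left smooth_on_has_derivative[OF smooth_on_frechet[OF assms(2)]])
  have 2: "continuous_on S (\<lambda>y. frechet_derivative (\<lambda>y. frechet_derivative f (at y) w) (at y) z \<bullet> b)"
    for w z
    using smooth_on_frechet[OF smooth_on_frechet[OF assms(2)], of w z]
    by (intro continuous_intros) (auto simp: smooth_on_def intro: Ck_on_imp_continuous_on)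
  show "frechet_derivative (\<lambda>y. frechet_derivative f (at y) u) (at x) v \<bullet> b =
    frechet_derivative (\<lambda>y. frechet_derivative f (at y) v) (at x) u \<bullet> b"
    by (rule second_derivative_symmetric_real[where S = S and f = "\<lambda>y. f y \<bullet> b"
          and f' = "\<lambda>y w. frechet_derivative f (at y) w \<bullet> b"
          and fu = "\<lambda>y z. frechet_derivative (\<lambda>y. frechet_derivative f (at y) u) (at y) z \<bullet> b"
          and fv = "\<lambda>y z. frechet_derivative (\<lambda>y. frechet_derivative f (at y) v) (at y) z \<bullet> b"])
      (auto intro!: has_derivative_inner_left smooth_on_has_derivative assms 1 2)
qed

lemmas cart_eq_iff = Finite_Cartesian_Product.vec_eq_iff

subsection \<open>Linear forms on \<open>C^m\<close>\<close>

text \<open>\<open>hol_coeff\<close> and \<open>anti_coeff\<close> are the coefficients of dq^i and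
  of its conjugate in a real-linear form. For a differential they are the two Wirtinger
  derivatives.\<close>

definition hol_coeff :: "('m::finite cspace \<Rightarrow> complex) \<Rightarrow> 'm \<Rightarrow> complex" where
  "hol_coeff \<alpha> i = (\<alpha> (axis i 1) - \<i> * \<alpha> (axis i \<i>)) / 2"

definition anti_coeff :: "('m::finite cspace \<Rightarrow> complex) \<Rightarrow> 'm \<Rightarrow> complex" where
  "anti_coeff \<alpha> i = (\<alpha> (axis i 1) + \<i> * \<alpha> (axis i \<i>)) / 2"

lemma sum_Basis_cspace:
  "(\<Sum>e\<in>(Basis :: 'm::finite cspace set). f e) = (\<Sum>i\<in>UNIV. f (axis i 1) + f (axis i \<i>))"
proof -
  have "(Basis :: 'm cspace set) = (\<Union>i. {axis i 1, axis i \<i>})"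
    by (auto simp: Basis_vec_def Basis_complex_def)
  moreover have "sum f (\<Union>i. {axis i 1, axis i \<i>}) = (\<Sum>i\<in>UNIV. sum f {axis i 1, axis i \<i>})"
    by (rule sum.UNION_disjoint) (auto simp: axis_eq_axis)
  moreover have "sum f {axis i 1, axis i \<i>} = f (axis i 1) + f (axis i \<i>)" for i
    by (subst sum.insert) (auto simp: axis_eq_axis)
  ultimately show ?thesis
    by simp
qed

lemma cspace_expansion:
  "X = (\<Sum>i\<in>UNIV. Re (X $ i) *\<^sub>R axis i 1 + Im (X $ i) *\<^sub>R axis i \<i>)" for X :: "'m::finite cspace"
  by (subst cart_eq_iff)
    (simp add: axis_def if_distrib[where f = "\<lambda>x. _ *\<^sub>R x"] sum.distrib complex_eq_iff cong: if_cong)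

lemma linear_form_expansion:
  fixes X :: "'m::finite cspace"
  assumes "linear \<alpha>"
  shows "\<alpha> X = (\<Sum>i\<in>UNIV. hol_coeff \<alpha> i * X $ i + anti_coeff \<alpha> i * cnj (X $ i))"
proof -
  have "\<alpha> X = (\<Sum>i\<in>UNIV. Re (X $ i) *\<^sub>R \<alpha> (axis i 1) + Im (X $ i) *\<^sub>R \<alpha> (axis i \<i>))"
    by (subst cspace_expansion[of X])
      (simp add: linear_sum[OF assms] linear_add[OF assms] linear_cmul[OF assms])
  also have "\<dots> = (\<Sum>i\<in>UNIV. hol_coeff \<alpha> i * X $ i + anti_coeff \<alpha> i * cnj (X $ i))"
    by (intro sum.cong) (auto simp: hol_coeff_def anti_coeff_def complex_eq_iff field_simps)
  finally show ?thesis .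
qed

lemma linear_form_eq_0:
  fixes \<alpha> :: "'m::finite cspace \<Rightarrow> complex"
  assumes "linear \<alpha>" "\<And>i. hol_coeff \<alpha> i = 0" "\<And>i. anti_coeff \<alpha> i = 0"
  shows "\<alpha> = (\<lambda>X. 0)"
  using linear_form_expansion[OF assms(1)] assms(2,3) by auto

text \<open>The left side is the complex bilinear extension of the Euclidean product to covectors.
  In the basis of the dq^i and their conjugates, each dq^i pairs only with its own conjugate, with
  value 2.\<close>

lemma sum_Basis_mult_linear_forms:
  fixes \<alpha> \<beta> :: "'m::finite cspace \<Rightarrow> complex"
  shows "(\<Sum>e\<in>Basis. \<alpha> e * \<beta> e) =
    2 * (\<Sum>i\<in>UNIV. hol_coeff \<alpha> i * anti_coeff \<beta> i + anti_coeff \<alpha> i * hol_coeff \<beta> i)"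
  unfolding sum_Basis_cspace sum_distrib_left
  by (intro sum.cong) (auto simp: hol_coeff_def anti_coeff_def field_simps)

lemma hol_coeff_linear_combination:
  "hol_coeff (\<lambda>X. \<alpha> X + c * \<beta> X) i = hol_coeff \<alpha> i + c * hol_coeff \<beta> i"
  "anti_coeff (\<lambda>X. \<alpha> X + c * \<beta> X) i = anti_coeff \<alpha> i + c * anti_coeff \<beta> i"
  by (auto simp: hol_coeff_def anti_coeff_def field_simps)

lemma hol_coeff_sum:
  "hol_coeff (\<lambda>X. \<Sum>k\<in>A. c k * \<beta> k X) i = (\<Sum>k\<in>A. c k * hol_coeff (\<beta> k) i)"
  "anti_coeff (\<lambda>X. \<Sum>k\<in>A. c k * \<beta> k X) i = (\<Sum>k\<in>A. c k * anti_coeff (\<beta> k) i)"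
  unfolding hol_coeff_def anti_coeff_def
  by (simp_all add: sum_distrib_left sum_divide_distrib flip: sum_subtractf sum.distrib)
    (simp_all add: field_simps)

section \<open>Conjugation, the forms theta and skew matrices\<close>

lemma linear_vcnj: "linear (vcnj :: 'm::finite cspace \<Rightarrow> 'm cspace)"
  by (auto simp: vcnj_def cart_eq_iff intro!: linearI)

lemma vcnj_nth [simp]: "vcnj q $ i = cnj (q $ i)"
  by (simp add: vcnj_def)

lemma linear_matrix_vector_mult_complex:
  "linear (\<lambda>X. M *v X)" for M :: "complex^'n::finite^'m::finite"
  by (rule linearI) (simp_all add: cart_eq_iff matrix_vector_mult_def sum.distrib
      scaleR_conv_of_real[where 'a = complex] algebra_simps sum_distrib_left)

lemma theta_eq: "theta M i X = (X - M *v vcnj X) $ i"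
  by (simp add: theta_def matrix_vector_mult_def)

lemma linear_Theta: "linear (\<lambda>X. X - M *v vcnj X)" for M :: "'m::finite cmatrix"
  using linear_compose[OF linear_vcnj linear_matrix_vector_mult_complex[of M]]
  by (intro linear_compose_sub linear_ident) (simp add: o_def)

lemma linear_theta: "linear (theta M i)"
  unfolding theta_eq
  using linear_compose[OF linear_Theta bounded_linear.linear[OF bounded_linear_vec_nth]]
  by (simp add: o_def)

lemma hol_coeff_theta: "hol_coeff (theta M i) j = (if i = j then 1 else 0)"
  and anti_coeff_theta: "anti_coeff (theta M i) j = - M $ i $ j"
proof -
  have "(\<Sum>k\<in>UNIV. M $ i $ k * cnj (axis j c $ k)) = M $ i $ j * cnj c" for c
    by (subst sum.remove[of _ j]) (auto simp: axis_def)
  then have *: "theta M i (axis j c) = (if i = j then c else 0) - M $ i $ j * cnj c" for c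
    by (auto simp: theta_def axis_def)
  show "hol_coeff (theta M i) j = (if i = j then 1 else 0)" "anti_coeff (theta M i) j = - M $ i $ j"
    by (auto simp: hol_coeff_def anti_coeff_def * algebra_simps)
qed

lemma eq_uminus_imp_0: "x = - x \<Longrightarrow> x = 0" for x :: "'a::field_char_0"
proof -
  assume "x = - x"
  then have "x + x = 0"
    by (simp only: eq_neg_iff_add_eq_0)
  then show "x = 0"
    by (simp flip: mult_2)
qed

lemma skew_sum_symmetric:
  fixes M S :: "'i \<Rightarrow> 'i \<Rightarrow> 'a::field_char_0"
  assumes "\<And>i j. M i j = - M j i" "\<And>i j. S i j = S j i"
  shows "(\<Sum>i\<in>A. \<Sum>j\<in>A. M i j * S i j) = 0"
proof -
  have "(\<Sum>i\<in>A. \<Sum>j\<in>A. M i j * S i j) = (\<Sum>j\<in>A. \<Sum>i\<in>A. M i j * S i j)"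
    by (rule sum.swap)
  also have "\<dots> = (\<Sum>j\<in>A. \<Sum>i\<in>A. - (M j i * S j i))"
    using assms by (intro sum.cong refl) (metis mult_minus_left)
  also have "\<dots> = - (\<Sum>i\<in>A. \<Sum>j\<in>A. M i j * S i j)"
    by (simp add: sum_negf)
  finally show ?thesis
    by (rule eq_uminus_imp_0)
qed

lemma so_complex_iff: "M \<in> so_complex \<longleftrightarrow> (\<forall>i j. M $ i $ j = - M $ j $ i)"
proof -
  have "M \<in> so_complex \<longleftrightarrow> (\<forall>i j. M $ j $ i = - M $ i $ j)"
    by (simp add: so_complex_def Finite_Cartesian_Product.transpose_def cart_eq_iff)
  then show ?thesis
    by blast
qed

lemma so_complexD: "M \<in> so_complex \<Longrightarrow> M $ i $ j = - M $ j $ i"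
  using so_complex_iff by blast

text \<open>Pairing the equation with the conjugate of X kills the skew term and leaves the squared
  norm of X.\<close>

lemma Theta_skew_injective:
  fixes X :: "'m::finite cspace"
  assumes "M \<in> so_complex" "X - M *v vcnj X = 0"
  shows "X = 0"
proof -
  have "(\<Sum>i\<in>UNIV. cnj (X $ i) * X $ i) = (\<Sum>i\<in>UNIV. cnj (X $ i) * (M *v vcnj X) $ i)"
    using assms(2) by simp
  also have "\<dots> = (\<Sum>i\<in>UNIV. \<Sum>j\<in>UNIV. M $ i $ j * (cnj (X $ i) * cnj (X $ j)))"
    by (simp add: matrix_vector_mult_def sum_distrib_left algebra_simps)
  also have "\<dots> = 0"
    by (rule skew_sum_symmetric) (auto simp: mult.commute intro: so_complexD[OF assms(1)])
  finally have "(\<Sum>i\<in>UNIV. complex_of_real ((cmod (X $ i))\<^sup>2)) = 0"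
    by (simp only: complex_norm_square mult.commute)
  then have "(\<Sum>i\<in>UNIV. (cmod (X $ i))\<^sup>2) = 0"
    by (metis of_real_eq_0_iff of_real_sum)
  then show ?thesis
    by (simp add: sum_nonneg_eq_0_iff cart_eq_iff)
qed

subsection \<open>The cotangent space of an orthogonal complex structure\<close>

lemma almost_hermitian_inner:
  assumes "almost_hermitian_at J0"
  shows "J0 X \<bullet> J0 Y = X \<bullet> Y" "J0 X \<bullet> Y = - (X \<bullet> J0 Y)" "J0 (J0 X) = - X" "linear J0"
proof -
  show lin: "linear J0" and eq: "J0 X \<bullet> J0 Y = X \<bullet> Y" "J0 (J0 X) = - X" for X Y
    using assms by (auto simp: almost_hermitian_at_def orthogonal_transformation_def)
  show "J0 X \<bullet> Y = - (X \<bullet> J0 Y)"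
    using eq(1)[of "J0 X" Y] eq(2)[of X] by simp
qed

lemma linear_Basis_expansion:
  fixes \<alpha> :: "'a::euclidean_space \<Rightarrow> 'b::real_vector"
  assumes "linear \<alpha>"
  shows "\<alpha> X = (\<Sum>f\<in>Basis. (X \<bullet> f) *\<^sub>R \<alpha> f)"
proof -
  have "\<alpha> X = \<alpha> (\<Sum>f\<in>Basis. (X \<bullet> f) *\<^sub>R f)"
    by (simp add: euclidean_representation)
  then show ?thesis
    by (simp add: linear_sum[OF assms] linear_cmul[OF assms])
qed

text \<open>
  A sum over an orthonormal basis is the same for the basis \<open>Basis\<close> and for its image under \<open>J0\<close>;
  the latter changes the sign of \<open>\<alpha> e * \<beta> e\<close>.
\<close>

lemma J_holomorphic_forms_isotropic:
  fixes \<alpha> \<beta> :: "'a::euclidean_space \<Rightarrow> complex"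
  assumes J: "almost_hermitian_at J0" and lin: "linear \<alpha>" "linear \<beta>"
    and hol: "\<And>X. \<alpha> (J0 X) = \<i> * \<alpha> X" "\<And>X. \<beta> (J0 X) = \<i> * \<beta> X"
  shows "(\<Sum>e\<in>Basis. \<alpha> e * \<beta> e) = 0"
proof -
  note J = almost_hermitian_inner[OF J]
  have exp: "\<gamma> (J0 e) = (\<Sum>f\<in>Basis. - of_real (e \<bullet> J0 f) * \<gamma> f)" if "linear \<gamma>" for \<gamma> :: "'a \<Rightarrow> complex" and e
    by (subst linear_Basis_expansion[OF that]) (simp add: J(2) scaleR_conv_of_real)
  have inner_sum: "(\<Sum>e\<in>Basis. (J0 f \<bullet> e) * (J0 g \<bullet> e)) = f \<bullet> g" for f g
    by (metis J(1) euclidean_inner)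
  have "- (\<Sum>e\<in>Basis. \<alpha> e * \<beta> e) = (\<Sum>e\<in>Basis. \<alpha> (J0 e) * \<beta> (J0 e))"
    by (simp add: hol sum_negf[symmetric] algebra_simps)
  also have "\<dots> = (\<Sum>e\<in>Basis. \<Sum>f\<in>Basis. \<Sum>g\<in>Basis.
      of_real ((J0 f \<bullet> e) * (J0 g \<bullet> e)) * (\<alpha> f * \<beta> g))"
    unfolding exp[OF lin(1)] exp[OF lin(2)] sum_product
    by (intro sum.cong refl) (simp add: inner_commute algebra_simps)
  also have "\<dots> = (\<Sum>f\<in>Basis. \<Sum>g\<in>Basis. \<Sum>e\<in>Basis.
      of_real ((J0 f \<bullet> e) * (J0 g \<bullet> e)) * (\<alpha> f * \<beta> g))"
    by (rule trans[OF sum.swap sum.cong[OF refl sum.swap]])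
  also have "\<dots> = (\<Sum>f\<in>Basis. \<Sum>g\<in>Basis. of_real (f \<bullet> g) * (\<alpha> f * \<beta> g))"
    by (intro sum.cong refl) (simp add: inner_sum flip: of_real_sum of_real_mult sum_distrib_right)
  also have "\<dots> = (\<Sum>f\<in>Basis. \<alpha> f * \<beta> f)"
    by (intro sum.cong refl) (simp add: inner_Basis if_distrib[where f = "\<lambda>x. of_real x * _"] cong: if_cong)
  finally show ?thesis
    by (rule eq_uminus_imp_0[OF sym])
qed

lemma cotangent10_pairing:
  fixes \<alpha> \<beta> :: "'m::finite cspace \<Rightarrow> complex"
  assumes "almost_hermitian_at J0" "\<alpha> \<in> cotangent10 J0" "\<beta> \<in> cotangent10 J0"
  shows "(\<Sum>i\<in>UNIV. hol_coeff \<alpha> i * anti_coeff \<beta> i + anti_coeff \<alpha> i * hol_coeff \<beta> i) = 0"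
  using J_holomorphic_forms_isotropic[OF assms(1), of \<alpha> \<beta>] assms(2,3)
  unfolding sum_Basis_mult_linear_forms by (simp add: cotangent10_def)

lemma linear_complex_mult: "linear f \<Longrightarrow> linear (\<lambda>x. c * f x)" for c :: complex
  by (rule linearI) (simp_all add: linear_add linear_cmul algebra_simps)

lemma cotangent10_add:
  "\<alpha> \<in> cotangent10 J0 \<Longrightarrow> \<beta> \<in> cotangent10 J0 \<Longrightarrow> (\<lambda>X. \<alpha> X + c * \<beta> X) \<in> cotangent10 J0"
  by (auto simp: cotangent10_def algebra_simps intro: linear_compose_add linear_complex_mult)

lemma cotangent10_sum:
  "(\<And>i. i \<in> A \<Longrightarrow> \<beta> i \<in> cotangent10 J0) \<Longrightarrow> (\<lambda>X. \<Sum>i\<in>A. c i * \<beta> i X) \<in> cotangent10 J0"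
  by (auto simp: cotangent10_def sum_distrib_left algebra_simps
      intro!: linear_compose_sum linear_complex_mult sum.cong)

text \<open>Both claims express isotropy of the (1,0)-forms. Pairing \<open>theta M i\<close> with
  \<open>theta M j\<close> gives skewness. For the span, subtract from a (1,0)-form the combination
  with the same dq-part: the pairings of the remainder with the \<open>theta M i\<close> are exactly
  its conjugate coefficients, which therefore vanish.\<close>

lemma theta_in_cotangent10:
  assumes J: "almost_hermitian_at J0" and \<theta>: "\<And>i. theta M i \<in> cotangent10 J0"
  shows theta_in_cotangent10_skew: "M \<in> so_complex"
    and theta_in_cotangent10_span: "cotangent10 J0 = {(\<lambda>X. \<Sum>i\<in>UNIV. c i * theta M i X) | c. True}"
proof -
  show "M \<in> so_complex"
  proof (rule so_complex_iff[THEN iffD2, rule_format])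
    fix i j
    have "(\<Sum>k\<in>UNIV. (if i = k then 1 else 0) * - M $ j $ k + - M $ i $ k * (if j = k then 1 else 0)) = 0"
      using cotangent10_pairing[OF J \<theta>[of i] \<theta>[of j]] unfolding hol_coeff_theta anti_coeff_theta .
    then have "- M $ j $ i - M $ i $ j = 0"
      by (simp add: sum_subtractf if_distrib[where f = "\<lambda>x. x * _"]
          if_distrib[where f = "\<lambda>x. _ * x"] sum_negf cong: if_cong) (metis minus_minus)
    then show "M $ i $ j = - M $ j $ i"
      by (metis right_minus_eq)
  qed
  show "cotangent10 J0 = {(\<lambda>X. \<Sum>i\<in>UNIV. c i * theta M i X) | c. True}"
  proof (intro subset_antisym subsetI)
    fix \<alpha>
    assume \<alpha>: "\<alpha> \<in> cotangent10 J0"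
    define \<sigma> where "\<sigma> = (\<lambda>X. \<Sum>i\<in>UNIV. hol_coeff \<alpha> i * theta M i X)"
    define \<beta> where "\<beta> = (\<lambda>X. \<alpha> X + (-1) * \<sigma> X)"
    have \<beta>: "\<beta> \<in> cotangent10 J0"
      unfolding \<beta>_def \<sigma>_def by (intro cotangent10_add cotangent10_sum \<alpha> \<theta>)
    have h: "hol_coeff \<beta> i = 0" for i
      unfolding \<beta>_def hol_coeff_linear_combination \<sigma>_def hol_coeff_sum hol_coeff_theta
      by (simp add: if_distrib[where f = "\<lambda>x. _ * x"] cong: if_cong)
    have "anti_coeff \<beta> i = 0" for i
      using cotangent10_pairing[OF J \<theta>[of i] \<beta>] unfolding h hol_coeff_theta
      by (simp add: if_distrib[where f = "\<lambda>x. x * _"] cong: if_cong)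
    then have "\<beta> = (\<lambda>X. 0)"
      using \<beta> h by (intro linear_form_eq_0) (auto simp: cotangent10_def)
    then have "\<alpha> = \<sigma>"
      by (auto simp: \<beta>_def fun_eq_iff)
    then show "\<alpha> \<in> {(\<lambda>X. \<Sum>i\<in>UNIV. c i * theta M i X) | c. True}"
      by (auto simp: \<sigma>_def)
  qed (auto intro!: cotangent10_sum \<theta>)
qed

lemma linear_form_eqI:
  fixes \<alpha> \<beta> :: "'m::finite cspace \<Rightarrow> complex"
  assumes "linear \<alpha>" "linear \<beta>" "\<And>i. hol_coeff \<alpha> i = hol_coeff \<beta> i"
    "\<And>i. anti_coeff \<alpha> i = anti_coeff \<beta> i"
  shows "\<alpha> = \<beta>"
  using linear_form_expansion[OF assms(1)] linear_form_expansion[OF assms(2)] assms(3,4) by auto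

text \<open>A real dimension count. Vectors v parametrise (1,0)-forms by their real parts, and
  passing to the dq-coefficients is an injective real-linear map between spaces of equal dimension.
  So some (1,0)-form has dq-part exactly dq^i; its conjugate coefficients, with sign changed, form
  row i of M.\<close>

lemma theta_in_cotangent10_exists:
  fixes J0 :: "'m::finite cspace \<Rightarrow> 'm cspace"
  assumes J: "almost_hermitian_at J0"
    and inj: "\<And>\<alpha>. \<alpha> \<in> cotangent10 J0 \<Longrightarrow> (\<And>i. hol_coeff \<alpha> i = 0) \<Longrightarrow> \<alpha> = (\<lambda>X. 0)"
  shows "\<exists>M. \<forall>i. theta M i \<in> cotangent10 J0"
proof -
  note J = almost_hermitian_inner[OF J]
  define \<alpha> where "\<alpha> v X = of_real (v \<bullet> X) - \<i> * of_real (v \<bullet> J0 X)" for v X :: "'m cspace"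
  have \<alpha>: "\<alpha> v \<in> cotangent10 J0" for v
    by (auto simp: cotangent10_def \<alpha>_def J inner_right_distrib linear_add[OF J(4)] linear_cmul[OF J(4)]
        scaleR_conv_of_real[where 'a = complex] algebra_simps intro!: linearI)
  define A where "A v = (\<chi> i. hol_coeff (\<alpha> v) i)" for v :: "'m cspace"
  have "linear A"
    by (rule linearI) (auto simp: A_def \<alpha>_def hol_coeff_def cart_eq_iff inner_left_distrib
        scaleR_conv_of_real[where 'a = complex] field_simps)
  moreover have "v = 0" if "A v = 0" for v
  proof -
    have "hol_coeff (\<alpha> v) i = 0" for i
      using that by (simp add: A_def cart_eq_iff)
    then have "\<alpha> v v = 0"
      using inj[OF \<alpha>, of v] by simp
    then have "Re (\<alpha> v v) = 0"
      by simp
    then show "v = 0"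
      by (simp add: \<alpha>_def)
  qed
  ultimately have "surj A"
    by (intro linear_injective_imp_surjective) (auto simp: linear_injective_0)
  define w where "w i = inv_into UNIV A (axis i 1)" for i
  have w: "A (w i) = axis i 1" for i
    using \<open>surj A\<close> by (simp add: w_def surj_f_inv_f)
  have "theta (\<chi> i j. - anti_coeff (\<alpha> (w i)) j) i = \<alpha> (w i)" for i
    using w[of i] \<alpha>[of "w i"]
    by (intro linear_form_eqI linear_theta)
      (auto simp: cotangent10_def A_def cart_eq_iff hol_coeff_theta anti_coeff_theta axis_def)
  then have "\<forall>i. theta (\<chi> i j. - anti_coeff (\<alpha> (w i)) j) i \<in> cotangent10 J0"
    using \<alpha> by simp
  then show ?thesis
    by blast
qed

subsection \<open>Permutations of the coordinates\<close>

lemma coordinate_permutation_orthogonal: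
  assumes "coordinate_permutation T"
  shows "orthogonal_transformation T"
proof -
  obtain \<pi> S where \<pi>: "\<pi> permutes UNIV"
    and T: "T = (\<lambda>q. \<chi> i. if i \<in> S then cnj (q $ \<pi> i) else q $ \<pi> i)"
    using assms by (auto simp: coordinate_permutation_def)
  have "T X \<bullet> T Y = (\<Sum>i\<in>UNIV. X $ \<pi> i \<bullet> Y $ \<pi> i)" for X Y
    unfolding inner_vec_def by (intro sum.cong) (auto simp: T inner_complex_def)
  also have "\<dots> X Y = X \<bullet> Y" for X Y
    using sum.permute[OF \<pi>, of "\<lambda>i. X $ i \<bullet> Y $ i"] by (simp add: inner_vec_def o_def)
  finally show ?thesis
    unfolding orthogonal_transformation_def by (auto simp: T cart_eq_iff intro!: linearI)
qed

lemma orthogonal_transformation_inverse: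
  fixes T :: "'a::euclidean_space \<Rightarrow> 'a"
  assumes "orthogonal_transformation T"
  shows "bij T" "T (inv_into UNIV T X) = X" "inv_into UNIV T (T X) = X" "orthogonal_transformation (inv_into UNIV T)" "linear T"
    "bounded_linear T" "linear (inv_into UNIV T)" "bounded_linear (inv_into UNIV T)"
proof -
  show bij: "bij T"
    using assms by (rule orthogonal_transformation_bij)
  then show inv: "T (inv_into UNIV T X) = X" "inv_into UNIV T (T X) = X" for X
    by (auto simp: bij_def surj_f_inv_f)
  show orth: "orthogonal_transformation (inv_into UNIV T)"
    using assms by (rule orthogonal_transformation_inv)
  show "linear T" "linear (inv_into UNIV T)"
    using assms orth by (auto simp: orthogonal_transformation_def)
  then show "bounded_linear T" "bounded_linear (inv_into UNIV T)"
    by (auto intro: linear_linear[THEN iffD2] simp: linear_conv_bounded_linear)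
qed

lemma almost_hermitian_push:
  assumes T: "orthogonal_transformation T" and J: "almost_hermitian_at (J (inv_into UNIV T p))"
  shows "almost_hermitian_at (push_acs T J p)"
proof -
  note T' = orthogonal_transformation_inverse[OF T]
  have "orthogonal_transformation (T \<circ> J (inv_into UNIV T p) \<circ> inv_into UNIV T)"
    using J T T' by (auto simp: almost_hermitian_at_def intro!: orthogonal_transformation_compose)
  moreover have "push_acs T J p = T \<circ> J (inv_into UNIV T p) \<circ> inv_into UNIV T"
    by (simp add: push_acs_def fun_eq_iff)
  moreover have "T (- X) = - T X" for X
    using T'(5) by (rule linear_neg)
  ultimately show ?thesis
    using J T' by (simp add: almost_hermitian_at_def)
qed

lemma cotangent10_push:
  assumes T: "orthogonal_transformation T" and \<alpha>: "\<alpha> \<in> cotangent10 (push_acs T J (T p))"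
  shows "\<alpha> \<circ> T \<in> cotangent10 (J p)"
proof -
  note T' = orthogonal_transformation_inverse[OF T]
  have "\<alpha> (T (J p X)) = \<i> * \<alpha> (T X)" for X
  proof -
    have "\<alpha> (push_acs T J (T p) (T X)) = \<i> * \<alpha> (T X)"
      using \<alpha> by (auto simp: cotangent10_def)
    then show ?thesis
      by (simp add: push_acs_def T')
  qed
  then show ?thesis
    using \<alpha> T' by (auto simp: cotangent10_def intro: linear_compose)
qed

text \<open>These are the coordinate permutations with identity reordering; conjugations alone
  suffice to reach the large cell.\<close>

definition conj_on :: "'m set \<Rightarrow> 'm::finite cspace \<Rightarrow> 'm cspace" where
  "conj_on S q = (\<chi> i. if i \<in> S then cnj (q $ i) else q $ i)"

lemma coordinate_permutation_conj_on: "coordinate_permutation (conj_on S)"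
  unfolding coordinate_permutation_def conj_on_def fun_eq_iff
  by (intro exI[of _ id] exI[of _ S]) (auto simp: permutes_id)

lemma coeff_conj_on:
  assumes "linear \<alpha>"
  shows "hol_coeff (\<alpha> \<circ> conj_on S) i = (if i \<in> S then anti_coeff \<alpha> i else hol_coeff \<alpha> i)"
    and "anti_coeff (\<alpha> \<circ> conj_on S) i = (if i \<in> S then hol_coeff \<alpha> i else anti_coeff \<alpha> i)"
proof -
  have "conj_on S (axis i 1) = axis i 1"
    "conj_on S (axis i \<i>) = (if i \<in> S then - axis i \<i> else axis i \<i>)"
    by (auto simp: conj_on_def cart_eq_iff axis_def)
  then show "hol_coeff (\<alpha> \<circ> conj_on S) i = (if i \<in> S then anti_coeff \<alpha> i else hol_coeff \<alpha> i)"
    and "anti_coeff (\<alpha> \<circ> conj_on S) i = (if i \<in> S then hol_coeff \<alpha> i else anti_coeff \<alpha> i)"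
    by (auto simp: hol_coeff_def anti_coeff_def linear_neg[OF assms])
qed

text \<open>
  The (1,0)-forms without \<open>dq\<close>-part form a space \<open>V\<close> of vectors of \<open>d\bar q\<close>-coefficients. Conjugating
  the coordinates in a maximal set \<open>S\<close> for which the restriction of \<open>V\<close> to \<open>C^S\<close> is onto makes this
  space trivial, because the space of (1,0)-forms is isotropic.
\<close>

lemma conj_on_exists:
  fixes J0 :: "'m::finite cspace \<Rightarrow> 'm cspace"
  assumes J: "almost_hermitian_at J0"
  obtains S where "\<And>\<alpha>. linear \<alpha> \<Longrightarrow> \<alpha> \<circ> conj_on S \<in> cotangent10 J0 \<Longrightarrow> (\<And>i. hol_coeff \<alpha> i = 0) \<Longrightarrow> \<alpha> = (\<lambda>X. 0)"
proof -
  define V where "V = {\<beta> \<in> cotangent10 J0. \<forall>i. hol_coeff \<beta> i = 0}"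
  \<comment> \<open>A dual family in \<open>V\<close> for the coordinates in S, which says that
    restriction of \<open>V\<close> to S is onto.\<close>
  define P where "P S \<longleftrightarrow> (\<forall>i\<in>S. \<exists>\<beta>\<in>V. anti_coeff \<beta> i = 1 \<and> (\<forall>k\<in>S - {i}. anti_coeff \<beta> k = 0))" for S
  have "P {}"
    by (simp add: P_def)
  then have "\<exists>S. P S \<and> (\<forall>S'. P S' \<longrightarrow> card S' \<le> card S)"
    by (rule ex_has_greatest_nat[where b = "Suc CARD('m)"]) (auto simp: less_Suc_eq_le intro: card_mono)
  then obtain S where S: "P S" and max: "\<And>S'. P S' \<Longrightarrow> card S' \<le> card S"
    by blast
  have V_zero: "\<beta> = (\<lambda>X. 0)" if \<beta>: "\<beta> \<in> V" and \<beta>S: "\<And>i. i \<in> S \<Longrightarrow> anti_coeff \<beta> i = 0" for \<beta>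
  proof (rule ccontr)
    assume "\<beta> \<noteq> (\<lambda>X. 0)"
    then obtain j where j: "anti_coeff \<beta> j \<noteq> 0"
      using \<beta> linear_form_eq_0[of \<beta>] by (auto simp: V_def cotangent10_def)
    then have "j \<notin> S"
      using \<beta>S by auto
    have V_comb: "(\<lambda>X. \<gamma> X + c * \<beta> X) \<in> V" if "\<gamma> \<in> V" for \<gamma> c
      using that \<beta> cotangent10_add[of \<gamma> J0 \<beta> c] by (auto simp: V_def hol_coeff_linear_combination)
    have zero: "(\<lambda>X. 0) \<in> V"
      by (auto simp: V_def cotangent10_def hol_coeff_def intro: linear_zero)
    \<comment> \<open>Here \<beta> vanishes on S but not at j. Rescaled, it serves the new index j;
      multiples of it correct the older dual forms at j without changing them on S. This contradicts
      maximality of S.\<close>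
    have "P (insert j S)"
      unfolding P_def
    proof
      fix i
      assume i: "i \<in> insert j S"
      show "\<exists>\<gamma>\<in>V. anti_coeff \<gamma> i = 1 \<and> (\<forall>k\<in>insert j S - {i}. anti_coeff \<gamma> k = 0)"
      proof (cases "i = j")
        case True
        have "anti_coeff (\<lambda>X. 0) k = 0" for k :: 'm
          by (simp add: anti_coeff_def)
        then show ?thesis
          using V_comb[OF zero, of "1 / anti_coeff \<beta> j"] j \<beta>S True
          by (intro bexI[of _ "\<lambda>X. 0 + 1 / anti_coeff \<beta> j * \<beta> X"])
            (auto simp only: hol_coeff_linear_combination, auto)
      next
        case False
        then obtain \<gamma> where \<gamma>: "\<gamma> \<in> V" "anti_coeff \<gamma> i = 1" "\<forall>k\<in>S - {i}. anti_coeff \<gamma> k = 0"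
          using i S by (auto simp: P_def)
        show ?thesis
          using V_comb[OF \<gamma>(1), of "- anti_coeff \<gamma> j / anti_coeff \<beta> j"] j \<beta>S False i \<gamma> \<open>j \<notin> S\<close>
          by (intro bexI[of _ "\<lambda>X. \<gamma> X + - anti_coeff \<gamma> j / anti_coeff \<beta> j * \<beta> X"])
            (auto simp only: hol_coeff_linear_combination, auto)
      qed
    qed
    then show False
      using max \<open>j \<notin> S\<close> by fastforce
  qed
  show ?thesis
  proof
    fix \<alpha> :: "'m cspace \<Rightarrow> complex"
    assume lin: "linear \<alpha>" and \<alpha>: "\<alpha> \<circ> conj_on S \<in> cotangent10 J0" and h: "\<And>i. hol_coeff \<alpha> i = 0"
    note coeff = coeff_conj_on[OF lin, of S]
    have a: "anti_coeff \<alpha> i = 0" if "i \<in> S" for i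
    proof -
      obtain \<beta> where \<beta>: "\<beta> \<in> V" "anti_coeff \<beta> i = 1" "\<And>k. k \<in> S \<Longrightarrow> k \<noteq> i \<Longrightarrow> anti_coeff \<beta> k = 0"
        using S \<open>i \<in> S\<close> by (auto simp: P_def)
      \<comment> \<open>Outside S the first form has no dq-part, and \<beta> has none anywhere, so
        the pairing runs over S; duality of \<beta> singles out the index i.\<close>
      have "(\<Sum>k\<in>UNIV. hol_coeff (\<alpha> \<circ> conj_on S) k * anti_coeff \<beta> k +
          anti_coeff (\<alpha> \<circ> conj_on S) k * hol_coeff \<beta> k) = 0"
        using \<beta>(1) by (intro cotangent10_pairing[OF J \<alpha>]) (auto simp: V_def)
      moreover have "hol_coeff (\<alpha> \<circ> conj_on S) k * anti_coeff \<beta> k +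
          anti_coeff (\<alpha> \<circ> conj_on S) k * hol_coeff \<beta> k = (if k = i then anti_coeff \<alpha> i else 0)" for k
        using \<beta> h \<open>i \<in> S\<close> by (auto simp: coeff V_def)
      ultimately show ?thesis
        by simp
    qed
    have "\<alpha> \<circ> conj_on S \<in> V"
      using \<alpha> h a by (auto simp: V_def coeff)
    \<comment> \<open>On S the conjugate coefficients of the composed form are the dq-coefficients
      of \<alpha>, which vanish by assumption.\<close>
    then have "\<alpha> \<circ> conj_on S = (\<lambda>X. 0)"
      using h by (intro V_zero) (auto simp: coeff)
    moreover have "conj_on S (conj_on S X) = X" for X :: "'m cspace"
      by (auto simp: conj_on_def cart_eq_iff)
    ultimately show "\<alpha> = (\<lambda>X. 0)"
      by (metis comp_apply ext)
  qed
qed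

subsection \<open>Positivity\<close>

definition ebasis :: "'m::finite + 'm \<Rightarrow> 'm cspace" where
  "ebasis r = (case r of Inl j \<Rightarrow> axis j 1 | Inr j \<Rightarrow> axis j \<i>)"

text \<open>The matrix with columns \<open>e s\<close>, whose determinant decides the orientation in
  \<open>oriented_orthonormal_basis\<close>.\<close>

definition cmat :: "('m::finite + 'm \<Rightarrow> 'm cspace) \<Rightarrow> real^('m + 'm)^('m + 'm)" where
  "cmat e = (\<chi> r s. real_coord (e s) r)"

definition rvec :: "'m::finite cspace \<Rightarrow> real^('m + 'm)" where
  "rvec v = (\<chi> r. real_coord v r)"

lemma sum_UNIV_sum:
  fixes f :: "'m::finite + 'm \<Rightarrow> 'a::comm_monoid_add"
  shows "(\<Sum>s\<in>UNIV. f s) = (\<Sum>j\<in>UNIV. f (Inl j)) + (\<Sum>j\<in>UNIV. f (Inr j))"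
  using sum.Plus[of UNIV UNIV f] by (simp add: o_def)

lemma linear_real_coord: "linear (\<lambda>v. real_coord v r)"
  by (cases r) (auto simp: real_coord_def intro!: linearI)

lemma real_coord_expansion:
  "(\<Sum>s\<in>UNIV. real_coord v s *\<^sub>R ebasis s) = v" for v :: "'m::finite cspace"
  by (subst (2) cspace_expansion[of v])
    (simp add: sum_UNIV_sum real_coord_def ebasis_def sum.distrib)

lemma cmat_compose:
  assumes "linear g"
  shows "cmat (\<lambda>s. g (e s)) = cmat (\<lambda>s. g (ebasis s)) ** cmat e"
proof -
  have "real_coord (g v) r = (\<Sum>t\<in>UNIV. real_coord (g (ebasis t)) r * real_coord v t)" for v r
  proof -
    have "real_coord (g v) r = real_coord (g (\<Sum>s\<in>UNIV. real_coord v s *\<^sub>R ebasis s)) r"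
      by (simp only: real_coord_expansion)
    also have "\<dots> = (\<Sum>t\<in>UNIV. real_coord (g (ebasis t)) r * real_coord v t)"
      by (simp add: linear_sum[OF assms] linear_cmul[OF assms] linear_sum[OF linear_real_coord]
          linear_cmul[OF linear_real_coord] mult.commute)
    finally show ?thesis .
  qed
  note * = this
  show ?thesis
    unfolding cart_eq_iff
  proof (intro allI)
    show "cmat (\<lambda>s. g (e s)) $ r $ s = (cmat (\<lambda>s. g (ebasis s)) ** cmat e) $ r $ s" for r s
      using *[of "e s" r] by (simp add: cmat_def matrix_matrix_mult_def)
  qed
qed

lemma cmat_ebasis: "cmat ebasis = Finite_Cartesian_Product.mat 1"
  by (auto simp: cart_eq_iff cmat_def Finite_Cartesian_Product.mat_def ebasis_def real_coord_def axis_def split: sum.splits)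

lemma cmat_mult_rvec:
  assumes "linear g"
  shows "cmat (\<lambda>s. g (ebasis s)) *v rvec v = rvec (g v)"
proof -
  \<comment> \<open>A vector is a column of the matrix of a constant family, which reduces the claim
    to \<open>cmat_compose\<close>; any column would do.\<close>
  have "rvec w = cmat (\<lambda>_. w) *v axis (Inl undefined) 1" for w :: "'a cspace"
    by (simp add: cart_eq_iff matrix_vector_mult_def cmat_def rvec_def axis_def
        if_distrib[where f = "\<lambda>x. _ * x"] cong: if_cong)
  then show ?thesis
    by (metis (no_types) cmat_compose[OF assms, of "\<lambda>_. v"] matrix_vector_mul_assoc)
qed

lemma bij_rvec: "bij (rvec :: 'm::finite cspace \<Rightarrow> _)"
proof (rule bijI')
  show "rvec v = rvec w \<longleftrightarrow> v = w" for v w :: "'m cspace"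
    by (auto simp: rvec_def cart_eq_iff complex_eq_iff real_coord_def split: sum.splits)
  show "\<exists>v :: 'm cspace. x = rvec v" for x
    by (intro exI[of _ "\<chi> j. Complex (x $ Inl j) (x $ Inr j)"])
      (auto simp: rvec_def cart_eq_iff real_coord_def split: sum.splits)
qed

lemma rvec_0: "rvec 0 = 0"
  by (simp add: rvec_def cart_eq_iff linear_0[OF linear_real_coord])

lemma det_cmat_nonzero_iff:
  fixes g :: "'m::finite cspace \<Rightarrow> 'm cspace"
  assumes "linear g"
  shows "Determinants.det (cmat (\<lambda>s. g (ebasis s))) \<noteq> 0 \<longleftrightarrow> (\<forall>v. g v = 0 \<longrightarrow> v = 0)"
proof -
  have "Determinants.det (cmat (\<lambda>s. g (ebasis s))) \<noteq> 0 \<longleftrightarrow>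
      (\<forall>x. cmat (\<lambda>s. g (ebasis s)) *v x = 0 \<longrightarrow> x = 0)"
    by (metis invertible_det_nz invertible_left_inverse matrix_left_invertible_ker)
  also have "\<dots> \<longleftrightarrow> (\<forall>v. rvec (g v) = 0 \<longrightarrow> rvec v = 0)"
    using cmat_mult_rvec[OF assms] bij_rvec by (metis bij_pointE)
  also have "\<dots> \<longleftrightarrow> (\<forall>v. g v = 0 \<longrightarrow> v = 0)"
    using bij_rvec rvec_0 by (metis bij_pointE)
  finally show ?thesis .
qed

text \<open>Intermediate value theorem: the image of a connected set under the determinant is an
  interval that omits 0.\<close>

lemma det_pos_connected:
  fixes A :: "'a::topological_space \<Rightarrow> real^'n::finite^'n"
  assumes S: "connected S" "a \<in> S" "b \<in> S"
    and cont: "\<And>i j. continuous_on S (\<lambda>x. A x $ i $ j)"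
    and nz: "\<And>x. x \<in> S \<Longrightarrow> Determinants.det (A x) \<noteq> 0" and a: "Determinants.det (A a) > 0"
  shows "Determinants.det (A b) > 0"
proof (rule ccontr)
  assume b: "\<not> Determinants.det (A b) > 0"
  have "continuous_on S (\<lambda>x. Determinants.det (A x))"
    unfolding Determinants.det_def by (intro continuous_intros cont)
  then have "connected ((\<lambda>x. Determinants.det (A x)) ` S)"
    by (rule connected_continuous_image[OF _ S(1)])
  then have "0 \<in> (\<lambda>x. Determinants.det (A x)) ` S"
    by (rule connectedD_interval[OF _ imageI[OF S(3)] imageI[OF S(2)]]) (use a b in linarith)+
  then obtain x where "x \<in> S" "0 = Determinants.det (A x)"
    by (rule imageE)
  then show False
    using nz[of x] by simp
qed

text \<open>The real determinant of \<open>X - t M \bar X\<close> does not vanish for real \<open>t\<close>, and it is 1 at \<open>t = 0\<close>.\<close>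

lemma det_cmat_Theta_pos:
  assumes "M \<in> so_complex"
  shows "Determinants.det (cmat (\<lambda>s. ebasis s - M *v vcnj (ebasis s))) > 0"
proof -
  define N where "N t = (\<chi> i j. of_real t * M $ i $ j)" for t :: real
  have N: "N t \<in> so_complex" for t
    unfolding so_complex_iff
  proof (intro allI)
    show "N t $ i $ j = - N t $ j $ i" for i j
      using arg_cong[OF so_complexD[OF assms, of i j], of "(*) (of_real t)"] by (simp add: N_def)
  qed
  let ?A = "\<lambda>t. cmat (\<lambda>s. ebasis s - N t *v vcnj (ebasis s))"
  have "Determinants.det (?A 1) > 0"
  proof (rule det_pos_connected[where A = ?A and S = UNIV and a = 0 and b = 1])
    show "continuous_on UNIV (\<lambda>t. ?A t $ r $ s)" for r s
      by (cases r) (auto simp: cmat_def N_def real_coord_def matrix_vector_mult_def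
          intro!: continuous_intros)
    show "Determinants.det (?A t) \<noteq> 0" for t
      unfolding det_cmat_nonzero_iff[OF linear_Theta] using Theta_skew_injective[OF N] by blast
    have "N 0 *v X = 0" for X
      by (simp add: N_def cart_eq_iff matrix_vector_mult_def)
    then show "Determinants.det (?A 0) > 0"
      by (simp add: cmat_ebasis)
  qed (auto simp: connected_UNIV)
  moreover have "N 1 = M"
    by (simp add: N_def cart_eq_iff)
  ultimately show ?thesis
    by simp
qed


text \<open>
  The invertible matrices on the complex line through the identity and \<open>F\<close> are connected, because
  the others are the zeros of a polynomial.
\<close>

lemma det_cmat_complex_pos:
  fixes F :: "'m::finite cmatrix"
  assumes "Determinants.det F \<noteq> 0"
  shows "Determinants.det (cmat (\<lambda>s. F *v ebasis s)) > 0"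
proof -
  define G where "G t = (\<chi> i j. (Finite_Cartesian_Product.mat 1 :: 'm cmatrix) $ i $ j + t * (F - Finite_Cartesian_Product.mat 1) $ i $ j)" for t
  \<comment> \<open>The determinant of a matrix with linear polynomial entries, so the parameters t
    with singular \<open>G t\<close> are the roots of \<open>p\<close>. It is not the zero
    polynomial because \<open>G 1 = F\<close>.\<close>
  define p where "p = Determinants.det (\<chi> i j. [:(Finite_Cartesian_Product.mat 1 :: 'm cmatrix) $ i $ j, (F - Finite_Cartesian_Product.mat 1) $ i $ j:])"
  have p: "poly p t = Determinants.det (G t)" for t
    unfolding p_def Determinants.det_def
    by (simp add: poly_sum poly_prod G_def algebra_simps)
  have G: "G 0 = Finite_Cartesian_Product.mat 1" "G 1 = F"
    by (auto simp: G_def cart_eq_iff)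
  let ?S = "- {t. poly p t = 0}"
  have "poly p 1 \<noteq> 0"
    using assms by (simp add: p G)
  then have "finite {t. poly p t = 0}"
    by (intro poly_roots_finite) auto
  \<comment> \<open>The parameter must be complex: deleting finitely many points may disconnect a
    line but not a plane.\<close>
  then have "connected ?S"
    by (intro path_connected_imp_connected path_connected_complement_countable countable_finite) auto
  have lin: "linear (\<lambda>v. G t *v v)" for t
    by (rule linear_matrix_vector_mult_complex)
  have "Determinants.det (cmat (\<lambda>s. G 1 *v ebasis s)) > 0"
  proof (rule det_pos_connected[where A = "\<lambda>t. cmat (\<lambda>s. G t *v ebasis s)" and S = ?S and a = 0 and b = 1])
    show "continuous_on ?S (\<lambda>t. cmat (\<lambda>s. G t *v ebasis s) $ r $ s)" for r s
      by (cases r) (auto simp: cmat_def G_def real_coord_def matrix_vector_mult_def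
          intro!: continuous_intros)
    show "Determinants.det (cmat (\<lambda>s. G t *v ebasis s)) \<noteq> 0" if "t \<in> ?S" for t
    proof -
      have "invertible (G t)"
        using that by (simp add: invertible_det_nz p)
      then have "\<forall>v. G t *v v = 0 \<longrightarrow> v = 0"
        unfolding invertible_left_inverse matrix_left_invertible_ker .
      then show ?thesis
        using det_cmat_nonzero_iff[OF lin] by blast
    qed
    show "connected ?S"
      by (rule \<open>connected ?S\<close>)
    show "0 \<in> ?S" "1 \<in> ?S"
      using assms by (auto simp: p G)
    show "Determinants.det (cmat (\<lambda>s. G 0 *v ebasis s)) > 0"
      by (simp add: G cmat_ebasis)
  qed
  then show ?thesis
    by (simp add: G)
qed

text \<open>Gram-Schmidt adapted to \<open>J0\<close>. As long as an index is missing, the vectors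
  found and their images span a proper subspace; a unit vector orthogonal to it is also orthogonal
  to its own image, since \<open>J0\<close> is skew.\<close>

lemma J_orthonormal_exists:
  fixes J0 :: "'a::euclidean_space \<Rightarrow> 'a" and A :: "'i::finite set"
  assumes J: "almost_hermitian_at J0" and dim: "DIM('a) = 2 * CARD('i)"
  shows "\<exists>e. \<forall>i\<in>A. \<forall>j\<in>A. e i \<bullet> e j = (if i = j then 1 else 0) \<and> e i \<bullet> J0 (e j) = 0"
proof -
  note J = almost_hermitian_inner[OF J]
  have "finite A"
    by simp
  then show ?thesis
  proof induction
    case (insert k A)
    then obtain e where e: "\<And>i j. i \<in> A \<Longrightarrow> j \<in> A \<Longrightarrow> e i \<bullet> e j = (if i = j then 1 else 0)"
      "\<And>i j. i \<in> A \<Longrightarrow> j \<in> A \<Longrightarrow> e i \<bullet> J0 (e j) = 0"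
      by blast
    have "dim (e ` A \<union> J0 ` e ` A) \<le> card (e ` A \<union> J0 ` e ` A)"
      by (rule dim_le_card') simp
    also have "\<dots> \<le> card A + card A"
      by (intro order_trans[OF card_Un_le] add_mono card_image_le order_trans[OF card_image_le])
        auto
    also have "\<dots> < DIM('a)"
      using insert card_mono[of UNIV "insert k A"] by (simp add: dim)
    finally have "dim (e ` A \<union> J0 ` e ` A) < DIM('a)" .
    then obtain u where u: "u \<noteq> 0" "\<And>y. y \<in> span (e ` A \<union> J0 ` e ` A) \<Longrightarrow> Linear_Algebra.orthogonal u y"
      using orthogonal_to_subspace_exists by blast
    define w where "w = u /\<^sub>R norm u"
    have w: "w \<bullet> w = 1"
      using u(1) by (simp add: w_def dot_square_norm power2_eq_square)
    have we: "w \<bullet> e i = 0" "w \<bullet> J0 (e i) = 0" if "i \<in> A" for i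
      using that u(2)[of "e i"] u(2)[of "J0 (e i)"]
      by (auto simp: w_def Linear_Algebra.orthogonal_def intro: span_base)
    have "x \<bullet> J0 x = 0" for x
      using J(2)[of x x] by (simp add: inner_commute)
    moreover have "J0 w \<bullet> e i = 0" if "i \<in> A" for i
      using we[OF that] J(2) by simp
    ultimately show ?case
      using e w we insert.hyps
      by (intro exI[of _ "e(k := w)"]) (auto simp: inner_commute)
  qed simp
qed

text \<open>The map X - M conj(X) intertwines \<open>J0\<close> with multiplication by the imaginary
  unit. It therefore carries a frame u_j, \<open>J0\<close> u_j to the real frame of a complex
  matrix F. The real determinants of this map and of F are both positive, hence so is that of the
  frame.\<close>

lemma positive_acs_theta:
  fixes J0 :: "'m::finite cspace \<Rightarrow> 'm cspace"
  assumes J0: "almost_hermitian_at J0" and M: "M \<in> so_complex"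
    and \<theta>: "\<And>i. theta M i \<in> cotangent10 J0"
  shows "positive_acs J0"
proof -
  note J = almost_hermitian_inner[OF J0]
  have "DIM('m cspace) = 2 * CARD('m)"
    by simp
  then obtain u :: "'m \<Rightarrow> 'm cspace" where u: "\<And>i j. u i \<bullet> u j = (if i = j then 1 else 0)"
      "\<And>i j. u i \<bullet> J0 (u j) = 0"
    using J_orthonormal_exists[OF J0, of UNIV] by blast
  define e where "e r = (case r of Inl j \<Rightarrow> u j | Inr j \<Rightarrow> J0 (u j))" for r
  have e: "e r \<bullet> e s = (if r = s then 1 else 0)" for r s
    using u J(1) by (cases r; cases s) (auto simp: e_def inner_commute)
  have "(\<Sum>r\<in>UNIV. real_coord v r * real_coord w r) = v \<bullet> w" for v w :: "'m cspace"
    by (simp add: sum_UNIV_sum real_coord_def inner_vec_def inner_complex_def sum.distrib)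
  then have "Finite_Cartesian_Product.transpose (cmat e) ** cmat e = Finite_Cartesian_Product.mat 1"
    using e by (simp add: cart_eq_iff cmat_def matrix_matrix_mult_def Finite_Cartesian_Product.mat_def
        Finite_Cartesian_Product.transpose_def)
  then have nz: "Determinants.det (cmat e) \<noteq> 0"
    by (metis invertible_det_nz invertible_left_inverse)
  define \<Theta> where "\<Theta> X = X - M *v vcnj X" for X :: "'m cspace"
  have lin: "linear \<Theta>"
    unfolding \<Theta>_def by (rule linear_Theta)
  have \<Theta>J: "\<Theta> (J0 X) = \<i> *s \<Theta> X" for X
    using \<theta> by (simp add: cotangent10_def theta_eq \<Theta>_def cart_eq_iff right_diff_distrib)
  define F where "F = (\<chi> i j. \<Theta> (u j) $ i)"
  \<comment> \<open>The columns with index \<open>Inr\<close> agree because of complex linearity: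
    \<open>J0\<close> on the left becomes the factor \<i> on the right.\<close>
  have F: "(\<lambda>s. F *v ebasis s) = (\<lambda>s. \<Theta> (e s))"
    by (auto simp: F_def e_def ebasis_def \<Theta>J cart_eq_iff matrix_vector_mult_def axis_def
        if_distrib[where f = "\<lambda>x. _ * x"] fun_eq_iff cong: if_cong split: sum.split)
  have det: "Determinants.det (cmat (\<lambda>s. F *v ebasis s)) =
      Determinants.det (cmat (\<lambda>s. \<Theta> (ebasis s))) * Determinants.det (cmat e)"
    unfolding F cmat_compose[OF lin, of e] by (rule det_mul)
  have pos: "Determinants.det (cmat (\<lambda>s. \<Theta> (ebasis s))) > 0"
    unfolding \<Theta>_def by (rule det_cmat_Theta_pos[OF M])
  have "Determinants.det (cmat (\<lambda>s. F *v ebasis s)) \<noteq> 0"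
    using det pos nz by simp
  then have "Determinants.det F \<noteq> 0"
    unfolding det_cmat_nonzero_iff[OF linear_matrix_vector_mult_complex]
    by (metis invertible_det_nz invertible_left_inverse matrix_left_invertible_ker)
  then have "Determinants.det (cmat e) > 0"
    using det_cmat_complex_pos[of F] det pos by (simp add: zero_less_mult_iff)
  moreover have "e (Inr j) = J0 (e (Inl j))" for j
    by (simp add: e_def)
  ultimately show ?thesis
    unfolding positive_acs_def oriented_orthonormal_basis_def
    by (intro exI[of _ e]) (simp add: e cmat_def)
qed

text \<open>Type (1,0) of the m forms already forces the rest: isotropy gives skewness and the span,
  and skewness gives positivity.\<close>

lemma is_J_of_theta:
  fixes J0 :: "'m::finite cspace \<Rightarrow> 'm cspace"
  assumes J: "almost_hermitian_at J0" and \<theta>: "\<And>i. theta M i \<in> cotangent10 J0"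
  shows "is_J_of M J0"
  unfolding is_J_of_def
  using J positive_acs_theta[OF J theta_in_cotangent10_skew[OF J \<theta>] \<theta>]
    theta_in_cotangent10_span[OF J \<theta>] by simp

subsection \<open>The determinants \<open>D^a_ij\<close>\<close>

text \<open>Expand row i in unit vectors. The vector at i leaves one replaced row, the vector at j
  leaves the same after exchanging two rows, and every other one repeats a row.\<close>

lemma det_unit_rows_except_two:
  fixes u v :: "'a::field^'n::finite"
  assumes ij: "i \<noteq> j"
  shows "Determinants.det (\<chi> r. if r = i then u else if r = j then v else axis r 1) =
    u $ i * v $ j - u $ j * v $ i"
proof -
  let ?D = "\<lambda>w. Determinants.det (\<chi> r. if r = i then w else if r = j then v else axis r 1)"
  have row: "Determinants.det (\<chi> r. if r = k then w else axis r 1) = w $ k" for k and w :: "'a^'n"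
  proof -
    have "Finite_Cartesian_Product.row l (Finite_Cartesian_Product.mat 1) = axis l (1::'a)" for l :: 'n
      by (auto simp: Finite_Cartesian_Product.row_def Finite_Cartesian_Product.mat_def axis_def cart_eq_iff)
    moreover have "(\<Sum>l\<in>UNIV. w $ l *s axis l 1) = w"
      by (rule basis_expansion)
    ultimately show ?thesis
      using cramer_lemma_transpose[of k w "Finite_Cartesian_Product.mat 1"] by (simp cong: if_cong)
  qed
  have "?D u = ?D (\<Sum>l\<in>UNIV. u $ l *s axis l 1)"
    by (simp only: basis_expansion)
  also have "\<dots> = (\<Sum>l\<in>UNIV. ?D (u $ l *s axis l 1))"
    by (rule Determinants.det_linear_row_sum[of UNIV i "\<lambda>_ l. u $ l *s axis l 1"]) simp
  also have "\<dots> = (\<Sum>l\<in>UNIV. u $ l * ?D (axis l 1))"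
    by (intro sum.cong refl Determinants.det_row_mul)
  also have "\<dots> = (\<Sum>l\<in>UNIV. if l = i then u $ i * v $ j else if l = j then - (u $ j * v $ i) else 0)"
  proof (intro sum.cong refl)
    fix l
    consider "l = i" | "l = j" | "l \<noteq> i" "l \<noteq> j"
      by blast
    then show "u $ l * ?D (axis l 1) =
      (if l = i then u $ i * v $ j else if l = j then - (u $ j * v $ i) else 0)"
    proof cases
      case 1
      have "(\<chi> r. if r = i then axis l 1 else if r = j then v else axis r (1::'a)) =
          (\<chi> r. if r = j then v else axis r 1)"
        using 1 ij by (auto simp: cart_eq_iff)
      then show ?thesis
        using 1 row[of j v] by simp
    next
      case 2
      let ?A = "\<chi> r. if r = i then v else axis r (1::'a)"
      have "(\<chi> r. if r = i then axis l 1 else if r = j then v else axis r (1::'a)) =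
          (\<chi> r. ?A $ Transposition.transpose i j r)"
        using 2 ij by (auto simp: cart_eq_iff Transposition.transpose_def)
      moreover have "Determinants.det (\<chi> r. ?A $ Transposition.transpose i j r) = - (v $ i)"
        using ij Determinants.det_permute_rows[of "Transposition.transpose i j" ?A]
        by (simp add: permutes_swap_id sign_swap_id row)
      ultimately show ?thesis
        using 2 ij by simp
    next
      case 3
      have "?D (axis l 1) = 0"
        using 3 by (intro Determinants.det_identical_rows[of i l]) (auto simp: Finite_Cartesian_Product.row_def)
      then show ?thesis
        using 3 by simp
    qed
  qed
  also have "\<dots> = (\<Sum>l\<in>{i, j}. if l = i then u $ i * v $ j else - (u $ j * v $ i))"
    by (rule sum.mono_neutral_cong_right) auto
  also have "\<dots> = u $ i * v $ j - u $ j * v $ i"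
    using ij by simp
  finally show ?thesis .
qed

text \<open>Jacobi's identity for complementary minors of size 2. Multiplying by the inverse B turns
  all rows except i and j into unit rows; row i becomes row a of B and row j becomes d B.\<close>

lemma det_two_rows_replaced:
  fixes K B :: "'a::field^'n::finite^'n"
  assumes ij: "i \<noteq> j" and KB: "K ** B = Finite_Cartesian_Product.mat 1"
  shows "Determinants.det (\<chi> r. if r = i then axis a 1 else if r = j then d else K $ r) =
    Determinants.det K * (\<Sum>b\<in>UNIV. d $ b * (B $ a $ i * B $ b $ j - B $ a $ j * B $ b $ i))"
    (is "Determinants.det ?N = _")
proof -
  have "(?N ** B) $ r $ c =
      (\<chi> r. if r = i then B $ a else if r = j then d v* B else axis r 1) $ r $ c" for r c
  proof (cases "r = i \<or> r = j")
    case True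
    then show ?thesis
      using ij by (auto simp: matrix_matrix_mult_def vector_matrix_mult_def axis_def
          if_distrib[where f = "\<lambda>x. x * _"] if_distrib[where f = "\<lambda>x. _ * x"] mult.commute
          cong: if_cong)
  next
    case False
    have "(K ** B) $ r $ c = axis r 1 $ c"
      by (simp add: KB Finite_Cartesian_Product.mat_def axis_def eq_commute)
    then show ?thesis
      using False by (simp add: matrix_matrix_mult_def)
  qed
  then have "?N ** B = (\<chi> r. if r = i then B $ a else if r = j then d v* B else axis r 1)"
    unfolding cart_eq_iff by blast
  then have "Determinants.det (?N ** B) = B $ a $ i * (d v* B) $ j - B $ a $ j * (d v* B) $ i"
    by (simp only: det_unit_rows_except_two[OF ij])
  also have "\<dots> = (\<Sum>b\<in>UNIV. d $ b * (B $ a $ i * B $ b $ j - B $ a $ j * B $ b $ i))"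
    by (simp add: vector_matrix_mult_def sum_distrib_left algebra_simps flip: sum_subtractf)
  finally have S: "Determinants.det ?N * Determinants.det B =
      (\<Sum>b\<in>UNIV. d $ b * (B $ a $ i * B $ b $ j - B $ a $ j * B $ b $ i))"
    by (simp only: Determinants.det_mul)
  have "Determinants.det K * Determinants.det B = 1"
    using arg_cong[OF KB, of Determinants.det] by (simp add: Determinants.det_mul)
  then have "Determinants.det ?N = (Determinants.det K * Determinants.det B) * Determinants.det ?N"
    by simp
  also have "\<dots> = Determinants.det K * (Determinants.det ?N * Determinants.det B)"
    by (simp only: ac_simps)
  finally show ?thesis
    unfolding S .
qed

text \<open>Conjugation by the enumeration matches the permutations of the positions with those of
  the index type and preserves the sign.\<close>

lemma det_eq_det_enumeration:
  fixes A :: "'a::comm_ring_1^'n::finite^'n"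
  assumes l: "distinct l" "set l = (UNIV :: 'n set)"
  shows "Determinants.det A =
    Determinant.det (Matrix.mat CARD('n) CARD('n) (\<lambda>(r, s). A $ (l ! r) $ (l ! s)))"
proof -
  let ?n = "CARD('n)" and ?f = "(!) l"
  have len: "length l = ?n"
    using distinct_card[OF l(1)] l(2) by simp
  have f: "bij_betw ?f {0..<?n} UNIV"
    using bij_betw_nth[OF l(1), of "{0..<?n}" UNIV] len l(2) by (simp add: atLeast0LessThan)
  then have inj: "inj_on ?f {0..<?n}"
    by (simp add: bij_betw_def)
  let ?g = "map_permutation {0..<?n} ?f"
  have "bij_betw ?g {p. p permutes {0..<?n}} {p. p permutes UNIV}"
  proof (rule bij_betw_byWitness[where f' = "map_permutation UNIV (inv_into {0..<?n} ?f)"])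
    have "map_permutation UNIV (inv_into {0..<?n} ?f) (?g p) = p" if "p permutes {0..<?n}" for p
      using f that by (intro map_permutation_compose_inv[OF f]) (auto simp: inj)
    then show "\<forall>p\<in>{p. p permutes {0..<?n}}. map_permutation UNIV (inv_into {0..<?n} ?f) (?g p) = p"
      by blast
    have "?g (map_permutation UNIV (inv_into {0..<?n} ?f) p) = p" if "p permutes UNIV" for p
      using that bij_betw_inv_into[OF f] f
      by (intro map_permutation_compose_inv) (auto simp: bij_betw_inv_into_right)
    then show "\<forall>p\<in>{p. p permutes UNIV}. ?g (map_permutation UNIV (inv_into {0..<?n} ?f) p) = p"
      by blast
  qed (use f bij_betw_inv_into[OF f] in \<open>auto intro: map_permutation_permutes\<close>)
  then have "Determinants.det A = (\<Sum>p | p permutes {0..<?n}. of_int (sign (?g p)) * (\<Prod>i\<in>UNIV. A $ i $ ?g p i))"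
    unfolding Determinants.det_def by (rule sum.reindex_bij_betw[symmetric])
  also have "\<dots> = (\<Sum>p | p permutes {0..<?n}. of_int (sign p) * (\<Prod>i=0..<?n. A $ (l ! i) $ (l ! p i)))"
  proof (intro sum.cong refl)
    fix p
    assume "p \<in> {p. p permutes {0..<?n}}"
    then have p: "p permutes {0..<?n}"
      by simp
    have "(\<Prod>i\<in>UNIV. A $ i $ ?g p i) = (\<Prod>i=0..<?n. A $ (l ! i) $ ?g p (l ! i))"
      by (rule prod.reindex_bij_betw[OF f, symmetric])
    also have "\<dots> = (\<Prod>i=0..<?n. A $ (l ! i) $ (l ! p i))"
      by (intro prod.cong refl) (simp add: map_permutation_apply[OF inj])
    finally show "of_int (sign (?g p)) * (\<Prod>i\<in>UNIV. A $ i $ ?g p i) =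
        of_int (sign p) * (\<Prod>i=0..<?n. A $ (l ! i) $ (l ! p i))"
      using sign_map_permutation[OF inj p] by simp
  qed
  also have "\<dots> = Determinant.det (Matrix.mat ?n ?n (\<lambda>(r, s). A $ (l ! r) $ (l ! s)))"
    unfolding Determinant.det_def
    by (auto intro!: sum.cong prod.cong dest: permutes_in_image[of _ "{0..<?n}"])
  finally show ?thesis .
qed

section \<open>Positions in the increasing enumeration of the indices\<close>

lemma nth_remove1:
  assumes "distinct l" "p < length l" "s < length l - 1"
  shows "remove1 (l ! p) l ! s = l ! (if s < p then s else Suc s)"
proof -
  have "l = take p l @ l ! p # drop (Suc p) l"
    using assms(2) by (rule id_take_nth_drop)
  moreover have "l ! p \<notin> set (take p l)"
    using assms(1,2) by (auto simp: in_set_conv_nth nth_eq_iff_index_eq)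
  ultimately have "remove1 (l ! p) l = take p l @ drop (Suc p) l"
    by (metis remove1.simps(2) remove1_append)
  then show ?thesis
    using assms(2,3) by (auto simp: nth_append min_def)
qed

text \<open>List positions start at 0 and \<open>idx\<close> at 1. The indices up to i are the
  entries at positions 0, ..., p.\<close>

lemma idx_position:
  fixes i :: "'m::{finite,linorder}"
  assumes "p < CARD('m)" "sorted_list_of_set UNIV ! p = i"
  shows "idx i = Suc p"
proof -
  let ?l = "sorted_list_of_set (UNIV :: 'm set)"
  have mono: "?l ! r < ?l ! s" if "r < s" "s < CARD('m)" for r s
    using that strict_sorted_list_of_set[of "UNIV :: 'm set"] by (simp add: sorted_wrt_iff_nth_less)
  have "{j. j \<le> i} = (!) ?l ` {..p}"
  proof (intro equalityI subsetI)
    fix j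
    assume "j \<in> {j. j \<le> i}"
    moreover obtain r where "r < CARD('m)" "?l ! r = j"
      using in_set_conv_nth[of j ?l] by auto
    ultimately show "j \<in> (!) ?l ` {..p}"
      using mono[of p r] assms by (cases "r \<le> p") auto
  qed (use mono[of _ p] assms in \<open>auto simp: order_le_less\<close>)
  moreover have "inj_on ((!) ?l) {..p}"
    using assms(1) by (auto simp: inj_on_def nth_eq_iff_index_eq)
  ultimately show ?thesis
    by (simp add: idx_def card_image)
qed

lemma position_exists:
  fixes i :: "'m::{finite,linorder}"
  obtains p where "p < CARD('m)" "sorted_list_of_set UNIV ! p = i" "idx i = Suc p"
proof -
  obtain p where "p < CARD('m)" "sorted_list_of_set UNIV ! p = i"
    using in_set_conv_nth[of i "sorted_list_of_set UNIV"] by auto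
  with idx_position that show thesis
    by blast
qed

lemma idx_less: "i < j \<Longrightarrow> idx i < idx j"
proof -
  assume ij: "i < j"
  then have "j \<in> {k. k \<le> j}" "j \<notin> {k. k \<le> i}"
    by auto
  then have "{k. k \<le> i} \<noteq> {k. k \<le> j}"
    by blast
  moreover have "{k. k \<le> i} \<subseteq> {k. k \<le> j}"
    using ij by auto
  ultimately show "idx i < idx j"
    unfolding idx_def by (intro psubset_card_mono) auto
qed

text \<open>
  Expanding along the row \<open>e_a\<close> removes the row \<open>i\<close> and the column \<open>a\<close>. The row \<open>d\<close> is then at the
  position \<open>idx j - 1\<close> instead of the first one; expansion along \<open>d\<close> in both matrices gives the sign.
\<close>

lemma det_eq_Ddet:
  fixes K :: "'m::{finite,linorder} cmatrix"
  assumes ij: "i < j"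
  shows "Determinants.det (\<chi> r. if r = i then axis a 1 else if r = j then d else K $ r) =
    (-1) ^ (idx i + idx j + idx a) * Ddet (($) d) K a i j"
    (is "Determinants.det ?N = _")
proof -
  let ?l = "sorted_list_of_set (UNIV :: 'm set)" and ?n = "CARD('m)"
  obtain p where p: "p < ?n" "?l ! p = i" "idx i = Suc p"
    by (rule position_exists)
  obtain q where q: "q < ?n" "?l ! q = j" "idx j = Suc q"
    by (rule position_exists)
  obtain t where t: "t < ?n" "?l ! t = a" "idx a = Suc t"
    by (rule position_exists)
  have pq: "p < q"
    using idx_less[OF ij] p(3) q(3) by simp
  have nth_eq: "?l ! r = ?l ! s \<longleftrightarrow> r = s" if "r < ?n" "s < ?n" for r s
    using that by (simp add: nth_eq_iff_index_eq)
  define cols where "cols = sorted_list_of_set (UNIV - {a})"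
  define rows where "rows = sorted_list_of_set (UNIV - {i, j})"
  have cols: "cols ! s = ?l ! (if s < t then s else Suc s)" if "s < ?n - 1" for s
    using that t nth_remove1[of ?l t s] by (simp add: cols_def sorted_list_of_set_remove)
  \<comment> \<open>Once i is removed from position p < q, the index j stands at position q - 1;
    this is where the second jump occurs.\<close>
  have rows: "rows ! s = ?l ! (if s < p then s else if s < q - 1 then Suc s else Suc (Suc s))"
    if "s < ?n - 2" for s
  proof -
    let ?l' = "remove1 i ?l"
    have l': "distinct ?l'" "length ?l' = ?n - 1"
      by (auto simp: length_remove1)
    have l'_nth: "?l' ! s = ?l ! (if s < p then s else Suc s)" if "s < ?n - 1" for s
      using that p nth_remove1[of ?l p s] by simp
    have "?l' ! (q - 1) = j"
      using l'_nth[of "q - 1"] pq q by auto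
    moreover have "rows = remove1 j ?l'"
      by (simp add: rows_def sorted_list_of_set_remove[symmetric] set_diff_eq insert_commute
          Diff_insert[of _ j "{i}"])
    ultimately have "rows ! s = ?l' ! (if s < q - 1 then s else Suc s)"
      using nth_remove1[of ?l' "q - 1" s] l' that q pq by auto
    also have "\<dots> = ?l ! (if s < p then s else if s < q - 1 then Suc s else Suc (Suc s))"
      using l'_nth[of s] l'_nth[of "Suc s"] that pq by auto
    finally show ?thesis .
  qed
  define N where "N = Matrix.mat ?n ?n (\<lambda>(r, s). ?N $ (?l ! r) $ (?l ! s))"
  define P where "P = mat_delete N p t"
  define D where "D = Matrix.mat (?n - 1) (?n - 1)
      (\<lambda>(r, s). if r = 0 then d $ (cols ! s) else K $ (rows ! (r - 1)) $ (cols ! s))"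
  have N: "N \<in> carrier_mat ?n ?n" and D: "D \<in> carrier_mat (?n - 1) (?n - 1)"
    by (auto simp: N_def D_def)
  have P: "P \<in> carrier_mat (?n - 1) (?n - 1)"
    unfolding P_def using N by (rule mat_delete_carrier)
  have P_entry: "P $$ (r, c) = ?N $ (?l ! (if r < p then r else Suc r)) $ (cols ! c)"
    if "r < ?n - 1" "c < ?n - 1" for r c
    using that by (simp add: P_def N_def mat_delete_def cols)
  \<comment> \<open>Deleting position p removes row i, and position q - 1 of \<open>P\<close> holds
    the row d; all other rows come from K.\<close>
  have P_K: "P $$ (r, c) = K $ (?l ! (if r < p then r else Suc r)) $ (cols ! c)"
    if "r < ?n - 1" "c < ?n - 1" "r \<noteq> q - 1" for r c
  proof -
    let ?r = "if r < p then r else Suc r"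
    have "?r < ?n" "?r \<noteq> p" "?r \<noteq> q"
      using that(1,3) pq by (auto split: if_splits)
    then have "?l ! ?r \<noteq> ?l ! p" "?l ! ?r \<noteq> ?l ! q"
      using \<open>?r < ?n\<close> \<open>?r \<noteq> p\<close> \<open>?r \<noteq> q\<close> p(1) q(1) nth_eq by blast+
    then show ?thesis
      using P_entry[OF that(1,2)] p(2) q(2) by simp
  qed
  have "Determinants.det ?N = Determinant.det N"
    unfolding N_def by (rule det_eq_det_enumeration) auto
  also have "\<dots> = (\<Sum>s<?n. N $$ (p, s) * cofactor N p s)"
    by (rule laplace_expansion_row[OF N p(1)])
  also have "\<dots> = (\<Sum>s<?n. if s = t then cofactor N p t else 0)"
    using p t nth_eq by (intro sum.cong refl) (auto simp: N_def axis_def)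
  also have "\<dots> = (-1) ^ (p + t) * Determinant.det P"
    using t by (simp add: cofactor_def P_def)
  also have "Determinant.det P = (\<Sum>s<?n - 1. P $$ (q - 1, s) * cofactor P (q - 1) s)"
    using q pq by (intro laplace_expansion_row[OF P]) auto
  also have "\<dots> = (\<Sum>s<?n - 1. (-1) ^ (q - 1) * (D $$ (0, s) * cofactor D 0 s))"
  proof (intro sum.cong refl)
    fix s
    assume "s \<in> {..<?n - 1}"
    then have s: "s < ?n - 1"
      by simp
    have "P $$ (q - 1, s) = ?N $ (?l ! q) $ (cols ! s)"
      using P_entry[of "q - 1" s] q(1) pq s by auto
    then have "P $$ (q - 1, s) = d $ (cols ! s)"
      using q(2) less_imp_neq[OF ij] by auto
    moreover have "D $$ (0, s) = d $ (cols ! s)"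
      using s by (simp add: D_def)
    \<comment> \<open>Without the row d the two matrices have the same rows of K in the same
      order.\<close>
    moreover have "mat_delete P (q - 1) s = mat_delete D 0 s"
    proof (rule eq_matI)
      fix r c
      assume "r < dim_row (mat_delete D 0 s)" "c < dim_col (mat_delete D 0 s)"
      then have rc: "r < ?n - 2" "c < ?n - 2"
        by (auto simp: D_def)
      let ?r = "if r < q - 1 then r else Suc r" and ?c = "if c < s then c else Suc c"
      have "mat_delete P (q - 1) s $$ (r, c) = P $$ (?r, ?c)"
        using rc P by (simp add: mat_delete_def)
      also have "\<dots> = K $ (?l ! (if ?r < p then ?r else Suc ?r)) $ (cols ! ?c)"
        using rc by (intro P_K) auto
      also have "(if ?r < p then ?r else Suc ?r) =
          (if r < p then r else if r < q - 1 then Suc r else Suc (Suc r))"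
        using pq by auto
      also have "K $ (?l ! \<dots>) $ (cols ! ?c) = K $ (rows ! r) $ (cols ! ?c)"
        by (simp only: rows[OF rc(1)])
      also have "\<dots> = mat_delete D 0 s $$ (r, c)"
        using rc by (auto simp: D_def mat_delete_def)
      finally show "mat_delete P (q - 1) s $$ (r, c) = mat_delete D 0 s $$ (r, c)" .
    qed (use P D in auto)
    ultimately show "P $$ (q - 1, s) * cofactor P (q - 1) s =
        (-1) ^ (q - 1) * (D $$ (0, s) * cofactor D 0 s)"
      by (simp add: cofactor_def power_add)
  qed
  also have "\<dots> = (-1) ^ (q - 1) * Determinant.det D"
    using q pq by (subst laplace_expansion_row[OF D, of 0]) (auto simp: sum_distrib_left)
  also have "(-1) ^ (p + t) * ((-1) ^ (q - 1) * Determinant.det D) =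
      (-1) ^ (idx i + idx j + idx a) * Determinant.det D"
  proof -
    \<comment> \<open>Each \<open>idx\<close> exceeds its position by one, and q - 1 replaces q: the
      offset is 4, which does not affect the sign.\<close>
    have "idx i + idx j + idx a = (p + t) + (q - 1) + 2 * 2"
      using p q t pq by simp
    then show ?thesis
      by (simp only: power_add power_mult) simp
  qed
  also have "Determinant.det D = Ddet (($) d) K a i j"
    unfolding Ddet_def Let_def D_def cols_def rows_def ..
  finally show ?thesis .
qed

subsection \<open>Wirtinger derivatives and the Laplacian\<close>

lemma wirtinger_eq_hol_coeff: "wirtinger g i q = hol_coeff (frechet_derivative g (at q)) i"
  by (simp add: wirtinger_def hol_coeff_def)

lemma wirtinger_cong_open:
  assumes "open S" "q \<in> S" "\<And>x. x \<in> S \<Longrightarrow> f x = g x"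
  shows "wirtinger f i q = wirtinger g i q"
  using frechet_derivative_cong_open[OF assms] by (simp add: wirtinger_def)

lemma wirtinger_eqI: "(g has_derivative D) (at q) \<Longrightarrow> wirtinger g i q = hol_coeff D i"
  using frechet_derivative_at[of g D q] by (simp add: wirtinger_eq_hol_coeff)

lemma wirtinger_sum:
  assumes "\<And>k. k \<in> A \<Longrightarrow> f k differentiable (at q)"
  shows "wirtinger (\<lambda>x. \<Sum>k\<in>A. f k x) i q = (\<Sum>k\<in>A. wirtinger (f k) i q)"
proof -
  have "((\<lambda>x. \<Sum>k\<in>A. f k x) has_derivative (\<lambda>v. \<Sum>k\<in>A. frechet_derivative (f k) (at q) v)) (at q)"
    using assms by (intro has_derivative_sum) (simp add: frechet_derivative_works)
  note * = wirtinger_eqI[OF this]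
  show ?thesis
    unfolding *
    by (simp add: wirtinger_eq_hol_coeff hol_coeff_sum(1)[where c = "\<lambda>_. 1", simplified])
qed

lemma wirtinger_mult:
  assumes "f differentiable (at q)" "g differentiable (at q)"
  shows "wirtinger (\<lambda>x. f x * g x) i q = wirtinger f i q * g q + f q * wirtinger g i q"
proof -
  have "((\<lambda>x. f x * g x) has_derivative
      (\<lambda>v. f q * frechet_derivative g (at q) v + frechet_derivative f (at q) v * g q)) (at q)"
    using assms by (intro has_derivative_mult) (simp_all add: frechet_derivative_works)
  note * = wirtinger_eqI[OF this]
  show ?thesis
    unfolding * by (simp add: wirtinger_eq_hol_coeff hol_coeff_def field_simps)
qed

lemma wirtinger_minus:
  assumes "f differentiable (at q)"
  shows "wirtinger (\<lambda>x. - f x) i q = - wirtinger f i q"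
proof -
  have "((\<lambda>x. - f x) has_derivative (\<lambda>v. - frechet_derivative f (at q) v)) (at q)"
    using assms by (intro has_derivative_minus) (simp add: frechet_derivative_works)
  note * = wirtinger_eqI[OF this]
  show ?thesis
    unfolding * by (simp add: wirtinger_eq_hol_coeff hol_coeff_def field_simps)
qed

lemma smooth_on_coeff_differentiable:
  fixes g :: "'m::finite cspace \<Rightarrow> complex"
  assumes "smooth_on S g" "q \<in> S"
  shows "((\<lambda>x. hol_coeff (frechet_derivative g (at x)) i) has_derivative
      (\<lambda>v. hol_coeff (\<lambda>u. frechet_derivative (\<lambda>x. frechet_derivative g (at x) u) (at q) v) i)) (at q)"
    and "((\<lambda>x. anti_coeff (frechet_derivative g (at x)) i) has_derivative
      (\<lambda>v. anti_coeff (\<lambda>u. frechet_derivative (\<lambda>x. frechet_derivative g (at x) u) (at q) v) i)) (at q)"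
  unfolding hol_coeff_def anti_coeff_def
  by (auto intro!: derivative_eq_intros smooth_on_has_derivative[OF smooth_on_frechet[OF assms(1)] assms(2)])

text \<open>The factorisation of the Laplacian into the two Wirtinger operators; the mixed real
  second derivatives cancel by symmetry.\<close>

lemma laplacian_wirtinger:
  fixes g :: "'m::finite cspace \<Rightarrow> complex"
  assumes "open S" "smooth_on S g" "q \<in> S"
  shows "1 / 4 * laplacian g q =
    (\<Sum>i\<in>UNIV. wirtinger (\<lambda>x. anti_coeff (frechet_derivative g (at x)) i) i q)"
  unfolding laplacian_def sum_Basis_cspace sum_distrib_left
    wirtinger_eqI[OF smooth_on_coeff_differentiable(2)[OF assms(2,3)]]
proof (intro sum.cong refl)
  fix i
  show "1 / 4 * (frechet_derivative (\<lambda>x. frechet_derivative g (at x) (axis i 1)) (at q) (axis i 1) +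
      frechet_derivative (\<lambda>x. frechet_derivative g (at x) (axis i \<i>)) (at q) (axis i \<i>)) =
    hol_coeff (\<lambda>v. anti_coeff (\<lambda>u. frechet_derivative (\<lambda>x. frechet_derivative g (at x) u) (at q) v) i) i"
    using second_derivative_symmetric[OF assms, of "axis i 1" "axis i \<i>"]
    by (simp add: hol_coeff_def anti_coeff_def field_simps)
qed

lemma wirtinger_commute:
  fixes g :: "'m::finite cspace \<Rightarrow> complex"
  assumes "open S" "smooth_on S g" "q \<in> S"
  shows "wirtinger (wirtinger g i) j q = wirtinger (wirtinger g j) i q"
proof -
  have *: "wirtinger g i = (\<lambda>x. hol_coeff (frechet_derivative g (at x)) i)" for i
    by (simp add: wirtinger_eq_hol_coeff fun_eq_iff)
  show ?thesis
    unfolding * wirtinger_eqI[OF smooth_on_coeff_differentiable(1)[OF assms(2,3)]]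
    using second_derivative_symmetric[OF assms] by (simp add: hol_coeff_def field_simps)
qed

text \<open>A real derivative that commutes with multiplication by \<i> has no conjugate
  coefficients. On a complex line it is a complex derivative, which identifies its coefficients with
  \<open>cpartial\<close>.\<close>

lemma cpartial_eq:
  assumes "(f has_derivative D) (at z)" "\<And>v. D (mult_i v) = \<i> * D v"
  shows "cpartial f c z = D (axis c 1)" and "D v = (\<Sum>b\<in>UNIV. cpartial f b z * v $ b)"
proof -
  have lin: "linear D"
    using assms(1) by (rule has_derivative_linear)
  have axis: "D (axis b \<i>) = \<i> * D (axis b 1)" for b
  proof -
    have "mult_i (axis b 1) = axis b \<i>"
      by (auto simp: mult_i_def axis_def cart_eq_iff)
    then show ?thesis
      by (metis assms(2))
  qed
  have exp: "D v = (\<Sum>b\<in>UNIV. D (axis b 1) * v $ b)" for v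
    by (subst linear_form_expansion[OF lin]) (simp add: hol_coeff_def anti_coeff_def axis)
  have cpartial: "cpartial f c z = D (axis c 1)" for c
  proof -
    have "((\<lambda>t. z + t *s axis c 1) has_derivative (\<lambda>t. t *s axis c 1)) (at 0)"
      by (intro has_derivative_vec) (auto simp: axis_def intro!: derivative_eq_intros)
    moreover have "D (t *s axis c 1) = t * D (axis c 1)" for t
      by (subst exp) (simp add: axis_def mult.commute if_distrib[where f = "\<lambda>x. _ * x"]
          if_distrib[where f = "\<lambda>x. x * _"] cong: if_cong)
    ultimately have "((\<lambda>t. f (z + t *s axis c 1)) has_derivative (\<lambda>t. t * D (axis c 1))) (at 0)"
      using has_derivative_compose[of "\<lambda>t. z + t *s axis c 1" "\<lambda>t. t *s axis c 1" 0 UNIV f D] assms(1)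
      by simp
    moreover have "(\<lambda>t. t * D (axis c 1)) = (*) (D (axis c 1))"
      by (simp add: fun_eq_iff)
    ultimately have "((\<lambda>t. f (z + t *s axis c 1)) has_field_derivative D (axis c 1)) (at 0)"
      by (simp add: has_field_derivative_def)
    then show ?thesis
      unfolding cpartial_def by (rule DERIV_imp_deriv)
  qed
  then show "cpartial f c z = D (axis c 1)" .
  show "D v = (\<Sum>b\<in>UNIV. cpartial f b z * v $ b)"
    unfolding cpartial by (rule exp)
qed

text \<open>For a holomorphic outer function the chain rule contains no derivatives of the
  conjugates of z.\<close>

lemma wirtinger_compose:
  assumes "\<And>b. ((\<lambda>q. z q $ b) has_derivative (\<lambda>v. Dz v $ b)) (at q)"
    and "(f has_derivative D) (at (z q))" "\<And>v. D (mult_i v) = \<i> * D v"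
  shows "((\<lambda>q. f (z q)) has_derivative (\<lambda>v. D (Dz v))) (at q)"
    and "wirtinger (\<lambda>q. f (z q)) i q = (\<Sum>b\<in>UNIV. cpartial f b (z q) * wirtinger (\<lambda>q. z q $ b) i q)"
proof -
  have "(z has_derivative Dz) (at q)"
    using assms(1) by (rule has_derivative_vec)
  from has_derivative_compose[OF this assms(2)]
  show *: "((\<lambda>q. f (z q)) has_derivative (\<lambda>v. D (Dz v))) (at q)" .
  show "wirtinger (\<lambda>q. f (z q)) i q = (\<Sum>b\<in>UNIV. cpartial f b (z q) * wirtinger (\<lambda>q. z q $ b) i q)"
    unfolding wirtinger_eqI[OF *] wirtinger_eqI[OF assms(1)] cpartial_eq(2)[OF assms(2,3)]
    by (rule hol_coeff_sum)
qed

text \<open>Since \<open>theta M i\<close> has dq-part dq^i, the coefficients of a (1,0)-form in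
  this basis are its own dq-coefficients. Applied to dz^a, the second equation gives the conjugate
  derivatives of z^a as -A M.\<close>

lemma is_J_of_form:
  assumes "is_J_of M J0" "\<alpha> \<in> cotangent10 J0"
  shows "\<alpha> X = (\<Sum>i\<in>UNIV. hol_coeff \<alpha> i * theta M i X)"
    and "anti_coeff \<alpha> i = - (\<Sum>j\<in>UNIV. hol_coeff \<alpha> j * M $ j $ i)"
proof -
  obtain c where c: "\<alpha> = (\<lambda>X. \<Sum>i\<in>UNIV. c i * theta M i X)"
    using assms by (auto simp: is_J_of_def)
  have h: "hol_coeff \<alpha> i = c i" for i
    unfolding c hol_coeff_sum hol_coeff_theta
    by (simp add: if_distrib[where f = "\<lambda>x. _ * x"] cong: if_cong)
  show "\<alpha> X = (\<Sum>i\<in>UNIV. hol_coeff \<alpha> i * theta M i X)"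
    unfolding h by (simp only: c)
  have "anti_coeff \<alpha> i = (\<Sum>k\<in>UNIV. c k * anti_coeff (theta M k) i)"
    by (simp only: c hol_coeff_sum)
  then show "anti_coeff \<alpha> i = - (\<Sum>j\<in>UNIV. hol_coeff \<alpha> j * M $ j $ i)"
    unfolding h by (simp add: anti_coeff_theta sum_negf)
qed

text \<open>Differentiating -A M produces derivatives of A and derivatives of M. The former are
  second derivatives of z^a and cancel; the latter give the formula by the chain rule.\<close>

lemma laplacian_formula:
  fixes z :: "'m::finite cspace \<Rightarrow> 'm cspace"
  assumes U: "open U'" "q \<in> U'" and z: "smooth_on U' (\<lambda>q. z q $ a)"
    "\<And>b. (\<lambda>q. z q $ b) differentiable (at q)"
    and M: "\<And>i j. holomorphic_in mult_i UNIV V (\<lambda>z. M z $ i $ j)" "M ` V \<subseteq> so_complex" "z ` U' \<subseteq> V"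
    and anti: "\<And>q i. q \<in> U' \<Longrightarrow> anti_coeff (frechet_derivative (\<lambda>q. z q $ a) (at q)) i =
      - (\<Sum>j\<in>UNIV. wirtinger (\<lambda>q. z q $ a) j q * M (z q) $ j $ i)"
  shows "1 / 4 * laplacian (\<lambda>q. z q $ a) q = - (\<Sum>i\<in>UNIV. \<Sum>j\<in>UNIV. \<Sum>b\<in>UNIV.
    wirtinger (\<lambda>q. z q $ a) i q * wirtinger (\<lambda>q. z q $ b) j q * cpartial (\<lambda>z. M z $ i $ j) b (z q))"
proof -
  let ?A = "\<lambda>b i q. wirtinger (\<lambda>q. z q $ b) i q"
  have Mz: "(\<lambda>q. M (z q) $ j $ i) differentiable (at q)"
    "wirtinger (\<lambda>q. M (z q) $ j $ i) k q = (\<Sum>b\<in>UNIV. cpartial (\<lambda>z. M z $ j $ i) b (z q) * ?A b k q)"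
    for i j k
  proof -
    have "z q \<in> V"
      using M(3) U(2) by blast
    then obtain D where D: "((\<lambda>z. M z $ j $ i) has_derivative D) (at (z q))"
      "\<And>v. D (mult_i v) = \<i> * D v"
      using M(1)[of j i] unfolding holomorphic_in_def by blast
    have Dz: "((\<lambda>q. z q $ b) has_derivative (\<lambda>v. (\<chi> b. frechet_derivative (\<lambda>q. z q $ b) (at q) v) $ b)) (at q)" for b
      using z(2)[of b] by (simp add: frechet_derivative_works)
    note comp = wirtinger_compose[where f = "\<lambda>z. M z $ j $ i", OF Dz D]
    show "(\<lambda>q. M (z q) $ j $ i) differentiable (at q)"
      using comp(1) by (auto simp: differentiable_def)
    show "wirtinger (\<lambda>q. M (z q) $ j $ i) k q = (\<Sum>b\<in>UNIV. cpartial (\<lambda>z. M z $ j $ i) b (z q) * ?A b k q)"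
      by (rule comp(2))
  qed
  have A: "?A a j differentiable (at q)" for j
    using smooth_on_coeff_differentiable(1)[OF z(1) U(2)]
    by (auto simp: differentiable_def wirtinger_eq_hol_coeff[abs_def])
  have "1 / 4 * laplacian (\<lambda>q. z q $ a) q =
      (\<Sum>i\<in>UNIV. wirtinger (\<lambda>q. - (\<Sum>j\<in>UNIV. ?A a j q * M (z q) $ j $ i)) i q)"
    unfolding laplacian_wirtinger[OF U(1) z(1) U(2)]
    by (intro sum.cong refl wirtinger_cong_open[OF U]) (rule anti)
  also have "\<dots> = (\<Sum>i\<in>UNIV. - (\<Sum>j\<in>UNIV. wirtinger (?A a j) i q * M (z q) $ j $ i +
      ?A a j q * (\<Sum>b\<in>UNIV. cpartial (\<lambda>z. M z $ j $ i) b (z q) * ?A b i q)))"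
    using A Mz(1) by (simp add: wirtinger_minus wirtinger_sum wirtinger_mult Mz(2) differentiable_mult
        differentiable_sum)
  also have "\<dots> = - (\<Sum>i\<in>UNIV. \<Sum>j\<in>UNIV. M (z q) $ j $ i * wirtinger (?A a j) i q) -
      (\<Sum>i\<in>UNIV. \<Sum>j\<in>UNIV. \<Sum>b\<in>UNIV. ?A a j q * ?A b i q * cpartial (\<lambda>z. M z $ j $ i) b (z q))"
    by (simp add: sum.distrib sum_negf sum_subtractf sum_distrib_left algebra_simps)
  \<comment> \<open>A symmetric matrix of second derivatives is contracted with the skew matrix
    M.\<close>
  also have "(\<Sum>i\<in>UNIV. \<Sum>j\<in>UNIV. M (z q) $ j $ i * wirtinger (?A a j) i q) = 0"
  proof (rule skew_sum_symmetric)
    have "M (z q) \<in> so_complex"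
      using M(2,3) U(2) by blast
    then show "M (z q) $ j $ i = - M (z q) $ i $ j" for i j
      by (rule so_complexD)
    show "wirtinger (?A a j) i q = wirtinger (?A a i) j q" for i j
      by (rule wirtinger_commute[OF U(1) z(1) U(2)])
  qed
  also have "(\<Sum>i\<in>UNIV. \<Sum>j\<in>UNIV. \<Sum>b\<in>UNIV. ?A a j q * ?A b i q * cpartial (\<lambda>z. M z $ j $ i) b (z q)) =
      (\<Sum>j\<in>UNIV. \<Sum>i\<in>UNIV. \<Sum>b\<in>UNIV. ?A a j q * ?A b i q * cpartial (\<lambda>z. M z $ j $ i) b (z q))"
    by (rule sum.swap)
  finally show ?thesis
    by simp
qed

section \<open>From the double sum to determinants\<close>

lemma sum_pairs_less:
  fixes f :: "'i::{finite,linorder} \<Rightarrow> 'i \<Rightarrow> 'a::comm_monoid_add"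
  assumes "\<And>i. f i i = 0"
  shows "(\<Sum>i\<in>UNIV. \<Sum>j\<in>UNIV. f i j) = (\<Sum>(i, j) | i < j. f i j + f j i)"
proof -
  let ?L = "{(i, j). i < j} :: ('i \<times> 'i) set" and ?G = "{(i, j). j < i} :: ('i \<times> 'i) set"
  have "(\<Sum>i\<in>UNIV. \<Sum>j\<in>UNIV. f i j) = (\<Sum>(i, j)\<in>UNIV. f i j)"
    by (simp add: sum.cartesian_product)
  also have "\<dots> = (\<Sum>(i, j)\<in>?L \<union> ?G. f i j)"
  proof (rule sum.mono_neutral_right)
    show "\<forall>p\<in>UNIV - (?L \<union> ?G). (case p of (i, j) \<Rightarrow> f i j) = 0"
    proof
      fix p
      assume p: "p \<in> UNIV - (?L \<union> ?G)"
      obtain i j where ij: "p = (i, j)"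
        by (rule prod.exhaust)
      with p have "i = j"
        by (cases i j rule: linorder_cases) auto
      then show "(case p of (i, j) \<Rightarrow> f i j) = 0"
        by (simp add: ij assms)
    qed
  qed simp_all
  also have "\<dots> = (\<Sum>(i, j)\<in>?L. f i j) + (\<Sum>(i, j)\<in>?G. f i j)"
    by (rule sum.union_disjoint) auto
  also have "(\<Sum>(i, j)\<in>?G. f i j) = (\<Sum>(i, j)\<in>?L. f j i)"
    by (rule sum.reindex_bij_witness[of _ prod.swap prod.swap]) auto
  finally show ?thesis
    by (simp add: sum.distrib split_def)
qed

text \<open>The terms for (i, j) and (j, i) are combined: skewness of d turns the products into 2 by
  2 minors of A. They equal those of the inverse -A of K, since two signs cancel, and so become
  determinants containing rows of K.\<close>

lemma laplacian_formula_det: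
  fixes A K :: "'m::{finite,linorder} cmatrix" and d :: "'m \<Rightarrow> 'm \<Rightarrow> 'm cspace"
  assumes KA: "K ** A = - Finite_Cartesian_Product.mat 1" and d: "\<And>i j. d i j = - d j i"
  shows "Determinants.det K \<noteq> 0"
    and "- (\<Sum>i\<in>UNIV. \<Sum>j\<in>UNIV. \<Sum>b\<in>UNIV. A $ a $ i * A $ b $ j * d i j $ b) =
      (-1) ^ idx a / Determinants.det K *
      (\<Sum>(i, j) | i < j. (-1) ^ (idx i + idx j - 1) * Ddet (($) (d i j)) K a i j)"
proof -
  have "K ** (- A) = - (K ** A)"
    by (simp add: matrix_matrix_mult_def cart_eq_iff sum_negf)
  then have KB: "K ** (- A) = Finite_Cartesian_Product.mat 1"
    using KA by simp
  then have "invertible K"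
    by (metis invertible_right_inverse)
  then show nz: "Determinants.det K \<noteq> 0"
    by (simp add: invertible_det_nz)
  let ?f = "\<lambda>i j. \<Sum>b\<in>UNIV. A $ a $ i * A $ b $ j * d i j $ b"
  have "d i i = 0" for i
    using eq_uminus_imp_0[of "d i i $ b" for b] d[of i i] by (simp add: cart_eq_iff)
  then have "(\<Sum>i\<in>UNIV. \<Sum>j\<in>UNIV. ?f i j) = (\<Sum>(i, j) | i < j. ?f i j + ?f j i)"
    by (intro sum_pairs_less) simp
  also have "\<dots> = (\<Sum>(i, j) | i < j.
      (-1) ^ (idx i + idx j + idx a) * Ddet (($) (d i j)) K a i j / Determinants.det K)"
  proof (intro sum.cong refl, clarify)
    fix i j :: 'm
    assume ij: "i < j"
    have "?f i j + ?f j i = (\<Sum>b\<in>UNIV. d i j $ b * (A $ a $ i * A $ b $ j - A $ a $ j * A $ b $ i))"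
      using d[of j i] by (simp add: algebra_simps flip: sum.distrib)
    also have "\<dots> = (-1) ^ (idx i + idx j + idx a) * Ddet (($) (d i j)) K a i j / Determinants.det K"
      using det_two_rows_replaced[OF less_imp_neq[OF ij] KB, of a "d i j"] det_eq_Ddet[OF ij, of a "d i j" K] nz
      by (simp add: field_simps)
    finally show "?f i j + ?f j i =
      (-1) ^ (idx i + idx j + idx a) * Ddet (($) (d i j)) K a i j / Determinants.det K" .
  qed
  also have "\<dots> = - ((-1) ^ idx a / Determinants.det K *
      (\<Sum>(i, j) | i < j. (-1) ^ (idx i + idx j - 1) * Ddet (($) (d i j)) K a i j))"
    unfolding sum_distrib_left sum_negf[symmetric]
  proof (intro sum.cong refl, clarify)
    fix i j :: 'm
    \<comment> \<open>The exponent \<open>idx i + idx j - 1\<close> is a subtraction of natural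
      numbers, so it must not be truncated; it also accounts for the change of sign.\<close>
    have "idx i \<ge> 1"
      using position_exists[of i] by (metis One_nat_def Suc_leI zero_less_Suc)
    then have "idx i + idx j + idx a = Suc ((idx i + idx j - 1) + idx a)"
      by simp
    then show "(-1) ^ (idx i + idx j + idx a) * Ddet (($) (d i j)) K a i j / Determinants.det K =
      - ((-1) ^ idx a / Determinants.det K * ((-1) ^ (idx i + idx j - 1) * Ddet (($) (d i j)) K a i j))"
      by (simp only: power_Suc power_add) simp
  qed
  finally show "- (\<Sum>i\<in>UNIV. \<Sum>j\<in>UNIV. ?f i j) =
      (-1) ^ idx a / Determinants.det K *
      (\<Sum>(i, j) | i < j. (-1) ^ (idx i + idx j - 1) * Ddet (($) (d i j)) K a i j)"
    by simp
qed

subsection \<open>Integrability in a complex chart\<close>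

lemma complex_linear_iff_anti_coeff:
  fixes D :: "'m::finite cspace \<Rightarrow> complex"
  assumes "linear D"
  shows "(\<forall>v. D (mult_i v) = \<i> * D v) \<longleftrightarrow> (\<forall>a. anti_coeff D a = 0)"
proof
  assume *: "\<forall>v. D (mult_i v) = \<i> * D v"
  have "mult_i (axis a 1) = axis a \<i>" for a :: 'm
    by (auto simp: mult_i_def axis_def cart_eq_iff)
  then have "D (axis a \<i>) = \<i> * D (axis a 1)" for a
    using * by metis
  then show "\<forall>a. anti_coeff D a = 0"
    by (simp add: anti_coeff_def)
next
  assume anti: "\<forall>a. anti_coeff D a = 0"
  show "\<forall>v. D (mult_i v) = \<i> * D v"
  proof
    fix v
    have D: "D w = (\<Sum>a\<in>UNIV. hol_coeff D a * w $ a)" for w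
      using linear_form_expansion[OF assms, of w] by (simp only: anti mult_zero_left add_0_right)
    show "D (mult_i v) = \<i> * D v"
      unfolding D[of v] D[of "mult_i v"] by (simp add: mult_i_def sum_distrib_left algebra_simps)
  qed
qed

lemma anti_coeff_sum_product_rule:
  "anti_coeff (\<lambda>v. \<Sum>j\<in>A. c j * \<alpha> j v + \<beta> j v * d j) b =
    (\<Sum>j\<in>A. c j * anti_coeff (\<alpha> j) b + anti_coeff (\<beta> j) b * d j)"
  unfolding anti_coeff_def
  by (simp add: sum_distrib_left sum_divide_distrib flip: sum.distrib)
    (intro sum.cong refl, simp add: field_simps)

lemma coeff_cnj:
  "hol_coeff (\<lambda>v. cnj (\<alpha> v)) a = cnj (anti_coeff \<alpha> a)"
  "anti_coeff (\<lambda>v. cnj (\<alpha> v)) a = cnj (hol_coeff \<alpha> a)"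
  by (auto simp: hol_coeff_def anti_coeff_def)

text \<open>
  In terms of \<open>S k i l = (\<Sum>b. R $ b $ k * T b i l)\<close> the hypotheses say that \<open>S\<close> is symmetric in its first
  and third and skew in its last two arguments.
\<close>

lemma symmetric_skew_eq_0:
  fixes P R :: "complex^'m::finite^'m"
  assumes PR: "P ** R = Finite_Cartesian_Product.mat 1"
    and sym: "\<And>a b i. (\<Sum>j\<in>UNIV. T b i j * P $ j $ a) = (\<Sum>j\<in>UNIV. T a i j * P $ j $ b)"
    and skew: "\<And>b i j. T b i j = - T b j i"
  shows "T b i l = 0"
proof -
  define S where "S k i l = (\<Sum>b\<in>UNIV. R $ b $ k * T b i l)" for k i l
  have PR': "(\<Sum>a\<in>UNIV. P $ j $ a * R $ a $ l) = (if j = l then 1 else 0)" for j l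
    using PR by (auto simp: cart_eq_iff matrix_matrix_mult_def Finite_Cartesian_Product.mat_def)
  \<comment> \<open>Because R is a right inverse of P, \<open>T\<close> is recovered from
    \<open>S\<close>, and the vanishing of \<open>S\<close> suffices.\<close>
  have T: "T b i l = (\<Sum>j\<in>UNIV. P $ j $ b * S l i j)" for b i l
  proof -
    have "T b i l = (\<Sum>j\<in>UNIV. T b i j * (\<Sum>a\<in>UNIV. P $ j $ a * R $ a $ l))"
      by (simp add: PR' if_distrib[where f = "\<lambda>x. _ * x"] cong: if_cong)
    also have "\<dots> = (\<Sum>j\<in>UNIV. \<Sum>a\<in>UNIV. T b i j * P $ j $ a * R $ a $ l)"
      by (simp add: sum_distrib_left algebra_simps)
    also have "\<dots> = (\<Sum>a\<in>UNIV. \<Sum>j\<in>UNIV. T b i j * P $ j $ a * R $ a $ l)"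
      by (rule sum.swap)
    also have "\<dots> = (\<Sum>a\<in>UNIV. \<Sum>j\<in>UNIV. T a i j * P $ j $ b * R $ a $ l)"
      by (simp only: sum_distrib_right[symmetric] sym[of b i])
    also have "\<dots> = (\<Sum>j\<in>UNIV. \<Sum>a\<in>UNIV. T a i j * P $ j $ b * R $ a $ l)"
      by (rule sum.swap)
    also have "\<dots> = (\<Sum>j\<in>UNIV. P $ j $ b * S l i j)"
      by (simp add: S_def sum_distrib_left algebra_simps)
    finally show ?thesis .
  qed
  have S_sym: "S k i l = S l i k" for k i l
  proof -
    have "S k i l = (\<Sum>b\<in>UNIV. \<Sum>j\<in>UNIV. P $ j $ b * R $ b $ k * S l i j)"
      by (simp add: S_def T[of _ i l] sum_distrib_left algebra_simps)
    also have "\<dots> = (\<Sum>j\<in>UNIV. \<Sum>b\<in>UNIV. P $ j $ b * R $ b $ k * S l i j)"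
      by (rule sum.swap)
    also have "\<dots> = S l i k"
      by (simp only: sum_distrib_right[symmetric] PR')
        (simp add: if_distrib[where f = "\<lambda>x. x * _"] cong: if_cong)
    finally show ?thesis .
  qed
  have S_skew: "S k i l = - S k l i" for k i l
    unfolding S_def sum_negf[symmetric] by (intro sum.cong refl) (metis skew mult_minus_right)
  \<comment> \<open>The sign chase known from the uniqueness of the Levi-Civita connection:
    alternating the two exchanges six times restores the indices after three changes of
    sign.\<close>
  have "S k i l = - S k i l" for k i l
    by (metis S_sym S_skew minus_minus)
  then have "S k i l = 0" for k i l
    by (rule eq_uminus_imp_0)
  then show ?thesis
    by (simp add: T)
qed

lemma matrix_inv_inverse:
  assumes "invertible A"
  shows "A ** matrix_inv A = Finite_Cartesian_Product.mat 1"
    and "matrix_inv A ** A = Finite_Cartesian_Product.mat 1"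
  using someI_ex[OF assms[unfolded invertible_def]] by (simp_all add: matrix_inv_def)

section \<open>The matrix M in a complex chart\<close>

locale complex_chart =
  fixes N :: "'m::finite cspace set" and \<zeta> :: "'m cspace \<Rightarrow> 'm cspace"
    and J :: "'m cspace \<Rightarrow> 'm cspace \<Rightarrow> 'm cspace"
  assumes open_N: "open N" and J: "q \<in> N \<Longrightarrow> almost_hermitian_at (J q)"
    and smooth: "smooth_on N \<zeta>" and inj: "inj_on \<zeta> N" and open_image: "open (\<zeta> ` N)"
    and smooth_inv: "smooth_on (\<zeta> ` N) (inv_into N \<zeta>)"
    and holomorphic: "J_holomorphic_on N J (\<lambda>q. \<zeta> q $ i)"
begin

definition y :: "'m cspace \<Rightarrow> 'm cspace" where
  "y = inv_into N \<zeta>"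

definition Dy :: "'m cspace \<Rightarrow> 'm cspace \<Rightarrow> 'm cspace" where
  "Dy u = frechet_derivative y (at u)"

lemma y_mem: "u \<in> \<zeta> ` N \<Longrightarrow> y u \<in> N" and \<zeta>_y: "u \<in> \<zeta> ` N \<Longrightarrow> \<zeta> (y u) = u"
  by (auto simp: y_def f_inv_into_f inv_into_into)

lemma y_\<zeta>: "q \<in> N \<Longrightarrow> y (\<zeta> q) = q"
  by (simp add: y_def inj)

lemma smooth_y: "smooth_on (\<zeta> ` N) y"
  using smooth_inv by (simp add: y_def)

lemma D\<zeta>: "q \<in> N \<Longrightarrow> (\<zeta> has_derivative frechet_derivative \<zeta> (at q)) (at q)"
  by (rule smooth_on_has_derivative[OF smooth])

lemma Dy: "u \<in> \<zeta> ` N \<Longrightarrow> (y has_derivative Dy u) (at u)"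
  unfolding Dy_def by (rule smooth_on_has_derivative[OF smooth_y])

lemma linear_Dy: "u \<in> \<zeta> ` N \<Longrightarrow> linear (Dy u)"
  using Dy has_derivative_linear by blast

lemma D\<zeta>_Dy:
  assumes "u \<in> \<zeta> ` N"
  shows "frechet_derivative \<zeta> (at (y u)) (Dy u v) = v"
proof -
  have "((\<lambda>u. \<zeta> (y u)) has_derivative (\<lambda>v. frechet_derivative \<zeta> (at (y u)) (Dy u v))) (at u)"
    using Dy[OF assms] D\<zeta>[OF y_mem[OF assms]] by (rule has_derivative_compose)
  moreover have "((\<lambda>u. \<zeta> (y u)) has_derivative (\<lambda>v. v)) (at u)"
    by (rule has_derivative_transform_within_open[OF has_derivative_ident open_image assms])
      (simp add: \<zeta>_y)
  ultimately show ?thesis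
    by (metis has_derivative_unique)
qed

lemma Dy_D\<zeta>:
  assumes "u \<in> \<zeta> ` N"
  shows "Dy u (frechet_derivative \<zeta> (at (y u)) X) = X"
proof -
  have "((\<lambda>q. y (\<zeta> q)) has_derivative (\<lambda>X. Dy u (frechet_derivative \<zeta> (at (y u)) X))) (at (y u))"
    using D\<zeta>[OF y_mem[OF assms]] Dy[OF assms] \<zeta>_y[OF assms]
    by (intro has_derivative_compose[where f = \<zeta> and g = y]) auto
  moreover have "((\<lambda>q. y (\<zeta> q)) has_derivative (\<lambda>v. v)) (at (y u))"
    by (rule has_derivative_transform_within_open[OF has_derivative_ident open_N y_mem[OF assms]])
      (simp add: y_\<zeta>)
  ultimately show ?thesis
    by (metis has_derivative_unique)
qed

lemma D\<zeta>_J: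
  assumes "q \<in> N"
  shows "frechet_derivative \<zeta> (at q) (J q X) = mult_i (frechet_derivative \<zeta> (at q) X)"
proof -
  have "frechet_derivative (\<lambda>q. \<zeta> q $ i) (at q) = (\<lambda>X. frechet_derivative \<zeta> (at q) X $ i)" for i
    by (rule frechet_derivative_at[OF has_derivative_vec_nth[OF D\<zeta>[OF assms]], symmetric])
  moreover have "frechet_derivative (\<lambda>q. \<zeta> q $ i) (at q) (J q X) =
      \<i> * frechet_derivative (\<lambda>q. \<zeta> q $ i) (at q) X" for i
    using holomorphic[unfolded J_holomorphic_on_def] assms by blast
  ultimately show ?thesis
    by (simp add: cart_eq_iff mult_i_def)
qed

lemma J_Dy:
  assumes "u \<in> \<zeta> ` N"
  shows "J (y u) (Dy u v) = Dy u (mult_i v)"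
  by (metis D\<zeta>_J D\<zeta>_Dy Dy_D\<zeta> assms y_mem)

text \<open>\<open>Pm\<close> and \<open>Qm\<close> are the matrices of derivatives of conj(y) and
  of y with respect to the conjugate chart coordinates.\<close>

definition Pm :: "'m cspace \<Rightarrow> 'm cmatrix" where
  "Pm u = (\<chi> i a. anti_coeff (\<lambda>v. cnj (Dy u v $ i)) a)"

definition Qm :: "'m cspace \<Rightarrow> 'm cmatrix" where
  "Qm u = (\<chi> i a. anti_coeff (\<lambda>v. Dy u v $ i) a)"

text \<open>Pulled back by the chart, a form is of type (1,0) exactly if it is complex linear. The
  conjugate coefficients of the pulled back \<open>theta M i\<close> form row i of Q - M P.\<close>

lemma theta_in_cotangent10_iff:
  assumes u: "u \<in> \<zeta> ` N"
  shows "(\<forall>i. theta M i \<in> cotangent10 (J (y u))) \<longleftrightarrow> Qm u = M ** Pm u"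
proof -
  have lin: "linear (\<lambda>v. theta M i (Dy u v))" for i
    using linear_compose[OF linear_Dy[OF u] linear_theta[of M i]] by (simp add: o_def)
  have coeff: "anti_coeff (\<lambda>v. theta M i (Dy u v)) a = Qm u $ i $ a - (M ** Pm u) $ i $ a" for i a
    using hol_coeff_linear_combination(2)[of "\<lambda>v. Dy u v $ i" "- 1"
        "\<lambda>v. \<Sum>j\<in>UNIV. M $ i $ j * cnj (Dy u v $ j)" a]
    by (simp add: theta_def hol_coeff_sum Qm_def Pm_def matrix_matrix_mult_def)
  have "theta M i \<in> cotangent10 (J (y u)) \<longleftrightarrow> (\<forall>a. Qm u $ i $ a = (M ** Pm u) $ i $ a)" for i
  proof -
    have "theta M i \<in> cotangent10 (J (y u)) \<longleftrightarrow> (\<forall>X. theta M i (J (y u) X) = \<i> * theta M i X)"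
      by (simp add: cotangent10_def linear_theta)
    also have "\<dots> \<longleftrightarrow> (\<forall>v. theta M i (J (y u) (Dy u v)) = \<i> * theta M i (Dy u v))"
      by (metis Dy_D\<zeta>[OF u])
    also have "\<dots> \<longleftrightarrow> (\<forall>a. anti_coeff (\<lambda>v. theta M i (Dy u v)) a = 0)"
      by (simp add: J_Dy[OF u] complex_linear_iff_anti_coeff[OF lin])
    finally show ?thesis
      by (simp add: coeff)
  qed
  then show ?thesis
    by (simp add: cart_eq_iff)
qed

text \<open>If P w = 0 then Q w = M P w = 0, and conj(P w) + Q w is the derivative of y in direction
  conj(w), which is injective.\<close>

lemma Pm_nonsingular:
  assumes u: "u \<in> \<zeta> ` N" and QP: "Qm u = M ** Pm u"
  shows "Determinants.det (Pm u) \<noteq> 0"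
proof -
  have "w = 0" if w: "Pm u *v w = 0" for w
  proof -
    have Qw: "Qm u *v w = 0"
      unfolding QP matrix_vector_mul_assoc[symmetric] w by simp
    have "Dy u (vcnj w) $ i = 0" for i
    proof -
      have "linear (\<lambda>v. Dy u v $ i)"
        using linear_compose[OF linear_Dy[OF u] bounded_linear.linear[OF bounded_linear_vec_nth]]
        by (simp add: o_def)
      then have "Dy u (vcnj w) $ i = (\<Sum>a\<in>UNIV. hol_coeff (\<lambda>v. Dy u v $ i) a * cnj (w $ a) +
          anti_coeff (\<lambda>v. Dy u v $ i) a * w $ a)"
        by (subst linear_form_expansion) auto
      also have "\<dots> = cnj ((Pm u *v w) $ i) + (Qm u *v w) $ i"
        by (simp add: matrix_vector_mult_def Pm_def Qm_def coeff_cnj sum.distrib)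
      finally show ?thesis
        by (simp add: w Qw)
    qed
    then have "Dy u (vcnj w) = 0"
      by (simp add: cart_eq_iff)
    then have "vcnj w = 0"
      using D\<zeta>_Dy[OF u, of "vcnj w"] linear_0[OF has_derivative_linear[OF D\<zeta>[OF y_mem[OF u]]]] by simp
    then show "w = 0"
      by (simp add: cart_eq_iff)
  qed
  then have "invertible (Pm u)"
    unfolding invertible_left_inverse matrix_left_invertible_ker by blast
  then show ?thesis
    by (simp add: invertible_det_nz)
qed

lemma Ck_on_Pm: "Ck_on n (\<lambda>u. Pm u $ i $ a) (\<zeta> ` N)"
  and Ck_on_Qm: "Ck_on n (\<lambda>u. Qm u $ i $ a) (\<zeta> ` N)"
proof -
  have Dy: "Ck_on n (\<lambda>u. Dy u v) (\<zeta> ` N)" for v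
    using smooth_on_frechet[OF smooth_y] by (simp add: Dy_def smooth_on_def)
  have lin: "bounded_linear (\<lambda>w :: 'm cspace. c * w $ i)" "bounded_linear (\<lambda>w :: 'm cspace. c * cnj (w $ i))" for c
    by (intro bounded_linear_const_mult bounded_linear_vec_nth
        bounded_linear_compose[OF bounded_linear_cnj])+
  show "Ck_on n (\<lambda>u. Pm u $ i $ a) (\<zeta> ` N)" "Ck_on n (\<lambda>u. Qm u $ i $ a) (\<zeta> ` N)"
    using Ck_on_add[OF open_image Ck_on_bounded_linear[OF open_image lin(1)[of "1 / 2"] Dy[of "axis a 1"]]
        Ck_on_bounded_linear[OF open_image lin(1)[of "\<i> / 2"] Dy[of "axis a \<i>"]]]
      Ck_on_add[OF open_image Ck_on_bounded_linear[OF open_image lin(2)[of "1 / 2"] Dy[of "axis a 1"]]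
        Ck_on_bounded_linear[OF open_image lin(2)[of "\<i> / 2"] Dy[of "axis a \<i>"]]]
    by (simp_all add: Pm_def Qm_def anti_coeff_def add_divide_distrib)
qed

text \<open>By \<open>is_J_of_Mt\<close> and \<open>Pm_nonsingular\<close> these are the chart
  points at which J lies in the large cell. In this form the set is visibly open.\<close>

definition V1 :: "'m cspace set" where
  "V1 = {u \<in> \<zeta> ` N. Determinants.det (Pm u) \<noteq> 0}"

lemma open_V1: "open V1"
proof -
  have "continuous_on (\<zeta> ` N) (\<lambda>u. Determinants.det (Pm u))"
    by (rule Ck_on_imp_continuous_on[OF Ck_on_det[OF open_image Ck_on_Pm]])
  then have "open ((\<lambda>u. Determinants.det (Pm u)) -` (- {0}) \<inter> \<zeta> ` N)"
    using continuous_on_open_vimage[OF open_image] by blast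
  moreover have "V1 = (\<lambda>u. Determinants.det (Pm u)) -` (- {0}) \<inter> \<zeta> ` N"
    by (auto simp: V1_def)
  ultimately show ?thesis
    by simp
qed

lemma V1_subset: "V1 \<subseteq> \<zeta> ` N"
  by (auto simp: V1_def)

definition Mt :: "'m cspace \<Rightarrow> 'm cmatrix" where
  "Mt u = Qm u ** matrix_inv (Pm u)"

lemma Mt_Pm: "u \<in> V1 \<Longrightarrow> Qm u = Mt u ** Pm u" "u \<in> V1 \<Longrightarrow> Pm u ** matrix_inv (Pm u) = Finite_Cartesian_Product.mat 1"
  by (simp_all add: V1_def Mt_def matrix_mul_assoc[symmetric] matrix_inv_inverse invertible_det_nz)

lemma is_J_of_Mt:
  assumes "u \<in> V1"
  shows "is_J_of (Mt u) (J (y u))" and "Mt u \<in> so_complex"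
proof -
  have u: "u \<in> \<zeta> ` N"
    using assms V1_subset by blast
  have \<theta>: "theta (Mt u) i \<in> cotangent10 (J (y u))" for i
    using theta_in_cotangent10_iff[OF u] Mt_Pm(1)[OF assms] by blast
  show "is_J_of (Mt u) (J (y u))" "Mt u \<in> so_complex"
    using is_J_of_theta[OF J[OF y_mem[OF u]] \<theta>] theta_in_cotangent10_skew[OF J[OF y_mem[OF u]] \<theta>]
    by blast+
qed

text \<open>Cramer's rule writes the entries of M as quotients of determinants in the entries of P
  and Q, so closure under products and inverses suffices.\<close>

lemma Ck_on_Mt: "Ck_on n (\<lambda>u. Mt u $ i $ k) V1"
proof -
  have eq: "Mt u $ i $ k = Determinants.det (\<chi> r. if r = k then Qm u $ i else Pm u $ r) * inverse (Determinants.det (Pm u))"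
    if "u \<in> V1" for u
  proof -
    have "(\<Sum>j\<in>UNIV. Mt u $ i $ j *s Finite_Cartesian_Product.row j (Pm u)) = Qm u $ i"
      unfolding Mt_Pm(1)[OF that]
      by (simp add: cart_eq_iff Finite_Cartesian_Product.row_def matrix_matrix_mult_def)
    moreover have "Finite_Cartesian_Product.row r (Pm u) = Pm u $ r" for r
      by (simp add: Finite_Cartesian_Product.row_def cart_eq_iff)
    ultimately have "Determinants.det (\<chi> r. if r = k then Qm u $ i else Pm u $ r) = Mt u $ i $ k * Determinants.det (Pm u)"
      using cramer_lemma_transpose[of k "Mt u $ i" "Pm u"] by (simp cong: if_cong)
    then show ?thesis
      using that by (simp add: V1_def)
  qed
  have ck: "Ck_on n (\<lambda>u. Determinants.det (\<chi> r. if r = k then Qm u $ i else Pm u $ r) *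
      inverse (Determinants.det (Pm u))) V1"
  proof (intro Ck_on_mult Ck_on_inverse Ck_on_det open_V1)
    show "Ck_on n (\<lambda>u. (\<chi> r. if r = k then Qm u $ i else Pm u $ r) $ s $ a) V1" for s a
      using Ck_on_subset[OF Ck_on_Pm V1_subset] Ck_on_subset[OF Ck_on_Qm V1_subset]
      by (cases "s = k") simp_all
    show "Ck_on n (\<lambda>u. Pm u $ s $ a) V1" for s a
      by (rule Ck_on_subset[OF Ck_on_Pm V1_subset])
  qed (simp add: V1_def)
  show ?thesis
    by (rule Ck_on_cong[OF open_V1 _ ck]) (rule eq[symmetric])
qed

end

text \<open>The product rule for x - M conj(c). It serves for a moving point, which gives the
  derivative of h, and for a constant point q, which gives the z-derivative of q - M
  conj(q).\<close>

lemma has_derivative_Theta: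
  fixes x c :: "'a::real_normed_vector \<Rightarrow> 'm::finite cspace"
  assumes "(x has_derivative Dx) (at v)" "(c has_derivative Dc) (at v)"
    "\<And>i j. ((\<lambda>v. M v $ i $ j) has_derivative DM i j) (at v)"
  shows "((\<lambda>v. (x v - M v *v vcnj (c v)) $ i) has_derivative
    (\<lambda>w. (Dx w - M v *v vcnj (Dc w)) $ i - (\<Sum>j\<in>UNIV. DM i j w * cnj (c v $ j)))) (at v)"
proof -
  have c: "((\<lambda>v. cnj (c v $ j)) has_derivative (\<lambda>w. cnj (Dc w $ j))) (at v)" for j
    by (intro has_derivative_cnj has_derivative_vec_nth assms)
  have "((\<lambda>v. x v $ i - (\<Sum>j\<in>UNIV. M v $ i $ j * cnj (c v $ j))) has_derivative
    (\<lambda>w. Dx w $ i - (\<Sum>j\<in>UNIV. M v $ i $ j * cnj (Dc w $ j) + DM i j w * cnj (c v $ j)))) (at v)"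
    by (intro has_derivative_diff has_derivative_sum has_derivative_mult has_derivative_vec_nth assms c)
  then show ?thesis
    by (simp add: matrix_vector_mult_def sum.distrib diff_diff_eq)
qed

context complex_chart
begin

lemma Dy_differentiable:
  assumes "u \<in> \<zeta> ` N"
  shows "((\<lambda>u. Dy u w) has_derivative frechet_derivative (\<lambda>u. Dy u w) (at u)) (at u)"
  using smooth_on_has_derivative[OF smooth_on_frechet[OF smooth_y] assms] by (simp add: Dy_def)

lemma D2y_symmetric:
  assumes "u \<in> \<zeta> ` N"
  shows "frechet_derivative (\<lambda>u. Dy u w) (at u) v = frechet_derivative (\<lambda>u. Dy u v) (at u) w"
  unfolding Dy_def by (rule second_derivative_symmetric[OF open_image smooth_y assms])

lemma has_derivative_Qm_Pm:
  assumes "u \<in> \<zeta> ` N"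
  defines "D2 \<equiv> \<lambda>w v. frechet_derivative (\<lambda>u. Dy u w) (at u) v"
  shows "((\<lambda>u. Qm u $ i $ a) has_derivative (\<lambda>v. anti_coeff (\<lambda>w. D2 w v $ i) a)) (at u)"
    and "((\<lambda>u. Pm u $ i $ a) has_derivative (\<lambda>v. anti_coeff (\<lambda>w. cnj (D2 w v $ i)) a)) (at u)"
proof -
  have D: "((\<lambda>u. Dy u w $ i) has_derivative (\<lambda>v. D2 w v $ i)) (at u)" for w
    unfolding D2_def by (rule has_derivative_vec_nth[OF Dy_differentiable[OF assms(1)]])
  show "((\<lambda>u. Qm u $ i $ a) has_derivative (\<lambda>v. anti_coeff (\<lambda>w. D2 w v $ i) a)) (at u)"
    "((\<lambda>u. Pm u $ i $ a) has_derivative (\<lambda>v. anti_coeff (\<lambda>w. cnj (D2 w v $ i)) a)) (at u)"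
    unfolding Qm_def Pm_def anti_coeff_def vec_lambda_beta
    using D has_derivative_cnj[OF D] by (auto intro!: derivative_eq_intros)
qed

lemma Mt_has_derivative:
  "u \<in> V1 \<Longrightarrow> ((\<lambda>u. Mt u $ i $ j) has_derivative frechet_derivative (\<lambda>u. Mt u $ i $ j) (at u)) (at u)"
  by (rule Ck_on_Suc_has_derivative[OF Ck_on_Mt])

text \<open>\<open>LQ\<close> and \<open>LP\<close> are second antiholomorphic derivatives of y and
  conj(y), hence symmetric in a and b. Subtracting them from the derivative of Q = M P leaves
  precisely the symmetry required by \<open>symmetric_skew_eq_0\<close>.\<close>

lemma anti_coeff_Mt:
  assumes u: "u \<in> V1"
  shows "anti_coeff (frechet_derivative (\<lambda>u. Mt u $ i $ j) (at u)) b = 0"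
proof -
  have u': "u \<in> \<zeta> ` N"
    using u V1_subset by blast
  define T where "T b i j = anti_coeff (frechet_derivative (\<lambda>u. Mt u $ i $ j) (at u)) b" for b i j
  define D2 where "D2 w v = frechet_derivative (\<lambda>u. Dy u w) (at u) v" for w v
  have D2: "D2 v w = D2 w v" for v w
    unfolding D2_def by (rule D2y_symmetric[OF u'])
  note DQP = has_derivative_Qm_Pm[OF u', folded D2_def]
  define LQ where "LQ i a b = anti_coeff (\<lambda>v. anti_coeff (\<lambda>w. D2 w v $ i) a) b" for i a b
  define LP where "LP i a b = anti_coeff (\<lambda>v. anti_coeff (\<lambda>w. cnj (D2 w v $ i)) a) b" for i a b
  have LQ: "LQ i a b = (\<Sum>j\<in>UNIV. Mt u $ i $ j * LP j a b + T b i j * Pm u $ j $ a)" for i a b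
  proof -
    have "((\<lambda>u. \<Sum>j\<in>UNIV. Mt u $ i $ j * Pm u $ j $ a) has_derivative
      (\<lambda>v. \<Sum>j\<in>UNIV. Mt u $ i $ j * anti_coeff (\<lambda>w. cnj (D2 w v $ j)) a +
        frechet_derivative (\<lambda>u. Mt u $ i $ j) (at u) v * Pm u $ j $ a)) (at u)"
      by (intro has_derivative_sum has_derivative_mult DQP Mt_has_derivative u)
    then have "((\<lambda>u. Qm u $ i $ a) has_derivative
      (\<lambda>v. \<Sum>j\<in>UNIV. Mt u $ i $ j * anti_coeff (\<lambda>w. cnj (D2 w v $ j)) a +
        frechet_derivative (\<lambda>u. Mt u $ i $ j) (at u) v * Pm u $ j $ a)) (at u)"
      by (rule has_derivative_transform_within_open[OF _ open_V1 u])
        (simp add: Mt_Pm(1) matrix_matrix_mult_def)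
    from has_derivative_unique[OF DQP(1) this] show ?thesis
      unfolding T_def LQ_def LP_def by (simp only: anti_coeff_sum_product_rule)
  qed
  have L_sym: "LQ i a b = LQ i b a" "LP i a b = LP i b a" for i a b
    unfolding LQ_def LP_def
    using D2[of "axis a 1" "axis b \<i>"] D2[of "axis a \<i>" "axis b 1"] D2[of "axis a 1" "axis b 1"]
      D2[of "axis a \<i>" "axis b \<i>"]
    by (simp_all add: anti_coeff_def field_simps)
  have sym: "(\<Sum>j\<in>UNIV. T b i j * Pm u $ j $ a) = (\<Sum>j\<in>UNIV. T a i j * Pm u $ j $ b)" for a b i
  proof -
    have "(\<Sum>j\<in>UNIV. Mt u $ i $ j * LP j a b) + (\<Sum>j\<in>UNIV. T b i j * Pm u $ j $ a) = LQ i a b"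
      by (simp add: LQ sum.distrib)
    also have "\<dots> = LQ i b a"
      by (rule L_sym(1))
    also have "\<dots> = (\<Sum>j\<in>UNIV. Mt u $ i $ j * LP j b a) + (\<Sum>j\<in>UNIV. T a i j * Pm u $ j $ b)"
      by (simp add: LQ sum.distrib)
    also have "(\<Sum>j\<in>UNIV. Mt u $ i $ j * LP j b a) = (\<Sum>j\<in>UNIV. Mt u $ i $ j * LP j a b)"
      by (intro sum.cong refl arg_cong[of _ _ "(*) _"] L_sym(2))
    finally show ?thesis
      by simp
  qed
  have skew: "T b i j = - T b j i" for b i j
  proof -
    have "((\<lambda>u. - Mt u $ j $ i) has_derivative (\<lambda>v. - frechet_derivative (\<lambda>u. Mt u $ j $ i) (at u) v)) (at u)"
      by (intro has_derivative_minus Mt_has_derivative u)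
    then have "((\<lambda>u. Mt u $ i $ j) has_derivative (\<lambda>v. - frechet_derivative (\<lambda>u. Mt u $ j $ i) (at u) v)) (at u)"
      by (rule has_derivative_transform_within_open[OF _ open_V1 u])
        (rule so_complexD[OF is_J_of_Mt(2), symmetric])
    from has_derivative_unique[OF Mt_has_derivative[OF u] this] show ?thesis
      by (simp add: T_def anti_coeff_def field_simps)
  qed
  show ?thesis
    using symmetric_skew_eq_0[OF Mt_Pm(2)[OF u] sym skew] by (simp add: T_def)
qed

section \<open>The map h and its rank after recentring\<close>

definition ht :: "'m cspace \<Rightarrow> 'm cspace" where
  "ht u = y u - Mt u *v vcnj (y u)"

lemma ht_has_derivative:
  assumes "u \<in> V1"
  shows "((\<lambda>u. ht u $ i) has_derivative (\<lambda>w. (Dy u w - Mt u *v vcnj (Dy u w)) $ i -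
    (\<Sum>j\<in>UNIV. frechet_derivative (\<lambda>u. Mt u $ i $ j) (at u) w * cnj (y u $ j)))) (at u)"
  unfolding ht_def
proof (rule has_derivative_Theta)
  show "(y has_derivative Dy u) (at u)" "(y has_derivative Dy u) (at u)"
    using assms V1_subset Dy by blast+
qed (rule Mt_has_derivative[OF assms])

lemma Ck_on_ht: "Ck_on n (\<lambda>u. ht u $ i) V1"
proof -
  have y: "Ck_on n (\<lambda>u. L (y u)) V1" if "bounded_linear L" for L :: "'m cspace \<Rightarrow> complex"
  proof (rule Ck_on_subset[OF _ V1_subset])
    show "Ck_on n (\<lambda>u. L (y u)) (\<zeta> ` N)"
      using smooth_y by (intro Ck_on_bounded_linear[OF open_image that]) (simp add: smooth_on_def)
  qed
  have "bounded_linear (\<lambda>w :: 'm cspace. cnj (w $ j))" for j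
    by (rule bounded_linear_compose[OF bounded_linear_cnj bounded_linear_vec_nth])
  then have "Ck_on n (\<lambda>u. y u $ i - (\<Sum>j\<in>UNIV. Mt u $ i $ j * cnj (y u $ j))) V1"
    using y[of "\<lambda>w. w $ i"] y[of "\<lambda>w. cnj (w $ j)" for j]
    by (intro Ck_on_diff Ck_on_sum Ck_on_mult Ck_on_Mt open_V1) (simp_all add: bounded_linear_vec_nth)
  then show ?thesis
    by (simp add: ht_def matrix_vector_mult_def)
qed

text \<open>The product rule gives Q - M P, which is 0 by the choice of M, and antiholomorphic
  derivatives of M, which vanish by \<open>anti_coeff_Mt\<close>.\<close>

lemma anti_coeff_ht:
  assumes u: "u \<in> V1"
  shows "anti_coeff (frechet_derivative (\<lambda>u. ht u $ i) (at u)) b = 0"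
proof -
  have "(\<lambda>w. (Dy u w - Mt u *v vcnj (Dy u w)) $ i -
      (\<Sum>j\<in>UNIV. frechet_derivative (\<lambda>u. Mt u $ i $ j) (at u) w * cnj (y u $ j))) =
    (\<lambda>w. (Dy u w $ i + (-1) * (\<Sum>j\<in>UNIV. Mt u $ i $ j * cnj (Dy u w $ j))) + (-1) *
      (\<Sum>j\<in>UNIV. cnj (y u $ j) * frechet_derivative (\<lambda>u. Mt u $ i $ j) (at u) w))"
    by (simp add: fun_eq_iff matrix_vector_mult_def mult.commute)
  then have "frechet_derivative (\<lambda>u. ht u $ i) (at u) =
    (\<lambda>w. (Dy u w $ i + (-1) * (\<Sum>j\<in>UNIV. Mt u $ i $ j * cnj (Dy u w $ j))) + (-1) *
      (\<Sum>j\<in>UNIV. cnj (y u $ j) * frechet_derivative (\<lambda>u. Mt u $ i $ j) (at u) w))"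
    using frechet_derivative_at[OF ht_has_derivative[OF u]] by metis
  then have "anti_coeff (frechet_derivative (\<lambda>u. ht u $ i) (at u)) b =
      Qm u $ i $ b - (Mt u ** Pm u) $ i $ b"
    by (simp only: hol_coeff_linear_combination hol_coeff_sum anti_coeff_Mt[OF u])
      (simp add: Qm_def Pm_def matrix_matrix_mult_def)
  then show ?thesis
    by (simp add: Mt_Pm(1)[OF u])
qed

lemma Mt_ht_complex_linear:
  assumes u: "u \<in> V1"
  shows "frechet_derivative (\<lambda>u. Mt u $ i $ j) (at u) (mult_i w) =
      \<i> * frechet_derivative (\<lambda>u. Mt u $ i $ j) (at u) w"
    and "frechet_derivative (\<lambda>u. ht u $ i) (at u) (mult_i w) =
      \<i> * frechet_derivative (\<lambda>u. ht u $ i) (at u) w"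
proof -
  have "linear (frechet_derivative (\<lambda>u. Mt u $ i $ j) (at u))"
    "linear (frechet_derivative (\<lambda>u. ht u $ i) (at u))"
    using Mt_has_derivative[OF u] Ck_on_Suc_has_derivative[OF Ck_on_ht u]
    by (blast intro: has_derivative_linear)+
  then show "frechet_derivative (\<lambda>u. Mt u $ i $ j) (at u) (mult_i w) =
      \<i> * frechet_derivative (\<lambda>u. Mt u $ i $ j) (at u) w"
    "frechet_derivative (\<lambda>u. ht u $ i) (at u) (mult_i w) =
      \<i> * frechet_derivative (\<lambda>u. ht u $ i) (at u) w"
    using complex_linear_iff_anti_coeff anti_coeff_Mt[OF u] anti_coeff_ht[OF u] by blast+
qed

text \<open>
  The derivative of \<open>ht - (p - Mt *v vcnj p)\<close> is \<open>Dy - Mt *v vcnj Dy\<close> where \<open>y = p\<close>, so it is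
  injective near that point.
\<close>

definition Rm :: "'m cspace \<Rightarrow> 'm cspace \<Rightarrow> 'm cmatrix" where
  "Rm p u = (\<chi> i a. frechet_derivative (\<lambda>u. ht u $ i) (at u) (axis a 1) +
    (\<Sum>j\<in>UNIV. frechet_derivative (\<lambda>u. Mt u $ i $ j) (at u) (axis a 1) * cnj (p $ j)))"

lemma Rm_mult:
  assumes u: "u \<in> V1"
  shows "(Rm p u *v w) $ i = frechet_derivative (\<lambda>u. ht u $ i) (at u) w +
    (\<Sum>j\<in>UNIV. frechet_derivative (\<lambda>u. Mt u $ i $ j) (at u) w * cnj (p $ j))"
proof -
  let ?D = "\<lambda>w. frechet_derivative (\<lambda>u. ht u $ i) (at u) w +
    (\<Sum>j\<in>UNIV. frechet_derivative (\<lambda>u. Mt u $ i $ j) (at u) w * cnj (p $ j))"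
  have D: "((\<lambda>u. ht u $ i + (\<Sum>j\<in>UNIV. Mt u $ i $ j * cnj (p $ j))) has_derivative ?D) (at u)"
    by (intro has_derivative_add has_derivative_sum has_derivative_mult_left Mt_has_derivative
        Ck_on_Suc_has_derivative[OF Ck_on_ht] u)
  have "?D (mult_i w) = \<i> * ?D w" for w
    by (simp add: Mt_ht_complex_linear[OF u] sum_distrib_left algebra_simps)
  note eq = cpartial_eq[OF D this]
  show ?thesis
    unfolding eq(2)[of w] by (simp add: eq(1) Rm_def matrix_vector_mult_def)
qed

lemma Rm_nonsingular:
  assumes u: "u \<in> V1"
  shows "Determinants.det (Rm (y u) u) \<noteq> 0"
proof -
  have u': "u \<in> \<zeta> ` N"
    using u V1_subset by blast
  have "w = 0" if "Rm (y u) u *v w = 0" for w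
  proof -
    have "(Rm (y u) u *v w) $ i = (Dy u w - Mt u *v vcnj (Dy u w)) $ i" for i
      unfolding Rm_mult[OF u] frechet_derivative_at[OF ht_has_derivative[OF u], symmetric] by simp
    then have "Dy u w - Mt u *v vcnj (Dy u w) = 0"
      using that by (simp add: cart_eq_iff)
    then have "Dy u w = 0"
      by (rule Theta_skew_injective[OF is_J_of_Mt(2)[OF u]])
    then show "w = 0"
      using D\<zeta>_Dy[OF u', of w] linear_0[OF has_derivative_linear[OF D\<zeta>[OF y_mem[OF u']]]] by simp
  qed
  then have "invertible (Rm (y u) u)"
    unfolding invertible_left_inverse matrix_left_invertible_ker by blast
  then show ?thesis
    by (simp add: invertible_det_nz)
qed

text \<open>Nonsingularity of \<open>Rm p u\<close> is established at the chart point of p only;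
  openness of this set spreads the rank condition to a neighbourhood.\<close>

definition V2 :: "'m cspace \<Rightarrow> 'm cspace set" where
  "V2 p = {u \<in> V1. Determinants.det (Rm p u) \<noteq> 0}"

lemma open_V2: "open (V2 p)"
proof -
  have D: "Ck_on 0 (\<lambda>u. frechet_derivative (\<lambda>u. ht u $ i) (at u) v) V1"
    "Ck_on 0 (\<lambda>u. frechet_derivative (\<lambda>u. Mt u $ i $ j) (at u) v) V1" for i j v
    using Ck_on_ht[of "Suc 0"] Ck_on_Mt[of "Suc 0"] by simp_all
  have "Ck_on 0 (\<lambda>u. Rm p u $ i $ a) V1" for i a
    unfolding Rm_def vec_lambda_beta
    by (intro Ck_on_add Ck_on_sum Ck_on_mult Ck_on_const D open_V1)
  then have "continuous_on V1 (\<lambda>u. Determinants.det (Rm p u))"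
    by (intro Ck_on_imp_continuous_on[OF Ck_on_det[OF open_V1]])
  then have "open ((\<lambda>u. Determinants.det (Rm p u)) -` (- {0}) \<inter> V1)"
    using continuous_on_open_vimage[OF open_V1] by blast
  moreover have "V2 p = (\<lambda>u. Determinants.det (Rm p u)) -` (- {0}) \<inter> V1"
    by (auto simp: V2_def)
  ultimately show ?thesis
    by simp
qed

text \<open>The forms \<open>theta M i\<close> lie in their own span and so are of type (1,0). This
  makes P nonsingular at the chart point of p, and there y takes the value p, as the rank argument
  requires.\<close>

lemma large_cell_mem_V2:
  assumes "p \<in> N" "J p \<in> large_cell"
  shows "\<zeta> p \<in> V2 p"
proof -
  obtain M where M: "is_J_of M (J p)"
    using assms by (auto simp: large_cell_def)
  have "theta M i \<in> cotangent10 (J p)" for i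
  proof -
    have "theta M i = (\<lambda>X. \<Sum>k\<in>UNIV. (if k = i then 1 else 0) * theta M k X)"
      by (simp add: if_distrib[where f = "\<lambda>x. x * _"] cong: if_cong)
    then show ?thesis
      using M by (auto simp: is_J_of_def)
  qed
  then have "Qm (\<zeta> p) = M ** Pm (\<zeta> p)"
    using theta_in_cotangent10_iff[of "\<zeta> p" M] assms(1) by (simp add: y_\<zeta>)
  then have "\<zeta> p \<in> V1"
    using Pm_nonsingular[of "\<zeta> p" M] assms(1) by (simp add: V1_def)
  then show ?thesis
    using Rm_nonsingular[of "\<zeta> p"] assms(1) by (simp add: V2_def y_\<zeta>)
qed

end

subsection \<open>The implicit equation of a system of holomorphic coordinates\<close>

lemma idx_le_CARD: "idx i \<le> CARD('m)" for i :: "'m::{finite,linorder}"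
  unfolding idx_def by (rule card_mono) auto

lemma Cpow_CARD: "Cpow CARD('m) = (UNIV :: 'm::{finite,linorder} cspace set)"
  using idx_le_CARD by (auto simp: Cpow_def not_less[symmetric])

lemma holomorphic_inE:
  assumes "holomorphic_in mult_i UNIV V f" "v \<in> V"
  obtains D where "(f has_derivative D) (at v)" "\<And>w. D (mult_i w) = \<i> * D w"
  using assms unfolding holomorphic_in_def by blast

text \<open>What the calculations with F use of the chart: J-holomorphic coordinates z with a
  differentiable inverse x, in which M and h = x - M conj(x) are holomorphic.\<close>

locale implicit_coordinates =
  fixes U V :: "'m::{finite,linorder} cspace set" and z x :: "'m cspace \<Rightarrow> 'm cspace"
    and Dx :: "'m cspace \<Rightarrow> 'm cspace \<Rightarrow> 'm cspace" and M :: "'m cspace \<Rightarrow> 'm cmatrix"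
    and h :: "'m cspace \<Rightarrow> 'm cspace" and J :: "'m cspace \<Rightarrow> 'm cspace \<Rightarrow> 'm cspace"
  assumes open_U: "open U" and open_V: "open V"
    and z_mem: "q \<in> U \<Longrightarrow> z q \<in> V"
    and x_z: "q \<in> U \<Longrightarrow> x (z q) = q" and z_x: "v \<in> V \<Longrightarrow> z (x v) = v"
    and smooth_z: "smooth_on U z"
    and z_hol: "q \<in> U \<Longrightarrow> frechet_derivative z (at q) (J q X) = mult_i (frechet_derivative z (at q) X)"
    and Dx: "v \<in> V \<Longrightarrow> (x has_derivative Dx v) (at v)"
    and is_J: "v \<in> V \<Longrightarrow> is_J_of (M v) (J (x v))" and M_skew: "v \<in> V \<Longrightarrow> M v \<in> so_complex"
    and M_hol: "holomorphic_in mult_i UNIV V (\<lambda>v. M v $ i $ j)"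
    and h_hol: "holomorphic_in mult_i UNIV V (\<lambda>v. h v $ i)"
    and h: "v \<in> V \<Longrightarrow> h v = x v - M v *v vcnj (x v)"
begin

definition f :: "'m cspace \<times> 'm cspace \<Rightarrow> 'm cspace" where
  "f = (\<lambda>(w, z). w - h z)"

lemma Dz: "q \<in> U \<Longrightarrow> (z has_derivative frechet_derivative z (at q)) (at q)"
  by (rule smooth_on_has_derivative[OF smooth_z])

lemma Dz_nth:
  "q \<in> U \<Longrightarrow> ((\<lambda>q. z q $ a) has_derivative (\<lambda>X. frechet_derivative z (at q) X $ a)) (at q)"
  by (rule has_derivative_vec_nth[OF Dz])

lemma frechet_derivative_z_nth:
  "q \<in> U \<Longrightarrow> frechet_derivative (\<lambda>q. z q $ a) (at q) = (\<lambda>X. frechet_derivative z (at q) X $ a)"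
  by (rule frechet_derivative_at[OF Dz_nth, symmetric])

lemma Dx_Dz:
  assumes "q \<in> U"
  shows "Dx (z q) (frechet_derivative z (at q) X) = X"
proof -
  have "((\<lambda>q. x (z q)) has_derivative (\<lambda>X. Dx (z q) (frechet_derivative z (at q) X))) (at q)"
    using Dz[OF assms] Dx[OF z_mem[OF assms]] by (rule has_derivative_compose)
  moreover have "((\<lambda>q. x (z q)) has_derivative (\<lambda>X. X)) (at q)"
    by (rule has_derivative_transform_within_open[OF has_derivative_ident open_U assms]) (simp add: x_z)
  ultimately show ?thesis
    by (metis has_derivative_unique)
qed

lemma Dz_Dx:
  assumes "q \<in> U"
  shows "frechet_derivative z (at q) (Dx (z q) w) = w"
proof -
  have "((\<lambda>v. z (x v)) has_derivative (\<lambda>w. frechet_derivative z (at q) (Dx (z q) w))) (at (z q))"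
    using Dz[OF assms] Dx[OF z_mem[OF assms]] x_z[OF assms]
    by (intro has_derivative_compose[where f = x and g = z]) auto
  moreover have "((\<lambda>v. z (x v)) has_derivative (\<lambda>w. w)) (at (z q))"
    by (rule has_derivative_transform_within_open[OF has_derivative_ident open_V z_mem[OF assms]])
      (simp add: z_x)
  ultimately show ?thesis
    by (metis has_derivative_unique)
qed

lemma is_J_of_z: "q \<in> U \<Longrightarrow> is_J_of (M (z q)) (J q)"
  using is_J[OF z_mem] by (simp add: x_z)

lemma z_cotangent10:
  assumes "q \<in> U"
  shows "(\<lambda>X. frechet_derivative z (at q) X $ a) \<in> cotangent10 (J q)"
  using has_derivative_linear[OF Dz_nth[OF assms]] z_hol[OF assms]
  by (simp add: cotangent10_def mult_i_def)

text \<open>In F = q - M(z) conj(q) - h(z) the derivatives of M appear twice, once with conj(q) and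
  once, inside h, with conj(x(z)). They cancel because x(z) = q, leaving only the derivative of
  x.\<close>

lemma Kmat_mult:
  assumes q: "q \<in> U"
  shows "Kmat f M q (z q) *v w = - (Dx (z q) w - M (z q) *v vcnj (Dx (z q) w))"
proof -
  note zq = z_mem[OF q]
  have "(Kmat f M q (z q) *v w) $ i = - (Dx (z q) w - M (z q) *v vcnj (Dx (z q) w)) $ i" for i
  proof -
    obtain Dh where Dh: "((\<lambda>v. h v $ i) has_derivative Dh) (at (z q))" "\<And>w. Dh (mult_i w) = \<i> * Dh w"
      using holomorphic_inE[OF h_hol zq] by blast
    define DM where "DM a b = frechet_derivative (\<lambda>v. M v $ a $ b) (at (z q))" for a b
    have DM: "((\<lambda>v. M v $ a $ b) has_derivative DM a b) (at (z q))" "DM a b (mult_i w) = \<i> * DM a b w" for a b w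
    proof -
      obtain D where D: "((\<lambda>v. M v $ a $ b) has_derivative D) (at (z q))" "\<And>w. D (mult_i w) = \<i> * D w"
        using holomorphic_inE[OF M_hol zq] by blast
      then show "((\<lambda>v. M v $ a $ b) has_derivative DM a b) (at (z q))" "DM a b (mult_i w) = \<i> * DM a b w"
        using frechet_derivative_at[OF D(1)] by (simp_all add: DM_def)
    qed
    let ?S = "\<lambda>w. \<Sum>j\<in>UNIV. DM i j w * cnj (q $ j)"
    have "((\<lambda>v. (x v - M v *v vcnj (x v)) $ i) has_derivative (\<lambda>w. (Dx (z q) w - M (z q) *v vcnj (Dx (z q) w)) $ i -
        (\<Sum>j\<in>UNIV. DM i j w * cnj (x (z q) $ j)))) (at (z q))"
      by (rule has_derivative_Theta[OF Dx[OF zq] Dx[OF zq] DM(1)])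
    then have "((\<lambda>v. h v $ i) has_derivative (\<lambda>w. (Dx (z q) w - M (z q) *v vcnj (Dx (z q) w)) $ i -
        (\<Sum>j\<in>UNIV. DM i j w * cnj (x (z q) $ j)))) (at (z q))"
      by (rule has_derivative_transform_within_open[OF _ open_V zq]) (simp add: h)
    from has_derivative_unique[OF Dh(1) this]
    have Dh_eq: "Dh w = (Dx (z q) w - M (z q) *v vcnj (Dx (z q) w)) $ i - ?S w" for w
      by (simp add: x_z[OF q])
    have "((\<lambda>v. ((\<lambda>_. q) v - M v *v vcnj ((\<lambda>_. q) v)) $ i) has_derivative
        (\<lambda>w. (0 - M (z q) *v vcnj 0) $ i - ?S w)) (at (z q))"
      by (rule has_derivative_Theta[OF has_derivative_const has_derivative_const DM(1)])
    moreover have "vcnj 0 = (0 :: 'm cspace)"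
      by (simp add: cart_eq_iff)
    ultimately have "((\<lambda>v. (q - M v *v vcnj q) $ i) has_derivative (\<lambda>w. - ?S w)) (at (z q))"
      by simp
    from has_derivative_diff[OF this Dh(1)]
    have E: "((\<lambda>v. eqF f M q v $ i) has_derivative (\<lambda>w. - ?S w - Dh w)) (at (z q))"
      by (simp add: eqF_def f_def)
    have "- ?S (mult_i w) - Dh (mult_i w) = \<i> * (- ?S w - Dh w)" for w
      by (simp add: DM(2) Dh(2) sum_distrib_left algebra_simps)
    from cpartial_eq(2)[OF E this]
    have "(Kmat f M q (z q) *v w) $ i = - ?S w - Dh w"
      by (simp add: Kmat_def cjacobian_def matrix_vector_mult_def)
    then show ?thesis
      by (simp add: Dh_eq)
  qed
  then show ?thesis
    by (simp add: cart_eq_iff)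
qed

lemma Kmat_injective:
  assumes q: "q \<in> U" and "Kmat f M q (z q) *v w = 0"
  shows "w = 0"
proof -
  have "Dx (z q) w - M (z q) *v vcnj (Dx (z q) w) = 0"
    using assms(2) unfolding Kmat_mult[OF q] by simp
  then have "Dx (z q) w = 0"
    by (rule Theta_skew_injective[OF M_skew[OF z_mem[OF q]]])
  then show ?thesis
    using Dz_Dx[OF q, of w] linear_0[OF has_derivative_linear[OF Dz[OF q]]] by simp
qed

text \<open>Applying \<open>Kmat_mult\<close> to dz gives K dz = -\<open>theta\<close>; comparing
  dq-coefficients yields the matrix equation.\<close>

lemma Kmat_wirtinger:
  assumes q: "q \<in> U"
  shows "Kmat f M q (z q) ** (\<chi> c i. wirtinger (\<lambda>q. z q $ c) i q) = - Finite_Cartesian_Product.mat 1"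
proof -
  let ?K = "Kmat f M q (z q)" and ?D = "frechet_derivative z (at q)"
  have "(\<Sum>c\<in>UNIV. ?K $ r $ c * wirtinger (\<lambda>q. z q $ c) i q) = (if r = i then - 1 else 0)" for r i
  proof -
    have "(\<Sum>c\<in>UNIV. ?K $ r $ c * wirtinger (\<lambda>q. z q $ c) i q) =
        hol_coeff (\<lambda>X. \<Sum>c\<in>UNIV. ?K $ r $ c * ?D X $ c) i"
      by (simp add: wirtinger_eqI[OF Dz_nth[OF q]] hol_coeff_sum)
    also have "(\<lambda>X. \<Sum>c\<in>UNIV. ?K $ r $ c * ?D X $ c) = (\<lambda>X. - theta (M (z q)) r X)"
    proof
      fix X
      have "(?K *v ?D X) $ r = - theta (M (z q)) r X"
        unfolding Kmat_mult[OF q] Dx_Dz[OF q] theta_eq by simp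
      then show "(\<Sum>c\<in>UNIV. ?K $ r $ c * ?D X $ c) = - theta (M (z q)) r X"
        by (simp add: matrix_vector_mult_def)
    qed
    also have "hol_coeff (\<lambda>X. - theta (M (z q)) r X) i = - hol_coeff (theta (M (z q)) r) i"
      by (simp add: hol_coeff_def field_simps)
    finally show ?thesis
      by (simp add: hol_coeff_theta)
  qed
  then show ?thesis
    by (simp add: cart_eq_iff matrix_matrix_mult_def Finite_Cartesian_Product.mat_def)
qed

lemma laplacian_z:
  assumes q: "q \<in> U"
  shows "1 / 4 * laplacian (\<lambda>q. z q $ a) q = - (\<Sum>i\<in>UNIV. \<Sum>j\<in>UNIV. \<Sum>b\<in>UNIV.
    wirtinger (\<lambda>q. z q $ a) i q * wirtinger (\<lambda>q. z q $ b) j q * cpartial (\<lambda>z. M z $ i $ j) b (z q))"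
proof (rule laplacian_formula[OF open_U q])
  show "smooth_on U (\<lambda>q. z q $ a)"
    by (rule smooth_on_bounded_linear[OF open_U bounded_linear_vec_nth smooth_z])
  show "(\<lambda>q. z q $ b) differentiable at q" for b
    using Dz_nth[OF q] by (auto simp: differentiable_def)
  show "holomorphic_in mult_i UNIV V (\<lambda>z. M z $ i $ j)" for i j
    by (rule M_hol)
  show "M ` V \<subseteq> so_complex" "z ` U \<subseteq> V"
    using M_skew z_mem by blast+
  show "anti_coeff (frechet_derivative (\<lambda>q. z q $ a) (at q)) i =
      - (\<Sum>j\<in>UNIV. wirtinger (\<lambda>q. z q $ a) j q * M (z q) $ j $ i)" if "q \<in> U" for q i
    unfolding wirtinger_eq_hol_coeff frechet_derivative_z_nth[OF that]
    by (rule is_J_of_form(2)[OF is_J_of_z[OF that] z_cotangent10[OF that]])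
qed

lemma cpartial_skew:
  assumes v: "v \<in> V"
  shows "cpartial (\<lambda>z. M z $ i $ j) c v = - cpartial (\<lambda>z. M z $ j $ i) c v"
proof -
  obtain D where D: "((\<lambda>v. M v $ i $ j) has_derivative D) (at v)" "\<And>w. D (mult_i w) = \<i> * D w"
    using holomorphic_inE[OF M_hol v] by blast
  obtain E where E: "((\<lambda>v. M v $ j $ i) has_derivative E) (at v)" "\<And>w. E (mult_i w) = \<i> * E w"
    using holomorphic_inE[OF M_hol v] by blast
  have "((\<lambda>v. M v $ i $ j) has_derivative (\<lambda>w. - E w)) (at v)"
    by (rule has_derivative_transform_within_open[OF has_derivative_minus[OF E(1)] open_V v])
      (rule so_complexD[OF M_skew, symmetric])
  from has_derivative_unique[OF D(1) this] show ?thesis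
    by (simp add: cpartial_eq(1)[OF D] cpartial_eq(1)[OF E])
qed

lemma laplacian_z_det:
  assumes q: "q \<in> U"
  shows "Determinants.det (Kmat f M q (z q)) \<noteq> 0"
    and "1 / 4 * laplacian (\<lambda>q. z q $ a) q = (-1) ^ idx a / Determinants.det (Kmat f M q (z q)) *
      (\<Sum>(i, j) | i < j. (-1) ^ (idx i + idx j - 1) *
        Ddet (\<lambda>c. cpartial (\<lambda>z. M z $ i $ j) c (z q)) (Kmat f M q (z q)) a i j)"
proof -
  let ?d = "\<lambda>i j. \<chi> c. cpartial (\<lambda>z. M z $ i $ j) c (z q)"
  have row: "($) (?d i j) = (\<lambda>c. cpartial (\<lambda>z. M z $ i $ j) c (z q))" for i j
    by (simp add: fun_eq_iff)
  have d: "?d i j = - ?d j i" for i j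
    using cpartial_skew[OF z_mem[OF q], of i j] by (simp add: cart_eq_iff)
  show "Determinants.det (Kmat f M q (z q)) \<noteq> 0"
    by (rule laplacian_formula_det(1)[OF Kmat_wirtinger[OF q], of ?d]) (rule d)
  have "1 / 4 * laplacian (\<lambda>q. z q $ a) q = - (\<Sum>i\<in>UNIV. \<Sum>j\<in>UNIV. \<Sum>b\<in>UNIV.
      (\<chi> c i. wirtinger (\<lambda>q. z q $ c) i q) $ a $ i * (\<chi> c i. wirtinger (\<lambda>q. z q $ c) i q) $ b $ j *
      ?d i j $ b)"
    unfolding laplacian_z[OF q] by simp
  also have "\<dots> = (-1) ^ idx a / Determinants.det (Kmat f M q (z q)) *
      (\<Sum>(i, j) | i < j. (-1) ^ (idx i + idx j - 1) * Ddet (($) (?d i j)) (Kmat f M q (z q)) a i j)"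
    by (rule laplacian_formula_det(2)[OF Kmat_wirtinger[OF q]]) (rule d)
  finally show "1 / 4 * laplacian (\<lambda>q. z q $ a) q = (-1) ^ idx a / Determinants.det (Kmat f M q (z q)) *
      (\<Sum>(i, j) | i < j. (-1) ^ (idx i + idx j - 1) *
        Ddet (\<lambda>c. cpartial (\<lambda>z. M z $ i $ j) c (z q)) (Kmat f M q (z q)) a i j)"
    by (simp only: row)
qed

lemma implicit_solution_f: "implicit_solution CARD('m) (UNIV \<times> V) f V M U z"
  unfolding implicit_solution_def Cpow_CARD
proof (intro conjI allI ballI impI)
  show "holomorphic_in mult_i2 (UNIV \<times> UNIV) (UNIV \<times> V) (\<lambda>x. f x $ b)" for b
    unfolding holomorphic_in_def
  proof (intro conjI ballI)
    show "openin (top_of_set (UNIV \<times> UNIV)) (UNIV \<times> V)"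
      using open_V by (simp add: open_Times)
    fix wv :: "'m cspace \<times> 'm cspace"
    assume "wv \<in> UNIV \<times> V"
    then obtain w v where wv: "wv = (w, v)" "v \<in> V"
      by blast
    obtain D where D: "((\<lambda>v. h v $ b) has_derivative D) (at v)" "\<And>w. D (mult_i w) = \<i> * D w"
      using holomorphic_inE[OF h_hol wv(2)] by blast
    have "((\<lambda>x. fst x $ b) has_derivative (\<lambda>x. fst x $ b)) (at wv)"
      by (intro has_derivative_vec_nth has_derivative_fst has_derivative_ident)
    moreover have "((\<lambda>x. h (snd x) $ b) has_derivative (\<lambda>x. D (snd x))) (at wv)"
      using D(1) wv(1)
      by (intro has_derivative_compose[where f = snd and g = "\<lambda>v. h v $ b"] has_derivative_snd
          has_derivative_ident) auto
    ultimately have "((\<lambda>x. f x $ b) has_derivative (\<lambda>x. fst x $ b - D (snd x))) (at wv)"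
      unfolding f_def split_def vector_minus_component by (rule has_derivative_diff)
    moreover have "fst (mult_i2 x) $ b = \<i> * fst x $ b" "snd (mult_i2 x) = mult_i (snd x)"
      for x :: "'m cspace \<times> 'm cspace"
      by (simp_all add: mult_i2_def mult_i_def)
    ultimately show "\<exists>D. ((\<lambda>x. f x $ b) has_derivative D) (at wv within UNIV \<times> UNIV) \<and>
        (\<forall>v\<in>UNIV \<times> UNIV. D (mult_i2 v) = \<i> * D v)"
      by (intro exI[of _ "\<lambda>x. fst x $ b - D (snd x)"])
        (simp add: D(2) algebra_simps)
  qed
  show "eqF f M q (z q) = 0" if "q \<in> U" for q
    using that h[OF z_mem] by (simp add: eqF_def f_def x_z)
  show "v = 0" if "q \<in> U" "Kmat f M q (z q) *v v = 0" for q v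
    using Kmat_injective that by blast
qed (use M_skew z_mem M_hol smooth_z in auto)

end

lemma rank_eq_CARD:
  fixes A :: "'a::field^'n::finite^'n"
  assumes "\<And>w. A *v w = 0 \<Longrightarrow> w = 0"
  shows "rank A = CARD('n)"
proof -
  have "\<exists>B. B ** A = Finite_Cartesian_Product.mat 1"
    unfolding matrix_left_invertible_ker using assms by blast
  then have span: "vec.span (Finite_Cartesian_Product.rows A) = UNIV"
    unfolding matrix_left_invertible_span_rows_gen .
  have "vec.dim (Finite_Cartesian_Product.rows A) = vec.dim (vec.span (Finite_Cartesian_Product.rows A))"
    by (rule vec.dim_span[symmetric])
  then show ?thesis
    unfolding row_rank_def_gen span vec_dim_card .
qed

section \<open>Coordinates with a prescribed component\<close>

context complex_chart
begin

text \<open>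
  One of the \<open>\<zeta>\<close> coordinates \<open>l\<close> with \<open>\<partial>\<phi>/\<partial>\<zeta>^l \<noteq> 0\<close> can be exchanged for \<open>\<phi>\<close>; the coordinate
  \<open>\<zeta>^k\<close>, whose place \<open>\<phi>\<close> takes, moves to the place \<open>l\<close>.
\<close>

lemma exchange_coordinate:
  fixes k :: 'm
  assumes p: "p \<in> N" and \<phi>: "J_holomorphic_on N J \<phi>" and surj: "surj (frechet_derivative \<phi> (at p))"
  obtains z where "smooth_on N z" "\<And>q. z q $ k = \<phi> q"
    "\<And>q X. q \<in> N \<Longrightarrow> frechet_derivative z (at q) (J q X) = mult_i (frechet_derivative z (at q) X)"
    "\<And>X. frechet_derivative z (at p) X = 0 \<Longrightarrow> X = 0"
proof -
  have smooth_\<phi>: "smooth_on N \<phi>"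
    using \<phi> by (simp add: J_holomorphic_on_def)
  define D\<phi> where "D\<phi> q = frechet_derivative \<phi> (at q)" for q
  have D\<phi>: "(\<phi> has_derivative D\<phi> q) (at q)" if "q \<in> N" for q
    unfolding D\<phi>_def using smooth_\<phi> that by (rule smooth_on_has_derivative)
  have D\<phi>_J: "D\<phi> q (J q X) = \<i> * D\<phi> q X" if "q \<in> N" for q X
    using \<phi> that by (simp add: J_holomorphic_on_def D\<phi>_def)
  let ?D\<zeta> = "\<lambda>q. frechet_derivative \<zeta> (at q)"
  let ?u = "\<zeta> p"
  have u: "?u \<in> \<zeta> ` N" "y ?u = p"
    using p by (auto simp: y_\<zeta>)
  \<comment> \<open>In chart coordinates the differential of \<phi> is complex linear, so its
    complex partial derivatives determine it.\<close>
  have D\<phi>_Dy: "D\<phi> p (Dy ?u v) = (\<Sum>a\<in>UNIV. D\<phi> p (Dy ?u (axis a 1)) * v $ a)" for v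
  proof -
    have D: "((\<lambda>u. \<phi> (y u)) has_derivative (\<lambda>v. D\<phi> p (Dy ?u v))) (at ?u)"
      using Dy[OF u(1)] D\<phi>[OF p] u(2) by (intro has_derivative_compose[where f = y and g = \<phi>]) auto
    have "D\<phi> p (Dy ?u (mult_i v)) = \<i> * D\<phi> p (Dy ?u v)" for v
      using D\<phi>_J[OF p] J_Dy[OF u(1), of v] u(2) by metis
    note eq = cpartial_eq[OF D this]
    show ?thesis
      unfolding eq(2)[of v] eq(1) ..
  qed
  obtain l where l: "D\<phi> p (Dy ?u (axis l 1)) \<noteq> 0"
  proof -
    obtain X where "D\<phi> p X = 1"
      using surj unfolding D\<phi>_def by (metis surjD)
    then have "D\<phi> p (Dy ?u (?D\<zeta> p X)) = 1"
      using Dy_D\<zeta>[OF u(1)] u(2) by simp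
    then have "(\<Sum>a\<in>UNIV. D\<phi> p (Dy ?u (axis a 1)) * ?D\<zeta> p X $ a) \<noteq> 0"
      unfolding D\<phi>_Dy[of "?D\<zeta> p X"] by simp
    then have "\<exists>l. D\<phi> p (Dy ?u (axis l 1)) \<noteq> 0"
      by (metis (no_types, lifting) mult_zero_left sum.neutral)
    then show thesis
      using that by blast
  qed
  \<comment> \<open>Slot k is emptied for \<phi>, and the old k-th coordinate is stored in slot l,
    overwriting the l-th. For l = k only the emptying takes place.\<close>
  define L where "L w = (\<chi> b. if b = k then 0 else if b = l then w $ k else w $ b)" for w :: "'m cspace"
  define z where "z q = L (\<zeta> q) + axis k (\<phi> q)" for q
  have "linear L"
    by (rule linearI) (auto simp: L_def cart_eq_iff)
  then have L: "bounded_linear L"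
    by (simp add: linear_conv_bounded_linear)
  have "linear (axis k :: complex \<Rightarrow> 'm cspace)"
    by (rule linearI) (auto simp: axis_def cart_eq_iff)
  then have axis: "bounded_linear (axis k :: complex \<Rightarrow> 'm cspace)"
    by (simp add: linear_conv_bounded_linear)
  have Dz: "frechet_derivative z (at q) = (\<lambda>X. L (?D\<zeta> q X) + axis k (D\<phi> q X))" if "q \<in> N" for q
  proof (rule frechet_derivative_at[symmetric])
    show "(z has_derivative (\<lambda>X. L (?D\<zeta> q X) + axis k (D\<phi> q X))) (at q)"
      unfolding z_def[abs_def]
      by (rule has_derivative_add[OF bounded_linear.has_derivative[OF L D\<zeta>[OF that]]
            bounded_linear.has_derivative[OF axis D\<phi>[OF that]]])
  qed
  show thesis
  proof
    show "smooth_on N z"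
      unfolding z_def[abs_def]
      by (rule smooth_on_add[OF open_N smooth_on_bounded_linear[OF open_N L smooth]
            smooth_on_bounded_linear[OF open_N axis smooth_\<phi>]])
    show "z q $ k = \<phi> q" for q
      by (simp add: z_def L_def axis_def)
    show "frechet_derivative z (at q) (J q X) = mult_i (frechet_derivative z (at q) X)" if "q \<in> N" for q X
      unfolding Dz[OF that] D\<zeta>_J[OF that] D\<phi>_J[OF that]
      by (auto simp: L_def mult_i_def axis_def cart_eq_iff)
    fix X
    assume "frechet_derivative z (at p) X = 0"
    then have 0: "L (?D\<zeta> p X) $ b + axis k (D\<phi> p X) $ b = 0" for b
      unfolding Dz[OF p] by (metis vector_add_component zero_index)
    define v where "v = ?D\<zeta> p X"
    have X: "X = Dy ?u v"
      using Dy_D\<zeta>[OF u(1)] u(2) by (simp add: v_def)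
    \<comment> \<open>The unchanged slots give this for b different from k and l; for b = k the
      value is found in slot l. The remaining component is killed by \<phi>, whose l-th derivative
      is nonzero.\<close>
    have v: "v $ b = 0" if "b \<noteq> l" for b
      using 0[of b] 0[of l] that by (cases "b = k"; cases "k = l") (auto simp: L_def axis_def v_def)
    have "D\<phi> p X = 0"
      using 0[of k] by (simp add: L_def axis_def)
    then have "(\<Sum>a\<in>UNIV. D\<phi> p (Dy ?u (axis a 1)) * v $ a) = 0"
      unfolding X D\<phi>_Dy[of v] .
    moreover have "(\<Sum>a\<in>UNIV. D\<phi> p (Dy ?u (axis a 1)) * v $ a) =
        (\<Sum>a\<in>{l}. D\<phi> p (Dy ?u (axis a 1)) * v $ a)"
      by (rule sum.mono_neutral_right) (auto simp: v)
    ultimately have "v $ l = 0"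
      using l by simp
    with v have "v = 0"
      by (metis cart_eq_iff zero_index)
    then show "X = 0"
      unfolding X using linear_0[OF linear_Dy[OF u(1)]] by simp
  qed
qed

text \<open>The inverse function theorem asks for a derivative that is continuous as a map into
  bounded linear maps, which is checked vector by vector. A first derivative of the inverse
  suffices, since holomorphy in z is a first-order condition.\<close>

lemma local_inverse:
  fixes z :: "'m cspace \<Rightarrow> 'm cspace"
  assumes p: "p \<in> N" and W: "open W" "p \<in> W" "W \<subseteq> N" and z: "smooth_on N z"
    and inj: "\<And>X. frechet_derivative z (at p) X = 0 \<Longrightarrow> X = 0"
  obtains U V x Dx where "open U" "U \<subseteq> W" "p \<in> U" "open V" "homeomorphism U V z x"
    "\<And>v. v \<in> V \<Longrightarrow> (x has_derivative Dx v) (at v)"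
proof -
  define z' where "z' q = Blinfun (frechet_derivative z (at q))" for q
  have Dz: "(z has_derivative frechet_derivative z (at q)) (at q)" if "q \<in> N" for q
    using z that by (rule smooth_on_has_derivative)
  then have z': "blinfun_apply (z' q) = frechet_derivative z (at q)" if "q \<in> N" for q
    unfolding z'_def using that has_derivative_bounded_linear by (intro bounded_linear_Blinfun_apply) blast
  have "linear (frechet_derivative z (at p))"
    by (rule has_derivative_linear[OF Dz[OF p]])
  moreover have "inj (frechet_derivative z (at p))"
    using inj by (simp add: linear_injective_0[OF calculation])
  ultimately obtain g where g: "linear g" "g \<circ> frechet_derivative z (at p) = id"
    using linear_injective_left_inverse by blast
  have "continuous_on W z'"
  proof (rule continuous_on_blinfun_componentwise)
    fix e :: "'m cspace"
    have "continuous_on W (\<lambda>q. frechet_derivative z (at q) e)"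
      using smooth_on_subset[OF smooth_on_frechet[OF z, of e] W(3)]
      unfolding smooth_on_def using Ck_on_imp_continuous_on by blast
    then show "continuous_on W (\<lambda>q. blinfun_apply (z' q) e)"
      by (rule continuous_on_eq) (use W(3) z' in auto)
  qed
  moreover have "(z has_derivative blinfun_apply (z' q)) (at q)" if "q \<in> W" for q
    using Dz[of q] z'[of q] that W(3) by auto
  moreover have "Blinfun g o\<^sub>L z' p = id_blinfun"
  proof (rule blinfun_eqI)
    have "bounded_linear g"
      using g(1) by (simp add: linear_conv_bounded_linear)
    then show "blinfun_apply (Blinfun g o\<^sub>L z' p) X = blinfun_apply id_blinfun X" for X
      using g by (simp add: z'[OF p] bounded_linear_Blinfun_apply fun_eq_iff)
  qed
  ultimately obtain U V x x' where UV: "open U" "U \<subseteq> W" "p \<in> U" "open V" "homeomorphism U V z x"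
    "\<And>v. v \<in> V \<Longrightarrow> (x has_derivative x' v) (at v)"
    using inverse_function_theorem[of W z z' p "Blinfun g"] W(1,2) by metis
  show thesis
    by (rule that[OF UV])
qed

end

text \<open>The change from z to the chart coordinates has a derivative \<open>E\<close> that is
  injective, and complex linear because both systems are J-holomorphic. Holomorphy of M and h and
  the rank condition, known in the chart, therefore pass to z.\<close>

lemma adapted_coordinates:
  fixes N :: "'m::{finite,linorder} cspace set" and k :: 'm
  assumes chart: "complex_chart N \<zeta> J" and p: "p \<in> N" "J p \<in> large_cell"
    and \<phi>: "J_holomorphic_on N J \<phi>" and surj: "surj (frechet_derivative \<phi> (at p))"
  obtains U V z x Dx M h where "U \<subseteq> N" "p \<in> U" "\<And>q. z q $ k = \<phi> q"
    "\<And>v. v \<in> V \<Longrightarrow> rank (cjacobian (recentred p M h) v) = CARD('m)"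
    "implicit_coordinates U V z x Dx M h J"
proof -
  interpret complex_chart N \<zeta> J
    by (rule chart)
  obtain z where z: "smooth_on N z" "\<And>q. z q $ k = \<phi> q"
    "\<And>q X. q \<in> N \<Longrightarrow> frechet_derivative z (at q) (J q X) = mult_i (frechet_derivative z (at q) X)"
    "\<And>X. frechet_derivative z (at p) X = 0 \<Longrightarrow> X = 0"
    using exchange_coordinate[OF p(1) \<phi> surj, of k] by blast
  \<comment> \<open>On this set M is defined and the recentred h has a nonsingular
    derivative.\<close>
  define W where "W = \<zeta> -` V2 p \<inter> N"
  have "continuous_on N \<zeta>"
    using smooth Ck_on_imp_continuous_on smooth_on_def by blast
  then have "open W"
    unfolding W_def using open_V2 open_N by (simp add: continuous_on_open_vimage)
  moreover have "p \<in> W" "W \<subseteq> N"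
    using large_cell_mem_V2[OF p] p(1) by (auto simp: W_def)
  ultimately obtain U V x Dx where U: "open U" "U \<subseteq> W" "p \<in> U" and V: "open V"
    and hom: "homeomorphism U V z x" and Dx: "\<And>v. v \<in> V \<Longrightarrow> (x has_derivative Dx v) (at v)"
    using local_inverse[OF p(1) _ _ _ z(1,4), of W] by metis
  have zx: "\<And>q. q \<in> U \<Longrightarrow> z q \<in> V" "\<And>q. q \<in> U \<Longrightarrow> x (z q) = q" "\<And>v. v \<in> V \<Longrightarrow> z (x v) = v"
    "\<And>v. v \<in> V \<Longrightarrow> x v \<in> U"
    using hom by (auto simp: homeomorphism_def)
  have UN: "q \<in> N" "\<zeta> q \<in> V2 p" "\<zeta> q \<in> V1" if "q \<in> U" for q
    using U(2) that by (auto simp: W_def V2_def)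
  define M where "M v = Mt (\<zeta> (x v))" for v
  define h where "h v = ht (\<zeta> (x v))" for v
  define E where "E v w = frechet_derivative \<zeta> (at (x v)) (Dx v w)" for v w
  have \<zeta>x: "((\<lambda>v. \<zeta> (x v)) has_derivative E v) (at v)" if "v \<in> V" for v
    unfolding E_def using Dx[OF that] D\<zeta>[OF UN(1)[OF zx(4)[OF that]]] by (rule has_derivative_compose)
  have Dz_Dx: "frechet_derivative z (at (x v)) (Dx v w) = w" if "v \<in> V" for v w
  proof -
    have "((\<lambda>v. z (x v)) has_derivative (\<lambda>w. frechet_derivative z (at (x v)) (Dx v w))) (at v)"
      using Dx[OF that] smooth_on_has_derivative[OF z(1) UN(1)[OF zx(4)[OF that]]]
      by (rule has_derivative_compose)
    moreover have "((\<lambda>v. z (x v)) has_derivative (\<lambda>w. w)) (at v)"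
      by (rule has_derivative_transform_within_open[OF has_derivative_ident V that]) (simp add: zx)
    ultimately show ?thesis
      by (metis has_derivative_unique)
  qed
  have Dx_Dz: "Dx v (frechet_derivative z (at (x v)) X) = X" if "v \<in> V" for v X
  proof -
    have "((\<lambda>q. x (z q)) has_derivative (\<lambda>X. Dx v (frechet_derivative z (at (x v)) X))) (at (x v))"
      using Dx[OF that] smooth_on_has_derivative[OF z(1) UN(1)[OF zx(4)[OF that]]] zx(3)[OF that]
      by (intro has_derivative_compose[where f = z and g = x]) auto
    moreover have "((\<lambda>q. x (z q)) has_derivative (\<lambda>X. X)) (at (x v))"
      by (rule has_derivative_transform_within_open[OF has_derivative_ident U(1) zx(4)[OF that]])
        (simp add: zx)
    ultimately show ?thesis
      by (metis has_derivative_unique)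
  qed
  \<comment> \<open>J-holomorphy of z, read through its inverse.\<close>
  have Dx_i: "Dx v (mult_i w) = J (x v) (Dx v w)" if "v \<in> V" for v w
    using z(3)[OF UN(1)[OF zx(4)[OF that]], of "Dx v w"] Dx_Dz[OF that] Dz_Dx[OF that] by metis
  have E_i: "E v (mult_i w) = mult_i (E v w)" if "v \<in> V" for v w
    unfolding E_def Dx_i[OF that] by (rule D\<zeta>_J[OF UN(1)[OF zx(4)[OF that]]])
  have E_inj: "w = 0" if "v \<in> V" "E v w = 0" for v w
  proof -
    have "\<zeta> (x v) \<in> \<zeta> ` N" "y (\<zeta> (x v)) = x v"
      using UN(1)[OF zx(4)[OF that(1)]] by (auto simp: y_\<zeta>)
    then have "Dx v w = Dy (\<zeta> (x v)) (E v w)"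
      unfolding E_def using Dy_D\<zeta> by metis
    then have "Dx v w = 0"
      using that(2) linear_0[OF linear_Dy[OF \<open>\<zeta> (x v) \<in> \<zeta> ` N\<close>]] by simp
    then show "w = 0"
      using Dz_Dx[OF that(1), of w] linear_0[OF smooth_on_linear[OF z(1) UN(1)[OF zx(4)[OF that(1)]]]]
      by simp
  qed
  have DM: "((\<lambda>v. M v $ i $ j) has_derivative
      (\<lambda>w. frechet_derivative (\<lambda>u. Mt u $ i $ j) (at (\<zeta> (x v))) (E v w))) (at v)" if "v \<in> V" for v i j
    unfolding M_def
    by (rule has_derivative_compose[OF \<zeta>x[OF that] Mt_has_derivative[OF UN(3)[OF zx(4)[OF that]]]])
  have Dh: "((\<lambda>v. h v $ i) has_derivative
      (\<lambda>w. frechet_derivative (\<lambda>u. ht u $ i) (at (\<zeta> (x v))) (E v w))) (at v)" if "v \<in> V" for v i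
    unfolding h_def
    by (rule has_derivative_compose[OF \<zeta>x[OF that] Ck_on_Suc_has_derivative[OF Ck_on_ht UN(3)[OF zx(4)[OF that]]]])
  have cl: "frechet_derivative (\<lambda>u. Mt u $ i $ j) (at (\<zeta> (x v))) (E v (mult_i w)) =
      \<i> * frechet_derivative (\<lambda>u. Mt u $ i $ j) (at (\<zeta> (x v))) (E v w)"
    "frechet_derivative (\<lambda>u. ht u $ i) (at (\<zeta> (x v))) (E v (mult_i w)) =
      \<i> * frechet_derivative (\<lambda>u. ht u $ i) (at (\<zeta> (x v))) (E v w)" if "v \<in> V" for v w i j
    unfolding E_i[OF that] by (rule Mt_ht_complex_linear[OF UN(3)[OF zx(4)[OF that]]])+
  have rank: "rank (cjacobian (recentred p M h) v) = CARD('m)" if v: "v \<in> V" for v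
  proof (rule rank_eq_CARD)
    fix w
    assume w: "cjacobian (recentred p M h) v *v w = 0"
    \<comment> \<open>The chain rule: the Jacobian in the coordinates z is \<open>Rm p\<close>
      composed with \<open>E\<close>, and both factors are injective.\<close>
    have "(cjacobian (recentred p M h) v *v w) $ i = (Rm p (\<zeta> (x v)) *v E v w) $ i" for i
    proof -
      let ?D = "\<lambda>w. frechet_derivative (\<lambda>u. ht u $ i) (at (\<zeta> (x v))) (E v w) +
        (\<Sum>j\<in>UNIV. frechet_derivative (\<lambda>u. Mt u $ i $ j) (at (\<zeta> (x v))) (E v w) * cnj (p $ j))"
      have "((\<lambda>v. h v $ i + (\<Sum>j\<in>UNIV. M v $ i $ j * cnj (p $ j)) - p $ i) has_derivative (\<lambda>w. ?D w - 0)) (at v)"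
        by (intro has_derivative_diff has_derivative_add has_derivative_sum has_derivative_mult_left
            has_derivative_const Dh DM v)
      then have D: "((\<lambda>v. recentred p M h v $ i) has_derivative ?D) (at v)"
        by (simp add: recentred_def matrix_vector_mult_def algebra_simps)
      have "?D (mult_i w) = \<i> * ?D w" for w
        by (simp add: cl[OF v] sum_distrib_left algebra_simps)
      from cpartial_eq(2)[OF D this]
      have "(cjacobian (recentred p M h) v *v w) $ i = ?D w"
        by (simp add: cjacobian_def matrix_vector_mult_def)
      then show ?thesis
        by (simp add: Rm_mult[OF UN(3)[OF zx(4)[OF v]]])
    qed
    then have "Rm p (\<zeta> (x v)) *v E v w = 0"
      using w by (simp add: cart_eq_iff)
    moreover have "invertible (Rm p (\<zeta> (x v)))"
      using UN(2)[OF zx(4)[OF v]] by (simp add: V2_def invertible_det_nz)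
    ultimately have "E v w = 0"
      unfolding invertible_left_inverse matrix_left_invertible_ker by blast
    then show "w = 0"
      by (rule E_inj[OF v])
  qed
  have "U \<subseteq> N"
    using UN(1) by blast
  have "implicit_coordinates U V z x Dx M h J"
  proof
    show "is_J_of (M v) (J (x v))" "M v \<in> so_complex" if "v \<in> V" for v
      using is_J_of_Mt[OF UN(3)[OF zx(4)[OF that]]] y_\<zeta>[OF UN(1)[OF zx(4)[OF that]]]
      by (simp_all add: M_def)
    show "h v = x v - M v *v vcnj (x v)" if "v \<in> V" for v
      using y_\<zeta>[OF UN(1)[OF zx(4)[OF that]]] by (simp add: h_def M_def ht_def)
    show "holomorphic_in mult_i UNIV V (\<lambda>v. M v $ i $ j)" for i j
      unfolding holomorphic_in_def
    proof (intro conjI ballI)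
      fix v
      assume "v \<in> V"
      then show "\<exists>D. ((\<lambda>v. M v $ i $ j) has_derivative D) (at v) \<and> (\<forall>w\<in>UNIV. D (mult_i w) = \<i> * D w)"
        using DM cl(1) by (intro exI conjI) auto
    qed (simp add: V)
    show "holomorphic_in mult_i UNIV V (\<lambda>v. h v $ i)" for i
      unfolding holomorphic_in_def
    proof (intro conjI ballI)
      fix v
      assume "v \<in> V"
      then show "\<exists>D. ((\<lambda>v. h v $ i) has_derivative D) (at v) \<and> (\<forall>w\<in>UNIV. D (mult_i w) = \<i> * D w)"
        using Dh cl(2) by (intro exI conjI) auto
    qed (simp add: V)
    show "smooth_on U z"
      by (rule smooth_on_subset[OF z(1) \<open>U \<subseteq> N\<close>])
    show "frechet_derivative z (at q) (J q X) = mult_i (frechet_derivative z (at q) X)" if "q \<in> U" for q X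
      by (rule z(3)[OF UN(1)[OF that]])
  qed (use U V zx Dx in simp_all)
  then show thesis
    using that \<open>U \<subseteq> N\<close> U(3) z(2) rank by blast
qed

text \<open>The quadratic condition on a harmonic morphism is isotropy of the (1,0)-form d\<phi>
  paired with itself.\<close>

lemma harmonic_J_holomorphic:
  fixes \<phi> :: "'a::euclidean_space \<Rightarrow> complex"
  assumes J: "\<And>q. q \<in> U \<Longrightarrow> almost_hermitian_at (J q)" and \<phi>: "J_holomorphic_on U J \<phi>"
    and "\<forall>q\<in>U. laplacian \<phi> q = 0"
  shows "harmonic_morphism_on U \<phi>"
  unfolding harmonic_morphism_on_def
proof (intro conjI ballI)
  show smooth: "smooth_on U \<phi>"
    using \<phi> by (simp add: J_holomorphic_on_def)
  fix q
  assume q: "q \<in> U"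
  show "laplacian \<phi> q = 0"
    using assms(3) q by blast
  have "linear (frechet_derivative \<phi> (at q))"
    by (rule smooth_on_linear[OF smooth q])
  moreover have "frechet_derivative \<phi> (at q) (J q X) = \<i> * frechet_derivative \<phi> (at q) X" for X
    using \<phi> q by (simp add: J_holomorphic_on_def)
  ultimately show "(\<Sum>e\<in>Basis. (frechet_derivative \<phi> (at q) e)\<^sup>2) = 0"
    unfolding power2_eq_square by (intro J_holomorphic_forms_isotropic[OF J[OF q]])
qed

text \<open>Suitable conjugations leave no nonzero (1,0)-form without dq-part, and the dimension
  count of \<open>theta_in_cotangent10_exists\<close> then provides M. Positivity for the new
  orientation follows from \<open>is_J_of_theta\<close>.\<close>

lemma large_cell_exists:
  fixes J :: "'m::finite cspace \<Rightarrow> 'm cspace \<Rightarrow> 'm cspace"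
  assumes J: "almost_hermitian_at (J q)"
  shows "\<exists>T. coordinate_permutation T \<and> push_acs T J (T q) \<in> large_cell"
proof -
  obtain S where S: "\<And>\<alpha> :: 'm cspace \<Rightarrow> complex. linear \<alpha> \<Longrightarrow> \<alpha> \<circ> conj_on S \<in> cotangent10 (J q) \<Longrightarrow>
      (\<And>i. hol_coeff \<alpha> i = 0) \<Longrightarrow> \<alpha> = (\<lambda>X. 0)"
    using conj_on_exists[OF J] by blast
  let ?T = "conj_on S :: 'm cspace \<Rightarrow> 'm cspace"
  let ?J = "push_acs ?T J (?T q)"
  have T: "coordinate_permutation ?T"
    by (rule coordinate_permutation_conj_on)
  note orth = coordinate_permutation_orthogonal[OF T]
  have J': "almost_hermitian_at ?J"
    using J by (intro almost_hermitian_push[OF orth]) (simp add: orthogonal_transformation_inverse[OF orth])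
  have "\<alpha> = (\<lambda>X. 0)" if "\<alpha> \<in> cotangent10 ?J" "\<And>i. hol_coeff \<alpha> i = 0" for \<alpha>
    using that cotangent10_push[OF orth that(1)] by (intro S) (auto simp: cotangent10_def)
  then obtain M where \<theta>: "\<And>i. theta M i \<in> cotangent10 ?J"
    using theta_in_cotangent10_exists[OF J'] by blast
  then have "?J \<in> large_cell"
    using is_J_of_theta[OF J' \<theta>] theta_in_cotangent10_skew[OF J' \<theta>] by (auto simp: large_cell_def)
  then show ?thesis
    using T by blast
qed

section \<open>Transport by a coordinate permutation\<close>

lemma push_J_holomorphic_on:
  fixes \<phi> :: "'m::finite cspace \<Rightarrow> complex"
  assumes T: "orthogonal_transformation T" and N: "open N" and \<phi>: "J_holomorphic_on N J \<phi>"
  shows "J_holomorphic_on (T ` N) (push_acs T J) (\<phi> \<circ> inv_into UNIV T)"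
proof -
  note T' = orthogonal_transformation_inverse[OF T]
  let ?T' = "inv_into UNIV T"
  have image: "T ` N = ?T' -` N"
    using T' by (metis bij_image_Collect_eq bij_vimage_eq_inv_image inv_inv_eq bij_imp_bij_inv)
  have smooth: "smooth_on N \<phi>"
    using \<phi> by (simp add: J_holomorphic_on_def)
  have "smooth_on (T ` N) (\<phi> \<circ> ?T')"
    unfolding image o_def by (rule smooth_on_compose_linear[OF N T'(8) smooth])
  moreover have "frechet_derivative (\<phi> \<circ> ?T') (at p) (push_acs T J p X) =
      \<i> * frechet_derivative (\<phi> \<circ> ?T') (at p) X" if "p \<in> T ` N" for p X
  proof -
    have p: "?T' p \<in> N"
      using that by (simp add: image)
    have "frechet_derivative (\<phi> \<circ> ?T') (at p) = (\<lambda>X. frechet_derivative \<phi> (at (?T' p)) (?T' X))"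
      unfolding o_def
      by (rule frechet_derivative_at[symmetric],
          rule has_derivative_compose[OF bounded_linear_imp_has_derivative[OF T'(8)] smooth_on_has_derivative[OF smooth p]])
    then show ?thesis
      using \<phi> p by (simp add: push_acs_def T' J_holomorphic_on_def)
  qed
  ultimately show ?thesis
    by (simp add: J_holomorphic_on_def)
qed

text \<open>The image of the chart does not change; its inverse is only followed by the linear map
  T, and the chart itself is preceded by the inverse of T.\<close>

lemma push_complex_chart:
  fixes \<zeta> :: "'m::finite cspace \<Rightarrow> 'm cspace"
  assumes T: "orthogonal_transformation T" and "complex_chart N \<zeta> J"
  shows "complex_chart (T ` N) (\<zeta> \<circ> inv_into UNIV T) (push_acs T J)"
proof -
  interpret complex_chart N \<zeta> J
    by fact
  note T' = orthogonal_transformation_inverse[OF T]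
  let ?T' = "inv_into UNIV T"
  have vimage: "T ` N = ?T' -` N"
    using T' by (metis bij_vimage_eq_inv_image inv_inv_eq bij_imp_bij_inv)
  have image: "(\<zeta> \<circ> ?T') ` T ` N = \<zeta> ` N"
    by (auto simp: T' image_image)
  show ?thesis
  proof
    show "open (T ` N)"
      unfolding vimage using open_N T'(8)
      by (simp add: continuous_open_vimage linear_continuous_at)
    show "almost_hermitian_at (push_acs T J q)" if "q \<in> T ` N" for q
      using that J by (intro almost_hermitian_push[OF T]) (auto simp: T')
    show "smooth_on (T ` N) (\<zeta> \<circ> ?T')"
      unfolding vimage o_def by (rule smooth_on_compose_linear[OF open_N T'(8) smooth])
    show inj': "inj_on (\<zeta> \<circ> ?T') (T ` N)"
      using inj by (auto simp: inj_on_def T')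
    show "open ((\<zeta> \<circ> ?T') ` T ` N)"
      unfolding image by (rule open_image)
    show "smooth_on ((\<zeta> \<circ> ?T') ` T ` N) (inv_into (T ` N) (\<zeta> \<circ> ?T'))"
      unfolding image
    proof (rule smooth_on_cong[OF open_image _ smooth_on_bounded_linear[OF open_image T'(6) smooth_inv]])
      fix u
      assume "u \<in> \<zeta> ` N"
      then obtain q where q: "q \<in> N" "u = \<zeta> q"
        by blast
      have "inv_into (T ` N) (\<zeta> \<circ> ?T') ((\<zeta> \<circ> ?T') (T q)) = T q"
        using q by (intro inv_into_f_f inj') auto
      then show "T (inv_into N \<zeta> u) = inv_into (T ` N) (\<zeta> \<circ> ?T') u"
        using q inj by (simp add: T')
    qed
    show "J_holomorphic_on (T ` N) (push_acs T J) (\<lambda>q. (\<zeta> \<circ> ?T') q $ i)" for i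
      using push_J_holomorphic_on[OF T open_N holomorphic[of i]] by (simp add: o_def)
  qed
qed

theorem proposition3p18:
  fixes U :: "'m::{finite,linorder} cspace set"
    and J :: "'m cspace \<Rightarrow> 'm cspace \<Rightarrow> 'm cspace"
    and \<phi> :: "'m cspace \<Rightarrow> complex"
    and q\<^sub>0 :: "'m cspace"
  assumes "open U"
    and "hermitian_on U J"
    and "J_holomorphic_on U J \<phi>"
    and "q\<^sub>0 \<in> U"
    and "surj (frechet_derivative \<phi> (at q\<^sub>0))"
  shows
    "((\<forall>q\<in>U. laplacian \<phi> q = 0) \<longrightarrow> harmonic_morphism_on U \<phi>) \<and>
     (\<exists>T. coordinate_permutation T \<and> positive_acs (push_acs T J (T q\<^sub>0)) \<and>
          push_acs T J (T q\<^sub>0) \<in> large_cell) \<and>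
     (\<forall>T. coordinate_permutation T \<and> push_acs T J (T q\<^sub>0) \<in> large_cell \<longrightarrow>
       (\<exists>U' k W f V M z.
          open U' \<and> T q\<^sub>0 \<in> U' \<and> U' \<subseteq> T ` U \<and> 1 \<le> k \<and> k \<le> CARD('m) \<and>
          implicit_solution k W f V M U' z \<and>
          (\<forall>q\<in>U'. (\<phi> \<circ> inv_into UNIV T) q = z q $ Min UNIV) \<and>
          (\<forall>q\<in>U'. is_J_of (M (z q)) (push_acs T J q)) \<and>
          (\<forall>q\<in>U'. \<forall>a. idx a \<le> k \<longrightarrow>
             1 / 4 * laplacian (\<lambda>q. z q $ a) q =
             - (\<Sum>i\<in>UNIV. \<Sum>j\<in>UNIV. \<Sum>b | idx b \<le> k.
                  wirtinger (\<lambda>q. z q $ a) i q * wirtinger (\<lambda>q. z q $ b) j q *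
                  cpartial (\<lambda>z. M z $ i $ j) b (z q)))) \<and>
       (\<exists>U' f h V M z.
          open U' \<and> T q\<^sub>0 \<in> U' \<and> U' \<subseteq> T ` U \<and>
          f = (\<lambda>(w, z). w - h z) \<and>
          (\<forall>b. holomorphic_in mult_i UNIV V (\<lambda>z. h z $ b)) \<and>
          (\<forall>\<zeta>\<in>V. rank (cjacobian (recentred (T q\<^sub>0) M h) \<zeta>) = CARD('m)) \<and>
          implicit_solution CARD('m) (UNIV \<times> V) f V M U' z \<and>
          (\<forall>q\<in>U'. (\<phi> \<circ> inv_into UNIV T) q = z q $ Min UNIV) \<and>
          (\<forall>q\<in>U'. is_J_of (M (z q)) (push_acs T J q)) \<and>
          (\<forall>q\<in>U'. Determinants.det (Kmat f M q (z q)) \<noteq> 0 \<and>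
             (\<forall>a. 1 / 4 * laplacian (\<lambda>q. z q $ a) q =
               (-1) ^ idx a / Determinants.det (Kmat f M q (z q)) *
               (\<Sum>(i, j) | i < j. (-1) ^ (idx i + idx j - 1) *
                  Ddet (\<lambda>c. cpartial (\<lambda>z. M z $ i $ j) c (z q)) (Kmat f M q (z q)) a i j)))))"
    (is "?harmonic \<and> ?cell \<and> (\<forall>T. ?large T \<longrightarrow> ?ii T \<and> ?iii T)")
proof -
  have J: "almost_hermitian_at (J q)" if "q \<in> U" for q
    using assms(2) that by (simp add: hermitian_on_def almost_hermitian_on_def)
  have ?harmonic
    using harmonic_J_holomorphic[OF J assms(3)] by blast
  moreover have ?cell
    using large_cell_exists[of J, OF J[OF assms(4)]] by (auto simp: large_cell_def is_J_of_def)
  moreover have "?ii T \<and> ?iii T" if large: "?large T" for T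
  proof -
    have orth: "orthogonal_transformation T"
      by (rule coordinate_permutation_orthogonal[OF conjunct1[OF large]])
    note T' = orthogonal_transformation_inverse[OF orth]
    let ?J = "push_acs T J" and ?\<phi> = "\<phi> \<circ> inv_into UNIV T"
    obtain N and \<zeta> :: "'m cspace \<Rightarrow> 'm cspace" where N\<zeta>: "open N \<and> q\<^sub>0 \<in> N \<and> N \<subseteq> U \<and> smooth_on N \<zeta> \<and> inj_on \<zeta> N \<and>
        open (\<zeta> ` N) \<and> smooth_on (\<zeta> ` N) (inv_into N \<zeta>) \<and> (\<forall>i. J_holomorphic_on N J (\<lambda>q. \<zeta> q $ i))"
      using assms(2)[unfolded hermitian_on_def integrable_acs_on_def, THEN conjunct2, THEN bspec, OF assms(4)]
      by (elim exE) (rule that)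
    then have N: "open N" "q\<^sub>0 \<in> N" "N \<subseteq> U"
      by simp_all
    have "complex_chart N \<zeta> J"
      using N\<zeta> J by (intro complex_chart.intro) (simp_all add: subset_iff)
    then have chart: "complex_chart (T ` N) (\<zeta> \<circ> inv_into UNIV T) ?J"
      by (rule push_complex_chart[OF orth])
    have "J_holomorphic_on N J \<phi>"
      using assms(3) N(3) smooth_on_subset unfolding J_holomorphic_on_def by blast
    then have \<phi>: "J_holomorphic_on (T ` N) ?J ?\<phi>"
      by (rule push_J_holomorphic_on[OF orth N(1)])
    have "(\<phi> has_derivative frechet_derivative \<phi> (at q\<^sub>0)) (at (inv_into UNIV T (T q\<^sub>0)))"
      using smooth_on_has_derivative[of U \<phi> q\<^sub>0] assms(3,4) by (simp add: T' J_holomorphic_on_def)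
    from has_derivative_compose[OF bounded_linear_imp_has_derivative[OF T'(8)] this]
    have "frechet_derivative ?\<phi> (at (T q\<^sub>0)) = frechet_derivative \<phi> (at q\<^sub>0) \<circ> inv_into UNIV T"
      unfolding o_def by (rule frechet_derivative_at[symmetric])
    then have surj: "surj (frechet_derivative ?\<phi> (at (T q\<^sub>0)))"
      using comp_surj[OF bij_is_surj[OF bij_imp_bij_inv[OF T'(1)]] assms(5)] by simp
    \<comment> \<open>Placing \<phi> at the least index, whose \<open>idx\<close> is 1, makes it
      z^1. The same U', M and z serve for both (ii) and (iii).\<close>
    obtain U' V z x Dx M h where z: "U' \<subseteq> T ` N" "T q\<^sub>0 \<in> U'" "\<And>q. z q $ Min UNIV = ?\<phi> q"
      "\<And>v. v \<in> V \<Longrightarrow> rank (cjacobian (recentred (T q\<^sub>0) M h) v) = CARD('m)"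
      and impl: "implicit_coordinates U' V z x Dx M h ?J"
      by (rule adapted_coordinates[where k = "Min UNIV", OF chart imageI[OF N(2)] conjunct2[OF large] \<phi> surj]) (rule that)
    interpret implicit_coordinates U' V z x Dx M h ?J
      by (rule impl)
    have U': "U' \<subseteq> T ` U"
      using z(1) N(3) by blast
    have idx: "{b. idx b \<le> CARD('m)} = (UNIV :: 'm set)"
      by (simp add: idx_le_CARD)
    have "?ii T"
    proof (rule exI[of _ U'], rule exI[of _ "CARD('m)"], rule exI[of _ "UNIV \<times> V"], rule exI[of _ f],
        rule exI[of _ V], rule exI[of _ M], rule exI[of _ z], unfold idx, intro conjI ballI allI impI)
      show "1 \<le> CARD('m)"
        by (simp add: Suc_le_eq)
    qed (simp_all only: open_U z U' implicit_solution_f is_J_of_z laplacian_z order_refl)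
    moreover have "?iii T"
    proof (rule exI[of _ U'], rule exI[of _ f], rule exI[of _ h], rule exI[of _ V], rule exI[of _ M],
        rule exI[of _ z], intro conjI ballI allI)
      show "f = (\<lambda>(w, z). w - h z)"
        by (rule f_def)
      show "Determinants.det (Kmat f M q (z q)) \<noteq> 0" if "q \<in> U'" for q
        by (rule laplacian_z_det(1)[OF that])
      show "1 / 4 * laplacian (\<lambda>q. z q $ a) q = (-1) ^ idx a / Determinants.det (Kmat f M q (z q)) *
          (\<Sum>(i, j) | i < j. (-1) ^ (idx i + idx j - 1) *
            Ddet (\<lambda>c. cpartial (\<lambda>z. M z $ i $ j) c (z q)) (Kmat f M q (z q)) a i j)"
        if "q \<in> U'" for q a
        by (rule laplacian_z_det(2)[OF that])
    qed (simp_all only: open_U z U' implicit_solution_f is_J_of_z h_hol)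
    ultimately show ?thesis
      by blast
  qed
  ultimately show ?thesis
    by blast
qed

end
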